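(* Let $Q$ be a finite quiver with set of vertices $Q_0=\{1,\dots,r\}$ having at least one loop at every vertex (equivalently, the matrix of the Euler-Ringel form of $Q$ has only non-positive entries). Let $T$ be the Tits form of $Q$ and let $$s=\sum_{\lambda\in\mathcal{P}^{Q_0}}\ \prod_{k\ge1}\frac{q^{-T(\lambda_k)}}{(q^{-1})_{\lambda_k-\lambda_{k+1}}}\,x_k^{\lambda_k-\lambda_{k+1}}\ \in\ \mathbb{Q}(q)[[x_{ki}\mid k\ge1,\ 1\le i\le r]].$$ Then all coefficients (of monomials in the variables $x_{ki}$) of $$(q-1)\operatorname{Log}(s)$$ are polynomials in $q$ with non-negative coefficients.
   Context: $\mathbb{N}=\{0,1,2,\dots\}$. The Euler-Ringel form of $Q$ is the bilinear form on $\mathbb{Z}^{Q_0}$ given by $\chi(\alpha,\beta)=\sum_{i\in Q_0}\alpha_i\beta_i-\sum_{(a:i\to j)}\alpha_i\beta_j$ (second sum over all arrows $a$ of $Q$); the Tits form is $T(\alpha)=\chi(\alpha,\alpha)$. $\mathcal{P}$ is the set of all partitions (weakly decreasing sequences of non-negative integers with finitely many non-zero terms). For a multipartition $\lambda=(\lambda^i)_{i\in Q_0}\in\mathcal{P}^{Q_0}$ with $\lambda^i=(\lambda^i_1,\lambda^i_2,\dots)$, put $\lambda_k=(\lambda^i_k)_{i\in Q_0}\in\mathbb{N}^{Q_0}$ for $k\ge1$. For $\alpha\in\mathbb{N}^{Q_0}$, $x_k^\alpha=\prod_{i\in Q_0}x_{ki}^{\alpha_i}$ and $(q)_\alpha=\prod_{i\in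 Q_0}(q)_{\alpha_i}$, where $(q)_n=\prod_{j=1}^n(1-q^j)$ for $n\ge 0$; thus $(q^{-1})_\alpha=\prod_{i}\prod_{j=1}^{\alpha_i}(1-q^{-j})$. The series $s$ has constant term $1$. On the (commutative) algebra $\mathbb{Q}(q)[[x_{ki}\mid k\ge1,\,1\le i\le r]]$ the Adams operations $\psi_n$ ($n\ge1$) are given by substituting $q\mapsto q^n$, $x_{ki}\mapsto x_{ki}^n$. For a series $f$ with constant term $1$ the plethystic logarithm is $$\operatorname{Log}(f)=\sum_{n\ge1}\frac{\mu(n)}{n}\psi_n(\log f),$$ where $\mu$ is the Möbius function; it is inverse to the plethystic exponential $\operatorname{Exp}(g)=\exp\big(\sum_{n\ge1}\frac1n\psi_n(g)\big)$ defined on series $g$ with zero constant term. *)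

theory Defs
  imports
    "HOL-Library.Poly_Mapping"
    "HOL-Library.FuncSet"
    "HOL-Computational_Algebra.Computational_Algebra"
    "Graph_Theory.Digraph"
begin

section \<open>Formal power series in arbitrarily many commuting variables\<close>

text \<open>
  A monomial is a finitely supported exponent vector, and a series is an arbitrary family of
  coefficients indexed by monomials.
\<close>

typedef (overloaded) ('v, 'a) mfps = "UNIV :: (('v \<Rightarrow>\<^sub>0 nat) \<Rightarrow> 'a) set"
  morphisms mfps_nth Abs_mfps
  by simp

setup_lifting type_definition_mfps

lemma mfps_eqI: "(\<And>m. mfps_nth f m = mfps_nth g m) \<Longrightarrow> f = g"
  by (metis ext mfps_nth_inject)

lemma mfps_nth_Abs [simp]: "mfps_nth (Abs_mfps f) = f"
  by (simp add: Abs_mfps_inverse)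

lemma finite_exponent_splits:
  fixes m :: "'v \<Rightarrow>\<^sub>0 nat"
  shows "finite {(a, b). a + b = m}"
proof -
  let ?F = "{f. \<forall>x. (x \<in> Poly_Mapping.keys m \<longrightarrow> f x \<in> {..Max (Poly_Mapping.lookup m ` Poly_Mapping.keys m)}) \<and> (x \<notin> Poly_Mapping.keys m \<longrightarrow> f x = 0)}"
  have fin: "finite ?F"
    by (intro finite_set_of_finite_funs finite_keys finite_atMost)
  have le: "Poly_Mapping.lookup a \<in> ?F" if "a + b = m" for a b :: "'v \<Rightarrow>\<^sub>0 nat"
  proof -
    have 1: "Poly_Mapping.lookup a x \<le> Poly_Mapping.lookup m x" for x
      unfolding that[symmetric] by (simp add: lookup_add)
    have "Poly_Mapping.lookup a x \<le> Max (Poly_Mapping.lookup m ` Poly_Mapping.keys m)"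
      if "x \<in> Poly_Mapping.keys m" for x
      by (rule order_trans[OF 1 Max_ge]) (use that in simp_all)
    moreover have "Poly_Mapping.lookup a x = 0" if "x \<notin> Poly_Mapping.keys m" for x
      using 1[of x] that by (simp add: in_keys_iff)
    ultimately show ?thesis
      by blast
  qed
  have "finite ((\<lambda>(a, b). (Poly_Mapping.lookup a, Poly_Mapping.lookup b)) ` {(a, b). a + b = m})"
  proof (rule finite_subset)
    show "(\<lambda>(a, b). (Poly_Mapping.lookup a, Poly_Mapping.lookup b)) ` {(a, b). a + b = m} \<subseteq> ?F \<times> ?F"
    proof
      fix p assume "p \<in> (\<lambda>(a, b). (Poly_Mapping.lookup a, Poly_Mapping.lookup b)) ` {(a, b). a + b = m}"
      then obtain a b where p: "p = (Poly_Mapping.lookup a, Poly_Mapping.lookup b)" and ab: "a + b = m"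
        by auto
      from ab have ba: "b + a = m" by (simp add: add.commute)
      show "p \<in> ?F \<times> ?F"
        unfolding p by (rule SigmaI) (rule le[OF ab], rule le[OF ba])
    qed
    show "finite (?F \<times> ?F)"
      using fin by (rule finite_cartesian_product) (rule fin)
  qed
  moreover have "inj_on (\<lambda>(a, b). (Poly_Mapping.lookup a, Poly_Mapping.lookup b)) {(a, b). a + b = m}"
    by (rule inj_onI) (auto simp: lookup_inject)
  ultimately show ?thesis
    by (rule finite_imageD)
qed

instantiation mfps :: (type, comm_ring_1) comm_ring_1
begin

lift_definition zero_mfps :: "('a, 'b) mfps" is "\<lambda>_. 0" .

lift_definition one_mfps :: "('a, 'b) mfps" is "\<lambda>m. if m = 0 then 1 else 0" .

lift_definition plus_mfps :: "('a, 'b) mfps \<Rightarrow> ('a, 'b) mfps \<Rightarrow> ('a, 'b) mfps"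
  is "\<lambda>f g m. f m + g m" .

lift_definition uminus_mfps :: "('a, 'b) mfps \<Rightarrow> ('a, 'b) mfps" is "\<lambda>f m. - f m" .

lift_definition minus_mfps :: "('a, 'b) mfps \<Rightarrow> ('a, 'b) mfps \<Rightarrow> ('a, 'b) mfps"
  is "\<lambda>f g m. f m - g m" .

lift_definition times_mfps :: "('a, 'b) mfps \<Rightarrow> ('a, 'b) mfps \<Rightarrow> ('a, 'b) mfps"
  is "\<lambda>f g m. \<Sum>(a, b) | a + b = m. f a * g b" .

instance
proof
  fix f g h :: "('a, 'b) mfps"
  show "f + g + h = f + (g + h)" "f + g = g + f" "0 + f = f" "- f + f = 0" "f - g = f + - g"
    by (transfer; simp add: fun_eq_iff algebra_simps)+
  show "(0 :: ('a, 'b) mfps) \<noteq> 1"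
    by transfer (auto simp: fun_eq_iff)
  show "(f + g) * h = f * h + g * h"
    by transfer (simp add: fun_eq_iff algebra_simps case_prod_unfold sum.distrib)
  show "f * g = g * f"
  proof (transfer, rule ext)
    fix f g :: "('a \<Rightarrow>\<^sub>0 nat) \<Rightarrow> 'b" and m
    show "(\<Sum>(a, b) | a + b = m. f a * g b) = (\<Sum>(a, b) | a + b = m. g a * f b)"
      by (rule sum.reindex_bij_witness[where i = prod.swap and j = prod.swap])
        (auto simp: algebra_simps)
  qed
  show "1 * f = f"
  proof (transfer, rule ext)
    fix f :: "('a \<Rightarrow>\<^sub>0 nat) \<Rightarrow> 'b" and m
    have "(\<Sum>(a, b) | a + b = m. (if a = 0 then 1 else 0) * f b)
        = (\<Sum>(a, b) \<in> {(0 :: 'a \<Rightarrow>\<^sub>0 nat, m)}. (if a = 0 then 1 else 0) * f b)"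
      by (rule sum.mono_neutral_right) (auto simp: finite_exponent_splits split: if_splits)
    then show "(\<Sum>(a, b) | a + b = m. (if a = 0 then 1 else 0) * f b) = f m"
      by simp
  qed
  show "f * g * h = f * (g * h)"
  proof (transfer, rule ext)
    fix f g h :: "('a \<Rightarrow>\<^sub>0 nat) \<Rightarrow> 'b" and m
    have fin: "finite {p. case p of (a, b) \<Rightarrow> a + b = n}" for n :: "'a \<Rightarrow>\<^sub>0 nat"
      using finite_exponent_splits[of n] by simp
    have "(\<Sum>(p, c) | p + c = m. (\<Sum>(a, b) | a + b = p. f a * g b) * h c)
        = (\<Sum>x \<in> {(p, c). p + c = m}. \<Sum>y \<in> {(a, b). a + b = fst x}.
             f (fst y) * g (snd y) * h (snd x))"
      by (simp add: case_prod_unfold sum_distrib_right)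
    also have "\<dots> = (\<Sum>(x, y) \<in> Sigma {(p, c). p + c = m} (\<lambda>x. {(a, b). a + b = fst x}).
             f (fst y) * g (snd y) * h (snd x))"
      by (rule sum.Sigma) (auto simp: fin)
    also have "\<dots> = (\<Sum>(x, y) \<in> Sigma {(a, p). a + p = m} (\<lambda>x. {(b, c). b + c = snd x}).
             f (fst x) * (g (fst y) * h (snd y)))"
      by (rule sum.reindex_bij_witness[where
            i = "\<lambda>((a, p), (b, c)). ((a + b, c), (a, b))" and
            j = "\<lambda>((p, c), (a, b)). ((a, b + c), (b, c))"])
        (auto simp: algebra_simps)
    also have "\<dots> = (\<Sum>x \<in> {(a, p). a + p = m}. \<Sum>y \<in> {(b, c). b + c = snd x}.
             f (fst x) * (g (fst y) * h (snd y)))"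
      by (rule sum.Sigma[symmetric]) (auto simp: fin)
    also have "\<dots> = (\<Sum>(a, p) | a + p = m. f a * (\<Sum>(b, c) | b + c = p. g b * h c))"
      by (simp add: case_prod_unfold sum_distrib_left)
    finally show "(\<Sum>(p, c) | p + c = m. (\<Sum>(a, b) | a + b = p. f a * g b) * h c)
        = (\<Sum>(a, p) | a + p = m. f a * (\<Sum>(b, c) | b + c = p. g b * h c))" .
  qed
qed

end

definition mfps_monom :: "('v \<Rightarrow>\<^sub>0 nat) \<Rightarrow> 'a \<Rightarrow> ('v, 'a :: comm_ring_1) mfps" where
  "mfps_monom m c = Abs_mfps (\<lambda>m'. if m' = m then c else 0)"

abbreviation mfps_const :: "'a \<Rightarrow> ('v, 'a :: comm_ring_1) mfps" where
  "mfps_const c \<equiv> mfps_monom 0 c"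

abbreviation mfps_var :: "'v \<Rightarrow> ('v, 'a :: comm_ring_1) mfps" where
  "mfps_var v \<equiv> mfps_monom (Poly_Mapping.single v 1) 1"

text \<open>
  The sum of a family of series in which every monomial occurs in only finitely many members.
  For a monomial occurring in infinitely many members, the coefficient is the default value
  \<open>0\<close>; all families below have the finiteness property (for \<open>mfps_log\<close> and
  \<open>mfps_Log\<close>, if the argument has constant term \<open>1\<close>).
\<close>

definition mfps_suminf :: "'i set \<Rightarrow> ('i \<Rightarrow> ('v, 'a) mfps) \<Rightarrow> ('v, 'a :: comm_ring_1) mfps" where
  "mfps_suminf I F =
     Abs_mfps (\<lambda>m. \<Sum>i \<in> {i \<in> I. mfps_nth (F i) m \<noteq> 0}. mfps_nth (F i) m)"

definition mfps_log :: "('v, 'a :: field) mfps \<Rightarrow> ('v, 'a) mfps" where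
  "mfps_log f = mfps_suminf {1..} (\<lambda>n::nat. mfps_const ((- 1) ^ (n + 1) / of_nat n) * (f - 1) ^ n)"


section \<open>Adams operations and the plethystic logarithm over the field of rational functions in q\<close>

type_synonym ratfun = "rat poly fract"

definition ratfun_q :: ratfun where
  "ratfun_q = to_fract [:0, 1:]"

lemma pcompose_monom_eq_0_iff:
  "n > 0 \<Longrightarrow> pcompose p (monom 1 n) = 0 \<longleftrightarrow> p = 0" for p :: "rat poly"
  by (auto simp: degree_monom_eq dest!: pcompose_eq_0)

text \<open>
  Substitution of \<open>q\<^sup>n\<close> for \<open>q\<close> in a rational function. It is only used for \<open>n > 0\<close>, where the
  result does not depend on the chosen fraction, as the lemma below shows.
\<close>

definition ratfun_adams :: "nat \<Rightarrow> ratfun \<Rightarrow> ratfun" where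
  "ratfun_adams n x = (THE y. \<forall>a b. b \<noteq> 0 \<and> x = Fraction_Field.Fract a b \<longrightarrow>
     y = Fraction_Field.Fract (pcompose a (monom 1 n)) (pcompose b (monom 1 n)))"

lemma ratfun_adams_Fract:
  assumes "n > 0" "b \<noteq> 0"
  shows "ratfun_adams n (Fraction_Field.Fract a b) =
           Fraction_Field.Fract (pcompose a (monom 1 n)) (pcompose b (monom 1 n))"
  unfolding ratfun_adams_def
proof (rule the_equality)
  show "\<forall>c d. d \<noteq> 0 \<and> Fraction_Field.Fract a b = Fraction_Field.Fract c d \<longrightarrow>
    Fraction_Field.Fract (pcompose a (monom 1 n)) (pcompose b (monom 1 n)) =
    Fraction_Field.Fract (pcompose c (monom 1 n)) (pcompose d (monom 1 n))"
  proof (intro allI impI, elim conjE)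
    fix c d :: "rat poly"
    assume d: "d \<noteq> 0" and eq: "Fraction_Field.Fract a b = Fraction_Field.Fract c d"
    from eq d assms have "a * d = c * b"
      by (simp add: Fraction_Field.eq_fract)
    then have "pcompose (a * d) (monom 1 n) = pcompose (c * b) (monom 1 n)"
      by (rule arg_cong)
    then show "Fraction_Field.Fract (pcompose a (monom 1 n)) (pcompose b (monom 1 n)) =
        Fraction_Field.Fract (pcompose c (monom 1 n)) (pcompose d (monom 1 n))"
      using d assms by (simp add: Fraction_Field.eq_fract pcompose_monom_eq_0_iff pcompose_mult)
  qed
next
  fix y
  assume "\<forall>c d. d \<noteq> 0 \<and> Fraction_Field.Fract a b = Fraction_Field.Fract c d \<longrightarrow>
    y = Fraction_Field.Fract (pcompose c (monom 1 n)) (pcompose d (monom 1 n))"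
  from this[rule_format, of b a] assms(2)
  show "y = Fraction_Field.Fract (pcompose a (monom 1 n)) (pcompose b (monom 1 n))"
    by simp
qed

definition mfps_adams :: "nat \<Rightarrow> ('v, ratfun) mfps \<Rightarrow> ('v, ratfun) mfps" where
  "mfps_adams n f = mfps_suminf UNIV
     (\<lambda>m. mfps_monom (Poly_Mapping.map ((*) n) m) (ratfun_adams n (mfps_nth f m)))"

definition moebius_mu :: "nat \<Rightarrow> int" where
  "moebius_mu n = (if squarefree n then (- 1) ^ card (prime_factors n) else 0)"

definition mfps_Log :: "('v, ratfun) mfps \<Rightarrow> ('v, ratfun) mfps" where
  "mfps_Log f = mfps_suminf {1..}
     (\<lambda>n::nat. mfps_const (of_int (moebius_mu n) / of_nat n) * mfps_adams n (mfps_log f))"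


section \<open>The generating series of a quiver\<close>

definition euler_ringel_form :: "('v, 'e) pre_digraph \<Rightarrow> ('v \<Rightarrow> int) \<Rightarrow> ('v \<Rightarrow> int) \<Rightarrow> int" where
  "euler_ringel_form Q \<alpha> \<beta> =
     (\<Sum>i \<in> verts Q. \<alpha> i * \<beta> i) - (\<Sum>a \<in> arcs Q. \<alpha> (tail Q a) * \<beta> (head Q a))"

definition tits_form :: "('v, 'e) pre_digraph \<Rightarrow> ('v \<Rightarrow> int) \<Rightarrow> int" where
  "tits_form Q \<alpha> = euler_ringel_form Q \<alpha> \<alpha>"

text \<open>
  Parts are indexed from \<open>0\<close>: \<open>p k\<close> is the part usually written \<open>p\<^sub>k\<^sub>+\<^sub>1\<close>. Accordingly, the variable
  \<open>(k, i)\<close> below stands for \<open>x\<^sub>k\<^sub>+\<^sub>1\<^sub>,\<^sub>i\<close>.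
\<close>

definition partitions :: "(nat \<Rightarrow> nat) set" where
  "partitions = {p. antimono p \<and> finite {k. p k \<noteq> 0}}"

definition multipartitions :: "('v, 'e) pre_digraph \<Rightarrow> ('v \<Rightarrow> nat \<Rightarrow> nat) set" where
  "multipartitions Q = verts Q \<rightarrow>\<^sub>E partitions"

definition qfact :: "'a :: comm_ring_1 \<Rightarrow> nat \<Rightarrow> 'a" where
  "qfact z n = (\<Prod>j = 1..n. 1 - z ^ j)"

definition qfact_vec :: "('v, 'e) pre_digraph \<Rightarrow> 'a :: comm_ring_1 \<Rightarrow> ('v \<Rightarrow> nat) \<Rightarrow> 'a" where
  "qfact_vec Q z \<alpha> = (\<Prod>i \<in> verts Q. qfact z (\<alpha> i))"

text \<open>
  In the product over \<open>k\<close>, all but finitely many factors are \<open>1\<close>. The subtraction of natural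
  numbers does not truncate, because partitions are weakly decreasing.
\<close>

definition quiver_series :: "('v, 'e) pre_digraph \<Rightarrow> (nat \<times> 'v, ratfun) mfps" where
  "quiver_series Q = mfps_suminf (multipartitions Q) (\<lambda>lam. \<Prod>k.
     mfps_const (ratfun_q powi (- tits_form Q (\<lambda>i. int (lam i k))) /
                 qfact_vec Q (inverse ratfun_q) (\<lambda>i. lam i k - lam i (Suc k))) *
     (\<Prod>i \<in> verts Q. mfps_var (k, i) ^ (lam i k - lam i (Suc k))))"

end

theory Submission
  imports
    Defs
    "HOL-Library.List_Lexorder"
    "HOL-Library.Product_Lexorder"
    "HOL-Library.Function_Algebras"
begin

text \<open>The variables \<open>x\<^sub>k\<^sub>i\<close> are regarded as colours. In multiplicities of colours, minus the sum of
  the Tits forms is \<open>1/2 \<Sum> a\<^sub>i\<^sub>j g\<^sub>i g\<^sub>j\<close> with a symmetric matrix \<open>a\<close> of natural numbers whose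
  diagonal is even; the loops are what makes the entries non-negative. Consider the functions \<open>F\<close>
  on words in letters \<open>(k, i)\<close> (an integer and a colour) that are local: multiplying the
  generating function of \<open>F\<close> by the \<open>a\<^sub>i\<^sub>j\<close>-th power of the difference of the variables of two
  neighbouring letters of colours \<open>i\<close> and \<open>j\<close> makes these letters commute. Such functions are obtained
  by dividing symmetric Laurent polynomials by a product of powers of differences of variables,
  and they form an algebra under the shuffle product. The possible leading words of local
  functions are the admissible words, which are counted by the coefficients of \<open>s\<close>.

  A word is admissible iff all its Lyndon factors are, and leading words multiply by merging
  Lyndon factors. So \<open>(q - 1) Log s\<close> is governed by the numbers \<open>c(N)\<close> of admissible Lyndon words of
  weight \<open>N\<close>, which are also the graded dimensions of the indecomposables of the algebra. Its
  coefficients are the differences \<open>c(N) - c(N + 1)\<close>. They vanish for almost all \<open>N\<close>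
  because Lyndon words may be translated, and they are non-negative because the derivation
  \<open>raise\<close> is injective on the indecomposables: together with \<open>lower\<close> it satisfies the canonical
  commutation relation.\<close>

section \<open>Lyndon words and maximal shuffles\<close>

text \<open>Why the leading words are exactly the admissible words: locality forces a leading word
  to be admissible, and \<open>flatten\<close> bounds the number of admissible words of given
  colours and weight by a number of multisets of letters. Conversely every such multiset, read as a
  symmetric monomial, gives a local function after division, and these functions are independent.
  The two bounds meet. A pigeonhole argument then makes every admissible word a leading word, and
  counting multisets shows that the words with colours \<open>g\<close> have the generating function
  \<open>q^quad / (q^-1)_g\<close>. The obstacle in the division is that a product of differences
  has no preferred inverse: a word orders its variables and thereby selects an iterated Laurent
  expansion. Locality is what the symmetry of the numerator leaves behind when expansions in
  different orders are compared. Rational functions in \<open>q\<close> are expanded in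
  \<open>X = q^-1\<close>, where words can be counted. As words are multisets of Lyndon words,
  \<open>s\<close> is \<open>Exp\<close> of the Lyndon series, and multiplication by
  \<open>1 - X\<close> takes differences of consecutive counts.\<close>

definition strict_lex :: "'a::linorder list \<Rightarrow> 'a list \<Rightarrow> bool" where
  "strict_lex u v \<longleftrightarrow> (\<exists>p a b u' v'. u = p @ a # u' \<and> v = p @ b # v' \<and> a < b)"

lemma append_less_append_iff [simp]: "p @ u < p @ v \<longleftrightarrow> u < (v :: 'a::linorder list)"
  by (induction p) auto

lemma le_append_self [simp]: "u \<le> u @ (v :: 'a::linorder list)"
  by (induction u) auto

text \<open>This stability is the reason for \<open>strict_lex\<close>: a proper prefix is smaller
  for \<open><\<close>, but need not stay smaller once both words are extended.\<close>

lemma strict_lex_append: "strict_lex u v \<Longrightarrow> strict_lex (u @ x) (v @ y)"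
  unfolding strict_lex_def by (metis append.assoc append_Cons)

lemma strict_lex_prepend: "strict_lex u v \<Longrightarrow> strict_lex (p @ u) (p @ v)"
  unfolding strict_lex_def by (metis append.assoc)

lemma strict_lex_imp_less: "strict_lex u v \<Longrightarrow> u < v"
  unfolding strict_lex_def by auto

lemma less_list_cases:
  fixes u v :: "'a::linorder list"
  assumes "u < v"
  obtains (strict) "strict_lex u v" | (prefix) t where "t \<noteq> []" "v = u @ t"
proof -
  have "strict_lex u v \<or> (\<exists>t. t \<noteq> [] \<and> v = u @ t)"
    using assms
  proof (induction u arbitrary: v)
    case Nil
    then show ?case by (cases v) auto
  next
    case (Cons a u)
    then obtain b v' where v: "v = b # v'" by (cases v) auto
    show ?case
    proof (cases "a < b")
      case True
      then have "strict_lex (a # u) v"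
        unfolding strict_lex_def v by (metis append_Nil)
      then show ?thesis ..
    next
      case False
      then have "a = b" "u < v'" using Cons.prems v by auto
      with Cons.IH[of v'] show ?thesis
        using strict_lex_prepend[of u v' "[a]"] by (auto simp: v)
    qed
  qed
  then show thesis using that by blast
qed

definition lyndon :: "'a::linorder list \<Rightarrow> bool" where
  "lyndon w \<longleftrightarrow> w \<noteq> [] \<and> (\<forall>u v. w = u @ v \<and> u \<noteq> [] \<and> v \<noteq> [] \<longrightarrow> w < v)"

lemma lyndon_neq_Nil: "lyndon w \<Longrightarrow> w \<noteq> []"
  by (simp add: lyndon_def)

lemma lyndon_single [simp]: "lyndon [x]"
  by (auto simp: lyndon_def Cons_eq_append_conv)

text \<open>The other case of \<open>less_list_cases\<close>, in which the whole word would be a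
  prefix of its own proper suffix, is excluded by length.\<close>

lemma lyndon_suffix_strict:
  assumes "lyndon (u @ v)" "u \<noteq> []" "v \<noteq> []"
  shows "strict_lex (u @ v) v"
proof -
  have "u @ v < v" using assms by (auto simp: lyndon_def)
  then show ?thesis
  proof (cases rule: less_list_cases)
    case (prefix t)
    then have "length v = length (u @ v @ t)" by simp
    then show ?thesis using assms(2) by simp
  qed
qed

text \<open>If \<open>l = m @ t\<close>, cancelling \<open>m\<close> leaves the comparison of
  \<open>l\<close> with its proper suffix \<open>t\<close>, which is strict because \<open>l\<close>
  is Lyndon.\<close>

lemma lyndon_strict_append:
  assumes "lyndon l" "m \<noteq> []" "m < l"
  shows "strict_lex (m @ l) l"
  using assms(3)
proof (cases rule: less_list_cases)
  case strict
  then show ?thesis using strict_lex_append[of m l l "[]"] by simp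
next
  case (prefix t)
  then have "strict_lex l t" using lyndon_suffix_strict[of m t] assms by simp
  then show ?thesis using strict_lex_prepend[of l t m] prefix by simp
qed

text \<open>A proper suffix is \<open>z @ l\<close> with \<open>z\<close> a suffix of
  \<open>m\<close>, or \<open>l\<close>, or a proper suffix of \<open>l\<close>. The first kind is
  decided inside \<open>m\<close>, the other two through \<open>m @ l < l\<close>.\<close>

lemma lyndon_append:
  assumes m: "lyndon m" and l: "lyndon l" and "m < l"
  shows "lyndon (m @ l)"
  unfolding lyndon_def
proof (intro conjI allI impI)
  show "m @ l \<noteq> []" using m by (simp add: lyndon_def)
next
  fix u v assume *: "m @ l = u @ v \<and> u \<noteq> [] \<and> v \<noteq> []"
  have ml: "m @ l < l"
    using lyndon_strict_append[OF l lyndon_neq_Nil[OF m] \<open>m < l\<close>] by (rule strict_lex_imp_less)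
  from * consider (a) z where "m = u @ z" "v = z @ l" | (b) z where "u = m @ z" "l = z @ v"
    by (auto simp: append_eq_append_conv2)
  then show "m @ l < v"
  proof cases
    case a
    show ?thesis
    proof (cases "z = []")
      case True then show ?thesis using ml a by simp
    next
      case False
      then have "strict_lex m z" using lyndon_suffix_strict[of u z] a m * by simp
      then show ?thesis using strict_lex_append[of m z l l] a strict_lex_imp_less by blast
    qed
  next
    case b
    show ?thesis
    proof (cases "z = []")
      case True then show ?thesis using ml b by simp
    next
      case False
      then have "l < v" using l b * unfolding lyndon_def by blast
      then show ?thesis using ml by simp
    qed
  qed
qed

section \<open>Existence and uniqueness of the Lyndon factorisation\<close>

definition lyndon_seq :: "'a::linorder list list \<Rightarrow> bool" where
  "lyndon_seq ls \<longleftrightarrow> sorted_wrt (\<lambda>x y. y \<le> x) ls \<and> (\<forall>l\<in>set ls. lyndon l)"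

lemma lyndon_seq_Nil [simp]: "lyndon_seq []"
  by (simp add: lyndon_seq_def)

lemma lyndon_seq_Cons:
  "lyndon_seq (l # ls) \<longleftrightarrow> lyndon l \<and> (\<forall>x\<in>set ls. x \<le> l) \<and> lyndon_seq ls"
  by (auto simp: lyndon_seq_def)

lemma lyndon_seq_append:
  "lyndon_seq (ls @ ks) \<longleftrightarrow> lyndon_seq ls \<and> lyndon_seq ks \<and> (\<forall>l\<in>set ls. \<forall>k\<in>set ks. k \<le> l)"
  by (auto simp: lyndon_seq_def sorted_wrt_append)

text \<open>A Lyndon word put in front is merged with the first factor as long as it is smaller than
  it; \<open>lyndon_append\<close> keeps the result Lyndon. Once it is not smaller, the sequence is
  weakly decreasing.\<close>

lemma lyndon_seq_prepend_ex:
  "lyndon l \<Longrightarrow> lyndon_seq ls \<Longrightarrow> \<exists>ks. lyndon_seq ks \<and> concat ks = l @ concat ls"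
proof (induction ls arbitrary: l)
  case Nil
  then show ?case by (intro exI[of _ "[l]"]) (simp add: lyndon_seq_Cons)
next
  case (Cons k ls)
  show ?case
  proof (cases "k \<le> l")
    case True
    then show ?thesis using Cons.prems
      by (intro exI[of _ "l # k # ls"]) (auto simp: lyndon_seq_Cons)
  next
    case False
    then have "lyndon (l @ k)" using Cons.prems by (auto intro: lyndon_append simp: lyndon_seq_Cons)
    from Cons.IH[OF this] show ?thesis using Cons.prems by (auto simp: lyndon_seq_Cons)
  qed
qed

lemma lyndon_seq_ex: "\<exists>ls. lyndon_seq ls \<and> concat ls = w"
proof (induction w)
  case Nil
  show ?case by (intro exI[of _ "[]"]) simp
next
  case (Cons x w)
  then obtain ls where "lyndon_seq ls" "concat ls = w" by blast
  with lyndon_seq_prepend_ex[of "[x]" ls] show ?case by auto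
qed

text \<open>The prefix ends within some factor, and the piece of that factor which it covers is at
  most the factor itself, hence at most \<open>l\<close>.\<close>

lemma prefix_of_concat_le:
  assumes "t @ r = concat ls" "t \<noteq> []" "\<forall>x\<in>set ls. x \<le> l"
  shows "\<exists>t' p. t = t' @ p \<and> p \<noteq> [] \<and> p \<le> (l :: 'a::linorder list)"
  using assms
proof (induction ls arbitrary: t)
  case Nil
  then show ?case by simp
next
  case (Cons k ls)
  from Cons.prems(1) consider (a) z where "k = t @ z" | (b) z where "t = k @ z" "z @ r = concat ls"
    by (auto simp: append_eq_append_conv2)
  then show ?case
  proof cases
    case a
    then have "t \<le> k" by simp
    also have "k \<le> l" using Cons.prems by simp
    finally show ?thesis using Cons.prems(2) by (intro exI[of _ "[]"] exI[of _ t]) simp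
  next
    case b
    show ?thesis
    proof (cases "z = []")
      case True
      then show ?thesis using b Cons.prems by (intro exI[of _ "[]"] exI[of _ t]) auto
    next
      case False
      then show ?thesis using Cons.IH[OF b(2)] Cons.prems b
        by (metis append.assoc list.set_intros(2))
    qed
  qed
qed

text \<open>The first factor is the longest Lyndon prefix, whence uniqueness: a longer Lyndon prefix
  \<open>k\<close> would have a proper suffix \<open>p\<close> with
  \<open>k < p \<le> l \<le> k\<close>.\<close>

lemma lyndon_prefix_le_length:
  assumes "lyndon_seq (l # ls)" "lyndon k" "l @ concat ls = k @ r"
  shows "length k \<le> length l"
proof (rule ccontr)
  assume "\<not> length k \<le> length l"
  then obtain t where t: "k = l @ t" "t \<noteq> []" "t @ r = concat ls"
    using assms(3) by (auto simp: append_eq_append_conv2)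
  then obtain t' p where p: "t = t' @ p" "p \<noteq> []" "p \<le> l"
    using prefix_of_concat_le[OF t(3,2), of l] assms(1) by (auto simp: lyndon_seq_Cons)
  have "k = (l @ t') @ p" "l @ t' \<noteq> []"
    using t p lyndon_neq_Nil assms(1) by (auto simp: lyndon_seq_Cons)
  then have "k < p" using assms(2) p(2) unfolding lyndon_def by blast
  also have "p \<le> l" by fact
  also have "l \<le> k" using t by simp
  finally show False by simp
qed

lemma lyndon_seq_unique:
  "lyndon_seq ls \<Longrightarrow> lyndon_seq ks \<Longrightarrow> concat ls = concat ks \<Longrightarrow> ls = ks"
proof (induction ls arbitrary: ks)
  case Nil
  then show ?case by (cases ks) (auto simp: lyndon_seq_Cons lyndon_def)
next
  case (Cons l ls)
  then obtain k ks' where ks: "ks = k # ks'"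
    by (cases ks) (auto simp: lyndon_seq_Cons lyndon_def)
  have "length k \<le> length l" "length l \<le> length k"
    using lyndon_prefix_le_length[of l ls k "concat ks'"] lyndon_prefix_le_length[of k ks' l "concat ls"]
      Cons.prems ks by (auto simp: lyndon_seq_Cons)
  then have "l = k" "concat ls = concat ks'" using Cons.prems(3) ks by auto
  then show ?case using Cons ks by (auto simp: lyndon_seq_Cons)
qed

definition lyndon_factors :: "'a::linorder list \<Rightarrow> 'a list list" where
  "lyndon_factors w = (THE ls. lyndon_seq ls \<and> concat ls = w)"

lemma lyndon_factors_props: "lyndon_seq (lyndon_factors w) \<and> concat (lyndon_factors w) = w"
  unfolding lyndon_factors_def by (rule theI') (metis lyndon_seq_ex lyndon_seq_unique)

lemma lyndon_seq_lyndon_factors [simp]: "lyndon_seq (lyndon_factors w)"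
  and concat_lyndon_factors [simp]: "concat (lyndon_factors w) = w"
  using lyndon_factors_props by auto

lemma lyndon_factors_concat: "lyndon_seq ls \<Longrightarrow> lyndon_factors (concat ls) = ls"
  using lyndon_seq_unique lyndon_factors_props by blast

lemma lyndon_factors_Nil [simp]: "lyndon_factors [] = []"
  using lyndon_factors_concat[of "[]"] by simp

lemma lyndon_factors_lyndon: "lyndon l \<Longrightarrow> lyndon_factors l = [l]"
  using lyndon_factors_concat[of "[l]"] by (simp add: lyndon_seq_Cons)

lemma lyndon_factors_eq_Nil_iff [simp]: "lyndon_factors w = [] \<longleftrightarrow> w = []"
  by (metis concat.simps(1) concat_lyndon_factors lyndon_factors_Nil)

text \<open>Inverse of taking the multiset of Lyndon factors, so that words correspond to finite
  multisets of Lyndon words.\<close>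

definition mset_concat :: "'a::linorder list multiset \<Rightarrow> 'a list" where
  "mset_concat M = concat (rev (sorted_list_of_multiset M))"

lemma lyndon_seq_rev_sorted:
  "(\<forall>l\<in>#M. lyndon l) \<Longrightarrow> lyndon_seq (rev (sorted_list_of_multiset M))"
  by (simp add: lyndon_seq_def sorted_wrt_rev)

lemma rev_sorted_mset_lyndon_seq:
  assumes "lyndon_seq ls"
  shows "rev (sorted_list_of_multiset (mset ls)) = ls"
proof -
  have "sorted (rev ls)" using assms by (simp add: lyndon_seq_def sorted_wrt_rev)
  then have "sorted_list_of_multiset (mset (rev ls)) = rev ls"
    by (metis sorted_list_of_multiset_mset sort_key_id_if_sorted map_ident sorted_sort_id)
  then show ?thesis by simp
qed

lemma mset_concat_mset: "lyndon_seq ls \<Longrightarrow> mset_concat (mset ls) = concat ls"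
  unfolding mset_concat_def by (simp only: rev_sorted_mset_lyndon_seq)

lemma mset_concat_lyndon_factors [simp]: "mset_concat (mset (lyndon_factors w)) = w"
  by (simp add: mset_concat_mset)

lemma lyndon_factors_mset_concat:
  "(\<forall>l\<in>#M. lyndon l) \<Longrightarrow> mset (lyndon_factors (mset_concat M)) = M"
  by (simp add: mset_concat_def lyndon_factors_concat lyndon_seq_rev_sorted)

lemma mset_concat_empty [simp]: "mset_concat {#} = []"
  by (simp add: mset_concat_def)

lemma mset_concat_single [simp]: "mset_concat {#l#} = l"
  by (simp add: mset_concat_def)

lemma mset_concat_append:
  assumes "\<forall>a\<in>#A. \<forall>b\<in>#B. b \<le> a"
  shows "mset_concat (A + B) = mset_concat A @ mset_concat B"
proof -
  let ?l = "sorted_list_of_multiset B @ sorted_list_of_multiset A"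
  have "sorted ?l" using assms by (auto simp: sorted_append)
  then have "sorted_list_of_multiset (mset ?l) = ?l"
    by (metis sorted_list_of_multiset_mset sorted_sort_id)
  then have "sorted_list_of_multiset (A + B) = ?l" by (simp add: add.commute)
  then show ?thesis by (simp add: mset_concat_def)
qed

lemma lyndon_seq_last_le: "lyndon_seq (ls @ [k]) \<Longrightarrow> l \<in> set (ls @ [k]) \<Longrightarrow> k \<le> l"
  by (auto simp: lyndon_seq_append)

lemma lyndon_less_factors_tl:
  assumes "lyndon (y # m)" "f \<in> set (lyndon_factors m)"
  shows "y # m < f"
proof -
  have "lyndon_factors m \<noteq> []" using assms(2) by auto
  then obtain ls k where ls: "lyndon_factors m = ls @ [k]" by (metis rev_exhaust)
  have seq: "lyndon_seq (ls @ [k])" by (metis ls lyndon_seq_lyndon_factors)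
  have m: "m = concat ls @ k" using concat_lyndon_factors[of m] ls by simp
  have "k \<noteq> []" using seq by (auto simp: lyndon_seq_append lyndon_seq_Cons lyndon_def)
  moreover have "y # m = (y # concat ls) @ k" by (simp add: m)
  ultimately have "y # m < k" using assms(1) unfolding lyndon_def by blast
  also have "k \<le> f" using lyndon_seq_last_le[OF seq] assms(2) ls by simp
  finally show ?thesis .
qed

text \<open>The factors of \<open>m\<close> all exceed \<open>y # m\<close>. If \<open>y # m\<close>
  is at least every word of \<open>B\<close>, they precede \<open>B\<close> and both sides agree.
  Otherwise the largest word \<open>l\<close> of \<open>B\<close> opens the right side, while the
  left side consists of \<open>y\<close>, the factors of \<open>m\<close> not below
  \<open>l\<close>, then \<open>l\<close> and the rest. What stands before \<open>l\<close> is a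
  prefix of \<open>y # m < l\<close>, so \<open>lyndon_strict_append\<close> decides.\<close>

lemma Cons_mset_concat_le:
  assumes m: "lyndon (y # m)" and B: "\<forall>l\<in>#B. lyndon l"
  shows "y # mset_concat (mset (lyndon_factors m) + B) \<le> mset_concat (add_mset (y # m) B)"
proof (cases "B = {#}")
  case True
  then show ?thesis by simp
next
  case False
  define l where "l = Max (set_mset B)"
  have l: "l \<in># B" using False by (simp add: l_def)
  have le: "k \<le> l" if "k \<in># B" for k using that by (simp add: l_def)
  let ?F = "mset (lyndon_factors m)"
  show ?thesis
  proof (cases "l \<le> y # m")
    case True
    have "k \<le> f" if "f \<in># ?F" "k \<in># B" for k f
      using that le[OF that(2)] True lyndon_less_factors_tl[OF m, of f] by auto
    then have "mset_concat (?F + B) = m @ mset_concat B"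
      by (subst mset_concat_append) auto
    moreover have "mset_concat (add_mset (y # m) B) = (y # m) @ mset_concat B"
      using True le by (subst add_mset_add_single, subst add.commute, subst mset_concat_append) force+
    ultimately show ?thesis by simp
  next
    case False
    define F1 where "F1 = filter_mset (\<lambda>f. l \<le> f) ?F"
    define F2 where "F2 = filter_mset (\<lambda>f. \<not> l \<le> f) ?F"
    have F: "?F = F1 + F2" unfolding F1_def F2_def by (rule multiset_partition)
    obtain B' where B': "B = add_mset l B'" using l by (metis multi_member_split)
    have mF: "m = mset_concat F1 @ mset_concat F2"
    proof -
      have "m = mset_concat (F1 + F2)" by (simp flip: F)
      also have "\<dots> = mset_concat F1 @ mset_concat F2"
        by (rule mset_concat_append) (auto simp: F1_def F2_def)
      finally show ?thesis .
    qed
    have "mset_concat (?F + B) = mset_concat (F1 + ({#l#} + (F2 + B')))"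
      by (simp add: F B' ac_simps)
    also have "\<dots> = mset_concat F1 @ mset_concat ({#l#} + (F2 + B'))"
      using le by (intro mset_concat_append) (auto simp: F1_def F2_def B' intro: order_trans)
    also have "mset_concat ({#l#} + (F2 + B')) = l @ mset_concat (F2 + B')"
      using le by (subst mset_concat_append) (auto simp: F2_def B')
    finally have 1: "y # mset_concat (?F + B) = ((y # mset_concat F1) @ l) @ mset_concat (F2 + B')"
      by simp
    have "mset_concat (add_mset (y # m) B) = mset_concat ({#l#} + add_mset (y # m) B')"
      by (simp add: B' add_mset_commute)
    also have "\<dots> = l @ mset_concat (add_mset (y # m) B')"
      using le False by (subst mset_concat_append) (auto simp: B')
    finally have 2: "mset_concat (add_mset (y # m) B) = l @ mset_concat (add_mset (y # m) B')" .
    have "y # mset_concat F1 \<le> y # m" using mF by simp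
    also have "\<dots> < l" using False by simp
    finally have "strict_lex ((y # mset_concat F1) @ l) l"
      using B l by (intro lyndon_strict_append) auto
    then have "y # mset_concat (?F + B) < mset_concat (add_mset (y # m) B)"
      unfolding 1 2 by (intro strict_lex_imp_less strict_lex_append)
    then show ?thesis by simp
  qed
qed

section \<open>Merging Lyndon factors gives the largest shuffle\<close>

definition max_shuffle :: "'a::linorder list \<Rightarrow> 'a list \<Rightarrow> 'a list" where
  "max_shuffle u v = mset_concat (mset (lyndon_factors u) + mset (lyndon_factors v))"

lemma max_shuffle_commute: "max_shuffle u v = max_shuffle v u"
  by (simp add: max_shuffle_def add.commute)

lemma max_shuffle_Nil [simp]: "max_shuffle [] v = v" "max_shuffle v [] = v"
  by (simp_all add: max_shuffle_def)

lemma lyndon_factors_lyndon_elem: "l \<in> set (lyndon_factors w) \<Longrightarrow> lyndon l"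
  using lyndon_seq_lyndon_factors[of w] by (auto simp: lyndon_seq_def)

lemma mset_lyndon_factors_max_shuffle:
  "mset (lyndon_factors (max_shuffle u v)) = mset (lyndon_factors u) + mset (lyndon_factors v)"
  unfolding max_shuffle_def
  by (rule lyndon_factors_mset_concat) (auto dest: lyndon_factors_lyndon_elem)

text \<open>The induction step of \<open>shuffles_le_max_shuffle\<close>. Removing the first letter
  affects only the first Lyndon factor, whose remainder splits into larger factors, so the claim
  reduces to \<open>Cons_mset_concat_le\<close>.\<close>

lemma Cons_max_shuffle_le: "x # max_shuffle u v \<le> max_shuffle (x # u) v"
proof -
  obtain n ls where ls: "lyndon_factors (x # u) = n # ls"
    by (cases "lyndon_factors (x # u)") auto
  have seq: "lyndon_seq (n # ls)" by (metis ls lyndon_seq_lyndon_factors)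
  have "n @ concat ls = x # u" using concat_lyndon_factors[of "x # u"] ls by simp
  moreover have "n \<noteq> []" using seq by (simp add: lyndon_seq_Cons lyndon_def)
  ultimately obtain m where m: "n = x # m" "u = m @ concat ls" by (cases n) auto
  have "lyndon_seq (lyndon_factors m @ ls)"
    using seq lyndon_less_factors_tl[of x m] unfolding lyndon_seq_append lyndon_seq_Cons m
    by (meson less_imp_le order_trans lyndon_seq_lyndon_factors)
  then have "lyndon_factors (concat (lyndon_factors m @ ls)) = lyndon_factors m @ ls"
    by (rule lyndon_factors_concat)
  then have u: "lyndon_factors u = lyndon_factors m @ ls" by (simp add: m)
  have "x # max_shuffle u v =
      x # mset_concat (mset (lyndon_factors m) + (mset ls + mset (lyndon_factors v)))"
    by (simp add: max_shuffle_def u add.assoc)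
  also have "\<dots> \<le> mset_concat (add_mset (x # m) (mset ls + mset (lyndon_factors v)))"
    using seq by (intro Cons_mset_concat_le)
      (auto simp: m lyndon_seq_def dest: lyndon_factors_lyndon_elem)
  also have "\<dots> = max_shuffle (x # u) v"
    by (simp add: max_shuffle_def ls flip: m(1))
  finally show ?thesis .
qed

lemma shuffles_le_max_shuffle: "w \<in> shuffles u v \<Longrightarrow> w \<le> max_shuffle u v"
proof (induction u v arbitrary: w rule: shuffles.induct)
  case (3 x u y v)
  then consider (a) z where "w = x # z" "z \<in> shuffles u (y # v)"
    | (b) z where "w = y # z" "z \<in> shuffles (x # u) v" by auto
  then show ?case
  proof cases
    case a
    then have "w \<le> x # max_shuffle u (y # v)" using 3 by simp
    also have "\<dots> \<le> max_shuffle (x # u) (y # v)" by (rule Cons_max_shuffle_le)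
    finally show ?thesis .
  next
    case b
    then have "w \<le> y # max_shuffle v (x # u)" using 3 by (simp add: max_shuffle_commute)
    also have "\<dots> \<le> max_shuffle (y # v) (x # u)" by (rule Cons_max_shuffle_le)
    finally show ?thesis by (simp add: max_shuffle_commute)
  qed
qed auto

lemma append_in_shuffles_left: "w \<in> shuffles u v \<Longrightarrow> p @ w \<in> shuffles (p @ u) v"
  by (induction p) (auto intro: Cons_in_shuffles_leftI)

text \<open>The largest factor of all opens the merged word and also the word of the side it comes
  from, so it can be taken off both.\<close>

lemma mset_concat_in_shuffles:
  fixes A B :: "'a::linorder list multiset"
  shows "mset_concat (A + B) \<in> shuffles (mset_concat A) (mset_concat B)"
proof (induction "size (A + B)" arbitrary: A B)
  case 0
  then show ?case by simp
next
  case (Suc n)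
  have step: "mset_concat (A + B) \<in> shuffles (mset_concat A) (mset_concat B)"
    if n: "Suc n = size (A + B)" and l: "l \<in># A" and max: "\<forall>k\<in>#A + B. k \<le> l"
    for l and A B :: "'a list multiset"
  proof -
    obtain A' where A: "A = add_mset l A'" using l by (metis multi_member_split)
    have "mset_concat ({#l#} + A') = l @ mset_concat A'"
      using max by (subst mset_concat_append) (auto simp: A)
    moreover have "mset_concat ({#l#} + (A' + B)) = l @ mset_concat (A' + B)"
      using max by (subst mset_concat_append) (auto simp: A)
    moreover have "mset_concat (A' + B) \<in> shuffles (mset_concat A') (mset_concat B)"
      using n Suc(1)[of A' B] by (simp add: A)
    ultimately show ?thesis by (simp add: A append_in_shuffles_left)
  qed
  define l where "l = Max (set_mset (A + B))"
  have ne: "A + B \<noteq> {#}" using Suc(2) by auto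
  then have l: "l \<in># A + B" unfolding l_def by (intro Max_in) auto
  have max: "\<forall>k\<in>#A + B. k \<le> l" by (auto simp: l_def)
  show ?case
  proof (cases "l \<in># A")
    case True
    then show ?thesis using step[of A B l] Suc(2) max by simp
  next
    case False
    then show ?thesis using step[of B A l] Suc(2) max l
      by (auto simp: add.commute shuffles_commutes)
  qed
qed

lemma max_shuffle_in_shuffles: "max_shuffle u v \<in> shuffles u v"
  using mset_concat_in_shuffles[of "mset (lyndon_factors u)" "mset (lyndon_factors v)"]
  by (simp add: max_shuffle_def)

text \<open>The same interleaving is followed up to the first letter in which \<open>u'\<close> is
  larger; after that any completion will do. Equal lengths exclude that \<open>u\<close> is a prefix
  of \<open>u'\<close>.\<close>

lemma shuffles_mono_left:
  fixes u u' v :: "'a::linorder list"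
  assumes "w \<in> shuffles u v" "u < u'" "length u = length u'"
  shows "\<exists>w'\<in>shuffles u' v. w < w'"
  using assms
proof (induction u v arbitrary: w u' rule: shuffles.induct)
  case (1 v)
  then show ?case by simp
next
  case (2 u)
  then show ?case by auto
next
  case (3 x u y v)
  obtain x' t where u': "u' = x' # t" using 3 by (cases u') auto
  from 3(3) consider (a) z where "w = x # z" "z \<in> shuffles u (y # v)"
    | (b) z where "w = y # z" "z \<in> shuffles (x # u) v" by auto
  then show ?case
  proof cases
    case a
    show ?thesis
    proof (cases "x < x'")
      case True
      have "t @ y # v \<in> shuffles t (y # v)"
        using append_in_shuffles_left[of "y # v" "[]" "y # v" t] by simp
      then show ?thesis using True a u'
        by (intro bexI[of _ "x' # t @ y # v"]) (auto intro: Cons_in_shuffles_leftI)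
    next
      case False
      then have "x = x'" "u < t" "length u = length t" using 3 u' by auto
      then obtain z' where "z' \<in> shuffles t (y # v)" "z < z'" using 3(1)[OF a(2)] by auto
      then show ?thesis using \<open>x = x'\<close> a u' by (intro bexI[of _ "x # z'"]) auto
    qed
  next
    case b
    then obtain z' where "z' \<in> shuffles u' v" "z < z'" using 3(2)[OF b(2)] 3(4,5) by auto
    then show ?thesis using b u' by (intro bexI[of _ "y # z'"]) auto
  qed
qed

text \<open>Strictness ensures that a product reaches its leading word from one pair of words only,
  so that nothing can cancel there.\<close>

lemma max_shuffle_strict_mono_left:
  assumes "u < u'" "length u = length u'"
  shows "max_shuffle u v < max_shuffle u' v"
  using shuffles_mono_left[OF max_shuffle_in_shuffles[of u v] assms] shuffles_le_max_shuffle
  by (metis order_less_le_trans)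

section \<open>Admissible words\<close>

definition colours :: "(int \<times> 'c) list \<Rightarrow> 'c \<Rightarrow>\<^sub>0 nat" where
  "colours w = (\<Sum>x\<leftarrow>w. Poly_Mapping.single (snd x) 1)"

definition weight :: "(int \<times> 'c) list \<Rightarrow> int" where
  "weight w = (\<Sum>x\<leftarrow>w. fst x)"

lemma colours_simps [simp]:
  "colours [] = 0" "colours (x # w) = Poly_Mapping.single (snd x) 1 + colours w"
  "colours (u @ v) = colours u + colours v"
  by (simp_all add: colours_def)

lemma weight_simps [simp]:
  "weight [] = 0" "weight (x # w) = fst x + weight w" "weight (u @ v) = weight u + weight v"
  by (simp_all add: weight_def)

lemma colours_mset_cong: "mset u = mset v \<Longrightarrow> colours u = colours v"
  unfolding colours_def by (simp only: sum_mset_sum_list[symmetric] mset_map)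

lemma weight_mset_cong: "mset u = mset v \<Longrightarrow> weight u = weight v"
  unfolding weight_def by (simp only: sum_mset_sum_list[symmetric] mset_map)

definition lin :: "('c \<Rightarrow> nat) \<Rightarrow> ('c \<Rightarrow>\<^sub>0 nat) \<Rightarrow> nat" where
  "lin f g = (\<Sum>c\<in>Poly_Mapping.keys g. Poly_Mapping.lookup g c * f c)"

lemma lin_superset:
  assumes "finite A" "Poly_Mapping.keys g \<subseteq> A"
  shows "lin f g = (\<Sum>c\<in>A. Poly_Mapping.lookup g c * f c)"
  unfolding lin_def using assms
  by (intro sum.mono_neutral_left) (auto simp: in_keys_iff)

lemma lin_0 [simp]: "lin f 0 = 0"
  by (simp add: lin_def)

lemma lin_add [simp]: "lin f (g + h) = lin f g + lin f h"
proof -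
  let ?A = "Poly_Mapping.keys g \<union> Poly_Mapping.keys h"
  have k: "Poly_Mapping.keys (g + h) \<subseteq> ?A" by (rule Poly_Mapping.keys_add)
  show ?thesis
    by (subst (1 2 3) lin_superset[of ?A])
      (use k in \<open>auto simp: lookup_add algebra_simps sum.distrib\<close>)
qed

lemma lin_single [simp]: "lin f (Poly_Mapping.single c n) = n * f c"
  by (simp add: lin_def)

lemma lin_colours: "lin f (colours w) = (\<Sum>x\<leftarrow>w. f (snd x))"
  by (induction w) auto

abbreviation deg :: "('c \<Rightarrow>\<^sub>0 nat) \<Rightarrow> nat" where
  "deg \<equiv> lin (\<lambda>_. 1)"

lemma deg_colours [simp]: "deg (colours w) = length w"
  by (simp add: lin_colours sum_list_triv)

lemma deg_eq_0_iff [simp]: "deg g = 0 \<longleftrightarrow> g = 0"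
  by (auto simp: lin_def in_keys_iff intro!: poly_mapping_eqI)

lemma colours_eq_0_iff [simp]: "colours w = 0 \<longleftrightarrow> w = []"
  by (metis deg_colours deg_eq_0_iff length_0_conv)

lemma snd_in_keys_colours: "x \<in> set w \<Longrightarrow> snd x \<in> Poly_Mapping.keys (colours w)"
  by (induction w) (auto simp: in_keys_iff lookup_add lookup_single)

locale colour_form =
  fixes a :: "'c::linorder \<Rightarrow> 'c \<Rightarrow> nat" and b :: "'c \<Rightarrow> nat"
  assumes a_sym: "a i j = a j i" and a_diag: "a i i = 2 * b i"
begin

definition shift :: "int \<times> 'c \<Rightarrow> int \<times> 'c \<Rightarrow> int \<times> 'c" where
  "shift x y = (fst y - int (a (snd x) (snd y)), snd y)"

text \<open>\<open>flatten\<close> embeds the good words into the multisets of letters. The good words are those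
  which cannot be made larger by moving a letter to the front by means of locality, see
  \<open>leading_move_front\<close> below.\<close>

primrec flatten :: "(int \<times> 'c) list \<Rightarrow> (int \<times> 'c) list" where
  "flatten [] = []"
| "flatten (x # w) = x # map (shift x) (flatten w)"

primrec good :: "(int \<times> 'c) list \<Rightarrow> bool" where
  "good [] \<longleftrightarrow> True"
| "good (x # w) \<longleftrightarrow> good w \<and> (\<forall>y\<in>set (flatten w). shift x y \<le> x)"

text \<open>Bounding the first letter is enough: all letters of \<open>flatten w\<close> are at most
  \<open>hd w\<close> when \<open>w\<close> is good, so they have first component at most 0. The
  condition mirrors \<open>regular\<close>.\<close>

definition admissible :: "(int \<times> 'c) list \<Rightarrow> bool" where
  "admissible w \<longleftrightarrow> good w \<and> (w \<noteq> [] \<longrightarrow> fst (hd w) \<le> 0)"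

definition adm :: "('c \<Rightarrow>\<^sub>0 nat) \<Rightarrow> int \<Rightarrow> (int \<times> 'c) list set" where
  "adm g N = {w. admissible w \<and> colours w = g \<and> weight w = N}"

lemma shift_le: "shift x y \<le> y"
  by (cases y) (auto simp: shift_def)

lemma inj_shift: "inj (shift x)"
  by (rule injI) (auto simp: shift_def prod_eq_iff)

lemma flatten_append_subset: "set (flatten u) \<subseteq> set (flatten (u @ v))"
  by (induction u) auto

lemma good_appendD: "good (u @ v) \<Longrightarrow> good u \<and> good v"
proof (induction u)
  case (Cons x u)
  then show ?case using flatten_append_subset[of u v] by auto
qed auto

lemma good_flatten_le_hd: "good w \<Longrightarrow> y \<in> set (flatten w) \<Longrightarrow> y \<le> hd w"
  by (cases w) auto

lemma flatten_append_cases: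
  assumes "good v" "y \<in> set (flatten (u @ v))"
  shows "y \<in> set (flatten u) \<or> y \<le> hd v"
  using assms(2)
proof (induction u arbitrary: y)
  case Nil
  then show ?case using good_flatten_le_hd[OF assms(1)] by simp
next
  case (Cons x u)
  then consider "y = x" | z where "y = shift x z" "z \<in> set (flatten (u @ v))" by auto
  then show ?case
  proof cases
    case 2
    then show ?thesis using Cons.IH[OF 2(2)] shift_le[of x z] by (auto intro: order_trans)
  qed auto
qed

text \<open>The non-negativity of \<open>a\<close> is used here in the form of
  \<open>shift_le\<close>: passing the letters of \<open>u\<close> can only lower letters, so those
  of \<open>v\<close> never exceed \<open>hd v\<close>, which is at most each letter of
  \<open>u\<close>.\<close>

lemma good_append:
  assumes "good u" "good v" "\<forall>x\<in>set u. hd v \<le> x"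
  shows "good (u @ v)"
  using assms(1,3)
proof (induction u)
  case Nil
  then show ?case using assms by simp
next
  case (Cons x u)
  have "shift x y \<le> x" if "y \<in> set (flatten (u @ v))" for y
    using flatten_append_cases[OF assms(2) that]
  proof
    assume "y \<le> hd v"
    moreover have "hd v \<le> x" using Cons.prems by simp
    ultimately show ?thesis using shift_le[of x y] by (blast intro: order_trans)
  qed (use Cons.prems in auto)
  then show ?case using Cons by auto
qed

lemma lyndon_hd_le:
  assumes "lyndon l" "x \<in> set l"
  shows "hd l \<le> x"
proof -
  obtain p s where l: "l = p @ x # s" using assms(2) by (metis split_list)
  show ?thesis
  proof (cases p)
    case Nil
    then show ?thesis using l by simp
  next
    case (Cons y p')
    then have "l < x # s" using assms(1) l unfolding lyndon_def by blast
    then show ?thesis using l Cons by auto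
  qed
qed

lemma hd_mono: "k \<le> l \<Longrightarrow> k \<noteq> [] \<Longrightarrow> hd k \<le> hd (l :: 'a::linorder list)"
  by (cases k; cases l) auto

lemma fst_mono: "x \<le> y \<Longrightarrow> fst x \<le> fst (y :: int \<times> 'c)"
  by (cases x; cases y) auto

text \<open>Goodness passes to prefixes and suffixes. Conversely, the first letters of the factors
  weakly decrease and each is the smallest letter of its factor, which is what
  \<open>good_append\<close> asks for.\<close>

lemma admissible_concat_iff:
  "lyndon_seq ls \<Longrightarrow> admissible (concat ls) \<longleftrightarrow> (\<forall>l\<in>set ls. admissible l)"
proof (induction ls)
  case Nil
  then show ?case by (simp add: admissible_def)
next
  case (Cons l ls)
  then have l: "lyndon l" "l \<noteq> []" and ls: "lyndon_seq ls"
    by (auto simp: lyndon_seq_Cons lyndon_def)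
  have hdk: "k \<noteq> [] \<and> hd k \<le> hd l" if "k \<in> set ls" for k
    using Cons.prems that by (auto simp: lyndon_seq_def lyndon_def intro!: hd_mono)
  have hdc: "hd (concat ls) \<le> hd l \<and> concat ls \<noteq> []" if "ls \<noteq> []"
    using that hdk by (cases ls) auto
  show ?case
  proof
    assume adm: "admissible (concat (l # ls))"
    then have "admissible l" using l good_appendD[of l "concat ls"]
      by (auto simp: admissible_def)
    moreover have "admissible (concat ls)"
      using adm good_appendD[of l "concat ls"] hdc fst_mono[of "hd (concat ls)" "hd l"] l
      by (cases "ls = []") (auto simp: admissible_def)
    ultimately show "\<forall>k\<in>set (l # ls). admissible k"
      using Cons.IH ls by simp
  next
    assume adm: "\<forall>k\<in>set (l # ls). admissible k"
    then have "admissible (concat ls)" using Cons.IH ls by simp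
    moreover have "good (l @ concat ls)" if "ls \<noteq> []"
      using adm \<open>admissible (concat ls)\<close> hdc[OF that] lyndon_hd_le[OF l(1)]
      by (intro good_append) (auto simp: admissible_def intro: order_trans)
    ultimately show "admissible (concat (l # ls))"
      using adm l by (cases "ls = []") (auto simp: admissible_def)
  qed
qed

lemma admissible_iff_factors: "admissible w \<longleftrightarrow> (\<forall>l\<in>set (lyndon_factors w). admissible l)"
  using admissible_concat_iff[of "lyndon_factors w"] by simp

lemma admissible_max_shuffle: "admissible u \<Longrightarrow> admissible v \<Longrightarrow> admissible (max_shuffle u v)"
  using admissible_iff_factors[of u] admissible_iff_factors[of v]
    admissible_iff_factors[of "max_shuffle u v"]
  by (metis UnE mset_lyndon_factors_max_shuffle set_mset_mset set_mset_union)

lemma mset_max_shuffle: "mset (max_shuffle u v) = mset u + mset v"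
  using mset_shuffles[OF max_shuffle_in_shuffles] .

lemma adm_max_shuffle:
  assumes "u \<in> adm g N" "v \<in> adm g' N'"
  shows "max_shuffle u v \<in> adm (g + g') (N + N')"
  using assms admissible_max_shuffle[of u v] mset_max_shuffle[of u v]
    colours_mset_cong[of "max_shuffle u v" "u @ v"] weight_mset_cong[of "max_shuffle u v" "u @ v"]
  by (auto simp: adm_def)

lemma colours_flatten [simp]: "colours (flatten w) = colours w"
proof -
  have shift: "colours (map (shift x) v) = colours v" for x v
    by (induction v) (auto simp: shift_def)
  show ?thesis by (induction w) (auto simp: shift)
qed

text \<open>The first letter is recovered as the largest letter of the flattened multiset. Removing
  it and undoing the injective \<open>shift\<close> leaves the flattening of the tail.\<close>

lemma flatten_inj: "good u \<Longrightarrow> good v \<Longrightarrow> mset (flatten u) = mset (flatten v) \<Longrightarrow> u = v"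
proof (induction u arbitrary: v)
  case Nil
  then show ?case by (cases v) auto
next
  case (Cons x u)
  obtain y w where v: "v = y # w" using Cons.prems(3) by (cases v) auto
  have "x \<in> set (flatten v)" "y \<in> set (flatten (x # u))"
    using mset_eq_setD[OF Cons.prems(3)] v by auto
  then have "x = y"
    using good_flatten_le_hd[OF Cons.prems(1)] good_flatten_le_hd[OF Cons.prems(2)] v
    by (metis list.sel(1) order_antisym)
  then have "image_mset (shift x) (mset (flatten u)) = image_mset (shift x) (mset (flatten w))"
    using Cons.prems(3) v by simp
  then have "mset (flatten u) = mset (flatten w)"
    using multiset.inj_map[OF inj_shift] by (meson injD)
  then show ?case using Cons v \<open>x = y\<close> by auto
qed

text \<open>For the form of a quiver this is minus the sum of the Tits forms
  (\<open>sum_tits_form\<close>). The division is exact, see \<open>quad_double\<close>.\<close>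

definition quad :: "('c \<Rightarrow>\<^sub>0 nat) \<Rightarrow> nat" where
  "quad g = (lin (\<lambda>i. lin (a i) g) g) div 2"

lemma weight_map_shift: "weight (map (shift x) v) = weight v - int (lin (a (snd x)) (colours v))"
  by (induction v) (auto simp: shift_def)

text \<open>Both sides are doubled so that the evenness of the quadratic form can be read off from
  the identity.\<close>

lemma weight_flatten_double:
  "2 * (weight w + int (lin b (colours w))) =
   2 * weight (flatten w) + int (lin (\<lambda>i. lin (a i) (colours w)) (colours w))"
proof (induction w)
  case (Cons x w)
  have swap: "lin (\<lambda>i. a i (snd x)) (colours v) = lin (a (snd x)) (colours v)"
    for v :: "(int \<times> 'c) list"
    by (simp only: a_sym[of _ "snd x"])
  have lin_fun: "lin (\<lambda>i. f i + h i) g = lin f g + lin h g" for f h :: "'c \<Rightarrow> nat" and g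
    by (simp add: lin_def algebra_simps sum.distrib)
  show ?case using Cons.IH
    by (simp add: weight_map_shift a_diag lin_fun swap algebra_simps)
qed simp

lemma even_quad: "even (lin (\<lambda>i. lin (a i) (colours w)) (colours w))"
proof -
  have "int (lin (\<lambda>i. lin (a i) (colours w)) (colours w))
      = 2 * (weight w + int (lin b (colours w)) - weight (flatten w))"
    using weight_flatten_double[of w] by simp
  then show ?thesis by (metis dvd_triv_left even_of_nat)
qed

text \<open>Each unordered pair of positions contributes once to the weight shift of \<open>flatten\<close>; the
  diagonal of the quadratic form accounts for the summand \<open>lin b\<close>.\<close>

lemma weight_flatten:
  "weight w + int (lin b (colours w)) = weight (flatten w) + int (quad (colours w))"
  using weight_flatten_double[of w] even_quad[of w] unfolding quad_def by presburger

text \<open>These multisets are the target of \<open>flatten\<close> and index the symmetric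
  numerators below. Since the variable of a letter \<open>(n, c)\<close> is raised to the power
  \<open>-n\<close>, those numerators are polynomials.\<close>

definition colour_multisets :: "('c \<Rightarrow>\<^sub>0 nat) \<Rightarrow> int \<Rightarrow> (int \<times> 'c) multiset set" where
  "colour_multisets g N = mset ` {w. (\<forall>x\<in>set w. fst x \<le> 0) \<and> colours w = g \<and> weight w = N}"

lemma weight_nonpos_elem:
  "\<forall>x\<in>set w. fst x \<le> 0 \<Longrightarrow> x \<in> set w \<Longrightarrow> weight w \<le> fst x"
proof (induction w)
  case (Cons y w)
  have "weight w \<le> 0" using Cons.prems(1) by (induction w) auto
  then show ?case using Cons by force
qed simp

lemma finite_colour_multisets: "finite (colour_multisets g N)"
  unfolding colour_multisets_def
proof (rule finite_imageI, rule finite_subset)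
  show "finite {xs. set xs \<subseteq> {N..0} \<times> Poly_Mapping.keys g \<and> length xs = deg g}"
    by (rule finite_lists_length_eq) simp
  show "{w. (\<forall>x\<in>set w. fst x \<le> 0) \<and> colours w = g \<and> weight w = N}
      \<subseteq> {xs. set xs \<subseteq> {N..0} \<times> Poly_Mapping.keys g \<and> length xs = deg g}"
  proof
    fix w assume "w \<in> {w. (\<forall>x\<in>set w. fst x \<le> 0) \<and> colours w = g \<and> weight w = N}"
    then have w: "\<forall>x\<in>set w. fst x \<le> 0" "colours w = g" "weight w = N" by auto
    have "x \<in> {N..0} \<times> Poly_Mapping.keys g" if "x \<in> set w" for x
      using weight_nonpos_elem[OF w(1) that] snd_in_keys_colours[OF that] w that
      by (cases x) auto
    then show "w \<in> {xs. set xs \<subseteq> {N..0} \<times> Poly_Mapping.keys g \<and> length xs = deg g}"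
      using w(2) deg_colours[of w] by auto
  qed
qed

lemma flatten_adm:
  "w \<in> adm g N \<Longrightarrow> mset (flatten w) \<in> colour_multisets g (N + int (lin b g) - int (quad g))"
proof -
  assume w: "w \<in> adm g N"
  have "fst y \<le> 0" if "y \<in> set (flatten w)" for y
    using w that good_flatten_le_hd[of w y] fst_mono[of y "hd w"]
    by (cases w) (auto simp: adm_def admissible_def)
  moreover have "weight (flatten w) = N + int (lin b g) - int (quad g)"
    using w weight_flatten[of w] by (simp add: adm_def)
  ultimately show ?thesis
    using w by (auto simp: colour_multisets_def adm_def intro!: imageI)
qed

lemma inj_on_flatten_adm: "inj_on (\<lambda>w. mset (flatten w)) (adm g N)"
  by (rule inj_onI) (auto simp: adm_def admissible_def intro: flatten_inj)

lemma finite_adm: "finite (adm g N)"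
  by (rule inj_on_finite[OF inj_on_flatten_adm image_subsetI finite_colour_multisets])
    (rule flatten_adm)

lemma card_adm_le: "card (adm g N) \<le> card (colour_multisets g (N + int (lin b g) - int (quad g)))"
  by (rule card_inj_on_le[OF inj_on_flatten_adm image_subsetI finite_colour_multisets])
    (rule flatten_adm)

lemma adm_empty: "N > int (quad g) - int (lin b g) \<Longrightarrow> adm g N = {}"
proof (rule ccontr)
  assume N: "N > int (quad g) - int (lin b g)" and "adm g N \<noteq> {}"
  then obtain w where "w \<in> adm g N" by blast
  from flatten_adm[OF this] obtain v :: "(int \<times> 'c) list" where v: "\<forall>x\<in>set v. fst x \<le> 0"
    "weight v = N + int (lin b g) - int (quad g)"
    by (auto simp: colour_multisets_def)
  from v(1) have "weight v \<le> 0" by (induction v) auto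
  then show False using v N by simp
qed

end

section \<open>The shuffle product of functions on words\<close>

definition lder :: "'a \<Rightarrow> ('a list \<Rightarrow> 'b) \<Rightarrow> 'a list \<Rightarrow> 'b" where
  "lder x F = (\<lambda>w. F (x # w))"

definition lders :: "'a list \<Rightarrow> ('a list \<Rightarrow> 'b) \<Rightarrow> 'a list \<Rightarrow> 'b" where
  "lders u F = (\<lambda>w. F (u @ w))"

definition scl :: "rat \<Rightarrow> ('a \<Rightarrow> rat) \<Rightarrow> 'a \<Rightarrow> rat" where
  "scl r F = (\<lambda>w. r * F w)"

lemma lder_simps [simp]:
  "lder x (F + G) = lder x F + lder x G" "lder x (F - G) = lder x F - lder x G"
  "lder x 0 = 0" "lder x (scl r F) = scl r (lder x F)"
  by (auto simp: lder_def scl_def)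

lemma lders_simps [simp]: "lders [] F = F" "lders (x # u) F = lders u (lder x F)"
  by (simp_all add: lders_def lder_def)

lemma lders_arith [simp]:
  "lders u (F + G) = lders u F + lders u G" "lders u (F - G) = lders u F - lders u G"
  "lders u 0 = 0" "lders u (scl r F) = scl r (lders u F)"
  by (auto simp: lders_def scl_def)

lemma scl_simps [simp]:
  "scl r (F + G) = scl r F + scl r G" "scl r (F - G) = scl r F - scl r G"
  "scl r 0 = 0" "scl 0 F = 0" "scl 1 F = F" "scl r (scl s F) = scl (r * s) F"
  by (auto simp: scl_def algebra_simps)

lemma scl_apply: "scl r F w = r * F w"
  by (simp add: scl_def)

text \<open>Recursion on the word with changing functions makes every \<open>lder x\<close> a
  derivation by definition; identities then follow by induction on the word, generalised over the
  functions.\<close>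

primrec shuffle_at :: "'a list \<Rightarrow> ('a list \<Rightarrow> rat) \<Rightarrow> ('a list \<Rightarrow> rat) \<Rightarrow> rat" where
  "shuffle_at [] F G = F [] * G []"
| "shuffle_at (x # w) F G = shuffle_at w (lder x F) G + shuffle_at w F (lder x G)"

definition shp :: "('a list \<Rightarrow> rat) \<Rightarrow> ('a list \<Rightarrow> rat) \<Rightarrow> 'a list \<Rightarrow> rat" where
  "shp F G = (\<lambda>w. shuffle_at w F G)"

lemma shp_Nil [simp]: "shp F G [] = F [] * G []"
  by (simp add: shp_def)

lemma lder_shp [simp]: "lder x (shp F G) = shp (lder x F) G + shp F (lder x G)"
  by (auto simp: shp_def lder_def)

lemma shp_Cons: "shp F G (x # w) = shp (lder x F) G w + shp F (lder x G) w"
  by (simp add: shp_def)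

lemma shp_commute: "shp F G = shp G F"
proof
  show "shp F G w = shp G F w" for w
    by (induction w arbitrary: F G) (auto simp: shp_Cons)
qed

lemma shp_add_left: "shp (F + F') G = shp F G + shp F' G"
proof
  show "shp (F + F') G w = (shp F G + shp F' G) w" for w
    by (induction w arbitrary: F F' G) (auto simp: shp_Cons algebra_simps)
qed

lemma shp_add_right: "shp G (F + F') = shp G F + shp G F'"
  using shp_add_left[of F F' G] by (simp add: shp_commute)

lemma shp_scl_left: "shp (scl r F) G = scl r (shp F G)"
proof
  show "shp (scl r F) G w = scl r (shp F G) w" for w
    by (induction w arbitrary: F G) (auto simp: shp_Cons scl_apply algebra_simps)
qed

lemma shp_scl_right: "shp G (scl r F) = scl r (shp G F)"
  using shp_scl_left[of r F G] by (simp add: shp_commute)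

lemma shp_0_left [simp]: "shp 0 G = 0"
  using shp_scl_left[of 0 0 G] by simp

lemma shp_0_right [simp]: "shp G 0 = 0"
  using shp_0_left[of G] by (simp add: shp_commute)

lemma shp_diff_left: "shp (F - F') G = shp F G - shp F' G"
  using shp_add_left[of "F - F'" F' G] by (simp add: algebra_simps)

lemma shp_diff_right: "shp G (F - F') = shp G F - shp G F'"
  using shp_diff_left[of F F' G] by (simp add: shp_commute)

lemma shp_assoc: "shp (shp F G) H = shp F (shp G H)"
proof
  show "shp (shp F G) H w = shp F (shp G H) w" for w
    by (induction w arbitrary: F G H) (auto simp: shp_Cons shp_add_left shp_add_right)
qed

definition word_delta :: "'a list \<Rightarrow> 'a list \<Rightarrow> rat" where
  "word_delta u = (\<lambda>w. if w = u then 1 else 0)"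

lemma lder_word_delta [simp]:
  "lder x (word_delta []) = 0" "lder x (word_delta (y # u)) = (if x = y then word_delta u else 0)"
  by (auto simp: lder_def word_delta_def)

lemma shp_one_left [simp]: "shp (word_delta []) F = F"
proof
  show "shp (word_delta []) F w = F w" for w
  proof (induction w arbitrary: F)
    case Nil
    then show ?case by (simp add: word_delta_def)
  next
    case (Cons x w)
    then have "shp (word_delta []) (lder x F) w = F (x # w)" by (simp add: lder_def)
    then show ?case by (simp add: shp_Cons)
  qed
qed

lemma shp_nonzeroD:
  "shp F G w \<noteq> 0 \<Longrightarrow> \<exists>u v. F u \<noteq> 0 \<and> G v \<noteq> 0 \<and> w \<in> shuffles u v"
proof (induction w arbitrary: F G)
  case Nil
  then show ?case by (intro exI[of _ "[]"]) auto
next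
  case (Cons x w)
  have "shp (lder x F) G w \<noteq> 0 \<or> shp F (lder x G) w \<noteq> 0"
    using Cons.prems by (auto simp: shp_Cons)
  then consider "shp (lder x F) G w \<noteq> 0" | "shp F (lder x G) w \<noteq> 0" by blast
  then show ?case
  proof cases
    case 1
    from Cons.IH[OF this] show ?thesis by (auto simp: lder_def intro: Cons_in_shuffles_leftI)
  next
    case 2
    from Cons.IH[OF this] show ?thesis by (auto simp: lder_def intro: Cons_in_shuffles_rightI)
  qed
qed

lemma shp_delta_nonneg: "shp (word_delta u) (word_delta v) w \<ge> 0"
proof -
  have "(\<And>w. F w \<ge> 0) \<Longrightarrow> (\<And>w. G w \<ge> 0) \<Longrightarrow> shp F G w \<ge> 0" for F G :: "'a list \<Rightarrow> rat"
    by (induction w arbitrary: F G) (auto simp: shp_Cons lder_def)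
  then show ?thesis by (simp add: word_delta_def)
qed

lemma shp_delta_pos: "w \<in> shuffles u v \<Longrightarrow> shp (word_delta u) (word_delta v) w > 0"
proof (induction w arbitrary: u v)
  case Nil
  then show ?case by (auto simp: word_delta_def)
next
  case (Cons x w)
  then consider (a) u' where "u = x # u'" "w \<in> shuffles u' v" | (b) v' where "v = x # v'" "w \<in> shuffles u v'"
    by (auto simp: Cons_in_shuffles_iff neq_Nil_conv)
  then show ?case
  proof cases
    case a
    have "shp (word_delta u) (lder x (word_delta v)) w \<ge> 0"
      by (cases v) (auto simp: shp_delta_nonneg)
    then show ?thesis using a Cons.IH[OF a(2)] by (auto simp: shp_Cons)
  next
    case b
    have "shp (lder x (word_delta u)) (word_delta v) w \<ge> 0"
      by (cases u) (auto simp: shp_delta_nonneg)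
    then show ?thesis using b Cons.IH[OF b(2)] by (auto simp: shp_Cons)
  qed
qed

text \<open>After the values of \<open>F\<close> at \<open>u\<close> and of \<open>G\<close> at
  \<open>v\<close> are split off, the remaining products contribute nothing at \<open>w\<close>.
  There is left \<open>F u\<close>, \<open>G v\<close> and the positive number of interleavings of
  \<open>u\<close> and \<open>v\<close> that give \<open>w\<close>.\<close>

lemma shp_at_unique:
  assumes w: "w \<in> shuffles u v"
    and unique: "\<And>u' v'. w \<in> shuffles u' v' \<Longrightarrow> F u' \<noteq> 0 \<Longrightarrow> G v' \<noteq> 0 \<Longrightarrow> u' = u \<and> v' = v"
    and "F u \<noteq> 0" "G v \<noteq> 0"
  shows "shp F G w \<noteq> 0"
proof -
  define F' where "F' = F(u := 0)"
  define G' where "G' = G(v := 0)"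
  have F: "F = scl (F u) (word_delta u) + F'" and G: "G = scl (G v) (word_delta v) + G'"
    by (auto simp: F'_def G'_def scl_def word_delta_def)
  have "shp F' G w = 0"
  proof (rule ccontr)
    assume "\<not> ?thesis"
    then obtain u' v' where *: "F' u' \<noteq> 0" "G v' \<noteq> 0" "w \<in> shuffles u' v'"
      using shp_nonzeroD by blast
    then have "u' \<noteq> u" "F u' \<noteq> 0" by (auto simp: F'_def split: if_splits)
    then show False using unique[of u' v'] * by auto
  qed
  moreover have "shp (scl (F u) (word_delta u)) G' w = 0"
  proof (rule ccontr)
    assume "\<not> ?thesis"
    then obtain u' v' where *: "scl (F u) (word_delta u) u' \<noteq> 0" "G' v' \<noteq> 0" "w \<in> shuffles u' v'"
      using shp_nonzeroD by blast
    then have "u' = u" "v' \<noteq> v" "G v' \<noteq> 0"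
      by (auto simp: scl_def word_delta_def G'_def split: if_splits)
    then show False using unique[of u v'] * assms(3) by auto
  qed
  moreover have "shp F G w = shp F' G w + shp (scl (F u) (word_delta u)) G' w
      + F u * G v * shp (word_delta u) (word_delta v) w"
  proof -
    have "shp F G = shp (scl (F u) (word_delta u)) G + shp F' G"
      by (subst F) (simp add: shp_add_left)
    also have "shp (scl (F u) (word_delta u)) G = shp (scl (F u) (word_delta u)) G'
        + scl (F u * G v) (shp (word_delta u) (word_delta v))"
      by (subst G) (simp add: shp_add_right shp_scl_left shp_scl_right mult.commute)
    finally show ?thesis by (simp add: scl_apply)
  qed
  ultimately show ?thesis using shp_delta_pos[OF w] assms(3,4) by simp
qed

text \<open>The equality of lengths is included because \<open>max_shuffle_strict_mono_left\<close>
  compares words of equal length.\<close>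

definition leading :: "('a::linorder list \<Rightarrow> rat) \<Rightarrow> 'a list \<Rightarrow> bool" where
  "leading F w \<longleftrightarrow> F w \<noteq> 0 \<and> (\<forall>v. F v \<noteq> 0 \<longrightarrow> v \<le> w \<and> length v = length w)"

lemma leading_shp:
  assumes F: "leading F u" and G: "leading G v"
  shows "leading (shp F G) (max_shuffle u v)"
  unfolding leading_def
proof (intro conjI allI impI)
  have mono: "max_shuffle u' v' \<le> max_shuffle u v"
    and eq: "max_shuffle u' v' = max_shuffle u v \<Longrightarrow> u' = u \<and> v' = v"
    if "F u' \<noteq> 0" "G v' \<noteq> 0" for u' v'
  proof -
    have 1: "u' \<le> u" "v' \<le> v" "length u' = length u" "length v' = length v"
      using that F G unfolding leading_def by blast+
    have 2: "u' < u \<Longrightarrow> max_shuffle u' v' < max_shuffle u v'"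
      and 3: "v' < v \<Longrightarrow> max_shuffle u v' < max_shuffle u v"
      using max_shuffle_strict_mono_left[of u' u v'] max_shuffle_strict_mono_left[of v' v u] 1
      by (simp_all add: max_shuffle_commute[of v' u] max_shuffle_commute[of v u])
    have 4: "max_shuffle u' v' \<le> max_shuffle u v'" "max_shuffle u v' \<le> max_shuffle u v"
      using 1 2 3 by (cases "u' = u"; force)+
    then show "max_shuffle u' v' \<le> max_shuffle u v"
      by (rule order_trans)
    show "u' = u \<and> v' = v" if "max_shuffle u' v' = max_shuffle u v"
      using 1 2 3 4 that by (metis order.order_iff_strict order_less_le_trans order_less_irrefl)
  qed
  show "shp F G (max_shuffle u v) \<noteq> 0"
  proof (rule shp_at_unique[OF max_shuffle_in_shuffles])
    fix u' v' assume *: "max_shuffle u v \<in> shuffles u' v'" "F u' \<noteq> 0" "G v' \<noteq> 0"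
    then have "max_shuffle u v \<le> max_shuffle u' v'" by (simp add: shuffles_le_max_shuffle)
    then show "u' = u \<and> v' = v" using mono[OF *(2,3)] eq[OF *(2,3)] by simp
  qed (use F G in \<open>auto simp: leading_def\<close>)
  fix w assume "shp F G w \<noteq> 0"
  then obtain u' v' where *: "F u' \<noteq> 0" "G v' \<noteq> 0" "w \<in> shuffles u' v'"
    using shp_nonzeroD by blast
  have "w \<le> max_shuffle u' v'" using *(3) by (rule shuffles_le_max_shuffle)
  also have "\<dots> \<le> max_shuffle u v" using mono *(1,2) by simp
  finally show "w \<le> max_shuffle u v" .
  have "length w = length u' + length v'" using *(3) by (rule length_shuffles)
  also have "\<dots> = length u + length v"
    using *(1,2) F G unfolding leading_def by metis
  also have "\<dots> = length (max_shuffle u v)"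
    using length_shuffles[OF max_shuffle_in_shuffles[of u v]] by simp
  finally show "length w = length (max_shuffle u v)" .
qed


section \<open>The derivations given by translation and by the first power sum\<close>

primrec raise_at :: "(int \<times> 'c) list \<Rightarrow> ((int \<times> 'c) list \<Rightarrow> rat) \<Rightarrow> rat" where
  "raise_at [] F = 0"
| "raise_at (x # w) F = F ((fst x + 1, snd x) # w) + raise_at w (lder x F)"

text \<open>On generating functions, with the variable of a letter \<open>(n, c)\<close> raised to the power \<open>-n\<close>,
  this is multiplication by the sum of all variables.\<close>

definition raise :: "((int \<times> 'c) list \<Rightarrow> rat) \<Rightarrow> (int \<times> 'c) list \<Rightarrow> rat" where
  "raise F = (\<lambda>w. raise_at w F)"

primrec lower_at :: "(int \<times> 'c) list \<Rightarrow> ((int \<times> 'c) list \<Rightarrow> rat) \<Rightarrow> rat" where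
  "lower_at [] F = 0"
| "lower_at (x # w) F =
     (1 - of_int (fst x)) * F ((fst x - 1, snd x) # w) + lower_at w (lder x F)"

text \<open>On generating functions, this is the sum of all partial derivatives.\<close>

definition lower :: "((int \<times> 'c) list \<Rightarrow> rat) \<Rightarrow> (int \<times> 'c) list \<Rightarrow> rat" where
  "lower F = (\<lambda>w. lower_at w F)"

lemma raise_Nil [simp]: "raise F [] = 0" and lower_Nil [simp]: "lower F [] = 0"
  by (simp_all add: raise_def lower_def)

lemma lder_raise [simp]: "lder x (raise F) = lder (fst x + 1, snd x) F + raise (lder x F)"
  by (auto simp: lder_def raise_def)

lemma lder_lower [simp]:
  "lder x (lower F) = scl (1 - of_int (fst x)) (lder (fst x - 1, snd x) F) + lower (lder x F)"
  by (auto simp: lder_def lower_def scl_def)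

lemma raise_Cons: "raise F (x # w) = lder (fst x + 1, snd x) F w + raise (lder x F) w"
  by (simp add: raise_def lder_def)

lemma lower_Cons:
  "lower F (x # w) = (1 - of_int (fst x)) * lder (fst x - 1, snd x) F w + lower (lder x F) w"
  by (simp add: lower_def lder_def)

lemma raise_add: "raise (F + G) = raise F + raise G"
proof
  show "raise (F + G) w = (raise F + raise G) w" for w
    by (induction w arbitrary: F G) (auto simp: raise_Cons)
qed

lemma raise_scl: "raise (scl r F) = scl r (raise F)"
proof
  show "raise (scl r F) w = scl r (raise F) w" for w
    by (induction w arbitrary: F) (auto simp: raise_Cons scl_apply algebra_simps)
qed

lemma raise_0 [simp]: "raise 0 = 0"
  using raise_scl[of 0 0] by simp

lemma raise_diff: "raise (F - G) = raise F - raise G"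
  using raise_add[of "F - G" G] by (simp add: algebra_simps)

lemma lower_add: "lower (F + G) = lower F + lower G"
proof
  show "lower (F + G) w = (lower F + lower G) w" for w
    by (induction w arbitrary: F G) (auto simp: lower_Cons algebra_simps)
qed

lemma lower_scl: "lower (scl r F) = scl r (lower F)"
proof
  show "lower (scl r F) w = scl r (lower F) w" for w
    by (induction w arbitrary: F) (auto simp: lower_Cons scl_apply algebra_simps)
qed

lemma lower_0 [simp]: "lower 0 = 0"
  using lower_scl[of 0 0] by simp

lemma lower_diff: "lower (F - G) = lower F - lower G"
  using lower_add[of "F - G" G] by (simp add: algebra_simps)

lemma raise_shp: "raise (shp F G) = shp (raise F) G + shp F (raise G)"
proof
  show "raise (shp F G) w = (shp (raise F) G + shp F (raise G)) w" for w
    by (induction w arbitrary: F G)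
      (auto simp: raise_Cons shp_Cons raise_add shp_add_left shp_add_right)
qed

lemma lower_shp: "lower (shp F G) = shp (lower F) G + shp F (lower G)"
proof
  show "lower (shp F G) w = (shp (lower F) G + shp F (lower G)) w" for w
    by (induction w arbitrary: F G)
      (auto simp: lower_Cons shp_Cons lower_add shp_add_left shp_add_right shp_scl_left
        shp_scl_right scl_apply algebra_simps)
qed

text \<open>On generating functions this is the commutator of the sum of the partial derivatives
  with multiplication by the sum of the variables; each variable contributes 1.\<close>

lemma lower_raise: "lower (raise F) w = raise (lower F) w + of_nat (length w) * F w"
proof (induction w arbitrary: F)
  case (Cons x w)
  have "F (x # w) = lder x F w" by (simp add: lder_def)
  then show ?case using Cons
    by (simp add: lower_Cons raise_Cons lower_add raise_add raise_scl scl_apply algebra_simps)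
qed simp


section \<open>Local functions\<close>

text \<open>If \<open>f k l\<close> is the coefficient of \<open>z\<close> to the \<open>-k\<close>
  times \<open>w\<close> to the \<open>-l\<close>, this is multiplication by the \<open>n\<close>-th
  power of \<open>z - w\<close>.\<close>

primrec difference :: "nat \<Rightarrow> (int \<Rightarrow> int \<Rightarrow> 'b::ab_group_add) \<Rightarrow> int \<Rightarrow> int \<Rightarrow> 'b" where
  "difference 0 f = f"
| "difference (Suc n) f = difference n (\<lambda>k l. f (k + 1) l - f k (l + 1))"

lemma difference_additive:
  assumes "\<And>x y. L (x - y) = L x - L y"
  shows "difference n (\<lambda>k l. L (f k l)) = (\<lambda>k l. L (difference n f k l))"
  by (induction n arbitrary: f) (simp_all flip: assms)

lemma difference_add:
  "difference n (\<lambda>k l. f k l + g k l) = (\<lambda>k l. difference n f k l + difference n g k l)"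
proof (induction n arbitrary: f g)
  case (Suc n)
  have "(\<lambda>k l. f (k + 1) l + g (k + 1) l - (f k (l + 1) + g k (l + 1)))
      = (\<lambda>k l. (f (k + 1) l - f k (l + 1)) + (g (k + 1) l - g k (l + 1)))"
    by (simp add: algebra_simps)
  then show ?case using Suc by simp
qed simp

lemma difference_commute:
  assumes "\<And>f. E (\<lambda>k l. f (k + 1) l - f k (l + 1)) = (\<lambda>k l. E f (k + 1) l - E f k (l + 1))"
  shows "difference n (E f) = E (difference n f)"
  by (induction n arbitrary: f) (simp_all flip: assms)

text \<open>In the \<open>n\<close>-th power of \<open>z - w\<close>, only the term that takes
  \<open>- w\<close> every time refers to the first index \<open>k0\<close>; all others refer to
  larger ones, where \<open>f\<close> vanishes.\<close>

lemma difference_leading: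
  "\<forall>k>k0. \<forall>l. f k l = 0 \<Longrightarrow> difference n f k0 (l - int n) = (if even n then f k0 l else - f k0 l)"
proof (induction n arbitrary: f l)
  case (Suc n)
  have "difference n (\<lambda>k l. f (k + 1) l - f k (l + 1)) k0 (l - 1 - int n)
     = (if even n then f (k0 + 1) (l - 1) - f k0 (l - 1 + 1) else - (f (k0 + 1) (l - 1) - f k0 (l - 1 + 1)))"
    using Suc.prems by (subst Suc.IH) auto
  then show ?case using Suc.prems by (auto simp: algebra_simps)
qed simp

lemma difference_nonzeroD:
  "difference n f k l \<noteq> 0 \<Longrightarrow> \<exists>k' l'. l \<le> l' \<and> f k' l' \<noteq> 0"
proof (induction n arbitrary: f)
  case (Suc n)
  then obtain k' l' where *: "l \<le> l'" "f (k' + 1) l' - f k' (l' + 1) \<noteq> 0" by fastforce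
  then have "f (k' + 1) l' \<noteq> 0 \<or> f k' (l' + 1) \<noteq> 0" by auto
  then show ?case using *(1) by (meson order_trans zle_add1_eq_le less_imp_le zless_add1_eq)
qed auto

context colour_form
begin

text \<open>The word \<open>u\<close> and the remaining argument of the functions are the letters
  before and after the two neighbours.\<close>

definition local :: "((int \<times> 'c) list \<Rightarrow> rat) \<Rightarrow> bool" where
  "local F \<longleftrightarrow> (\<forall>u i j.
     difference (a i j) (\<lambda>k l. lder (l, j) (lder (k, i) (lders u F))) =
     difference (a i j) (\<lambda>k l. lder (k, i) (lder (l, j) (lders u F))))"

text \<open>This gives a largest possible next letter after any fixed prefix, and thereby leading
  words.\<close>

definition bounded :: "((int \<times> 'c) list \<Rightarrow> rat) \<Rightarrow> bool" where
  "bounded F \<longleftrightarrow> (\<forall>u. \<exists>N. \<forall>k>N. \<forall>i. lder (k, i) (lders u F) = 0)"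

text \<open>Only the first letter is restricted, because expanding the denominators gives later
  letters positive first components.\<close>

definition regular :: "((int \<times> 'c) list \<Rightarrow> rat) \<Rightarrow> bool" where
  "regular F \<longleftrightarrow> (\<forall>k>0. \<forall>i. lder (k, i) F = 0)"

definition fields :: "('c \<Rightarrow>\<^sub>0 nat) \<Rightarrow> int \<Rightarrow> ((int \<times> 'c) list \<Rightarrow> rat) set" where
  "fields g N = {F. local F \<and> bounded F \<and> regular F \<and>
     (\<forall>w. F w \<noteq> 0 \<longrightarrow> colours w = g \<and> weight w = N)}"

lemma localD:
  "local F \<Longrightarrow> difference (a i j) (\<lambda>k l. lder (l, j) (lder (k, i) (lders u F))) =
     difference (a i j) (\<lambda>k l. lder (k, i) (lder (l, j) (lders u F)))"
  by (simp add: local_def)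

lemma local_lder: "local F \<Longrightarrow> local (lder x F)"
  unfolding local_def by (metis lders_simps(2))

lemma local_0 [simp]: "local 0"
  by (simp add: local_def)

lemma local_add: "local F \<Longrightarrow> local G \<Longrightarrow> local (F + G)"
  unfolding local_def by (simp add: difference_add)

lemma local_scl: "local F \<Longrightarrow> local (scl r F)"
  unfolding local_def by (simp add: difference_additive[of "scl r"])

lemma local_shp:
  assumes "local F" "local G"
  shows "local (shp F G)"
proof -
  have "difference (a i j) (\<lambda>k l. lder (l, j) (lder (k, i) (lders u (shp F G)))) =
     difference (a i j) (\<lambda>k l. lder (k, i) (lder (l, j) (lders u (shp F G))))" for u i j
    using assms
  proof (induction u arbitrary: F G)
    case Nil
    let ?n = "a i j"
    let ?S = "\<lambda>F k l. lder (l, j) (lder (k, i) F)" and ?T = "\<lambda>F k l. lder (k, i) (lder (l, j) F)"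
    \<comment> \<open>The mixed terms, in which the two letters go to different factors, are
      symmetric and therefore agree on both sides of the locality relation.\<close>
    let ?M = "\<lambda>k l. shp (lder (k, i) F) (lder (l, j) G) + shp (lder (l, j) F) (lder (k, i) G)"
    have eq: "difference ?n (?S F) = difference ?n (?T F)" "difference ?n (?S G) = difference ?n (?T G)"
      using Nil[unfolded local_def] by (metis lders_simps(1))+
    have 1: "difference ?n (\<lambda>k l. shp (f k l) G) = (\<lambda>k l. shp (difference ?n f k l) G)" for f
      by (rule difference_additive[where L = "\<lambda>X. shp X G"]) (rule shp_diff_left)
    have 2: "difference ?n (\<lambda>k l. shp F (f k l)) = (\<lambda>k l. shp F (difference ?n f k l))" for f
      by (rule difference_additive[where L = "shp F"]) (rule shp_diff_right)
    have "(?S (shp F G)) = (\<lambda>k l. (shp (?S F k l) G + shp F (?S G k l)) + ?M k l)"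
      "(?T (shp F G)) = (\<lambda>k l. (shp (?T F k l) G + shp F (?T G k l)) + ?M k l)"
      by (simp_all add: algebra_simps)
    then show ?case
      by (simp only: lders_simps difference_add 1 2 eq)
  next
    case (Cons x u)
    show ?case
      by (simp only: lders_simps lder_shp lders_arith lder_simps difference_add
        Cons.IH[OF local_lder[OF Cons.prems(1)] Cons.prems(2)]
        Cons.IH[OF Cons.prems(1) local_lder[OF Cons.prems(2)]])
  qed
  then show ?thesis by (simp add: local_def)
qed

lemma local_raise:
  assumes "local F"
  shows "local (raise F)"
proof -
  have "difference (a i j) (\<lambda>k l. lder (l, j) (lder (k, i) (lders u (raise F)))) =
     difference (a i j) (\<lambda>k l. lder (k, i) (lder (l, j) (lders u (raise F))))" for u i j
    using assms
  proof (induction u arbitrary: F)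
    case Nil
    let ?n = "a i j"
    let ?S = "\<lambda>F k l. lder (l, j) (lder (k, i) F)" and ?T = "\<lambda>F k l. lder (k, i) (lder (l, j) F)"
    \<comment> \<open>Multiplication by the sum of the two variables, which commutes with
      multiplication by their difference.\<close>
    define E where "E = (\<lambda>f k l. f (k + 1 :: int) l + f k (l + 1 :: int) :: (int \<times> 'c) list \<Rightarrow> rat)"
    have eq: "difference ?n (?S F) = difference ?n (?T F)"
      using Nil[unfolded local_def] by (metis lders_simps(1))
    have 1: "difference ?n (\<lambda>k l. raise (f k l)) = (\<lambda>k l. raise (difference ?n f k l))"
      for f :: "int \<Rightarrow> int \<Rightarrow> (int \<times> 'c) list \<Rightarrow> rat"
      by (rule difference_additive[where L = raise]) (rule raise_diff)
    have 2: "difference ?n (E f) = E (difference ?n f)" for f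
      by (rule difference_commute[where E = E]) (simp add: E_def algebra_simps)
    have "?S (raise F) = (\<lambda>k l. E (?S F) k l + raise (?S F k l))"
      "?T (raise F) = (\<lambda>k l. E (?T F) k l + raise (?T F k l))"
      by (simp_all add: E_def algebra_simps)
    then show ?case
      by (simp only: lders_simps difference_add 1 2 eq)
  next
    case (Cons x u)
    show ?case
      by (simp only: lders_simps lder_raise lders_arith lder_simps difference_add
        Cons.IH[OF local_lder[OF Cons.prems]] localD[OF local_lder[OF Cons.prems]])
  qed
  then show ?thesis by (simp add: local_def)
qed

lemma local_lower:
  assumes "local F"
  shows "local (lower F)"
proof -
  have "difference (a i j) (\<lambda>k l. lder (l, j) (lder (k, i) (lders u (lower F)))) =
     difference (a i j) (\<lambda>k l. lder (k, i) (lder (l, j) (lders u (lower F))))" for u i j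
    using assms
  proof (induction u arbitrary: F)
    case Nil
    let ?n = "a i j"
    let ?S = "\<lambda>F k l. lder (l, j) (lder (k, i) F)" and ?T = "\<lambda>F k l. lder (k, i) (lder (l, j) F)"
    \<comment> \<open>The sum of the two partial derivatives. It annihilates the difference of the
      variables, hence commutes with multiplication by powers of it.\<close>
    define E where "E = (\<lambda>f k l. scl (1 - of_int k) (f (k - 1) l) +
      scl (1 - of_int l) (f k (l - 1 :: int)) :: (int \<times> 'c) list \<Rightarrow> rat)"
    have eq: "difference ?n (?S F) = difference ?n (?T F)"
      using Nil[unfolded local_def] by (metis lders_simps(1))
    have 1: "difference ?n (\<lambda>k l. lower (f k l)) = (\<lambda>k l. lower (difference ?n f k l))"
      for f :: "int \<Rightarrow> int \<Rightarrow> (int \<times> 'c) list \<Rightarrow> rat"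
      by (rule difference_additive[where L = lower]) (rule lower_diff)
    have 2: "difference ?n (E f) = E (difference ?n f)" for f
      by (rule difference_commute[where E = E]) (auto simp: E_def scl_def fun_eq_iff algebra_simps)
    have "?S (lower F) = (\<lambda>k l. E (?S F) k l + lower (?S F k l))"
      "?T (lower F) = (\<lambda>k l. E (?T F) k l + lower (?T F k l))"
      by (simp_all add: E_def algebra_simps)
    then show ?case
      by (simp only: lders_simps difference_add 1 2 eq)
  next
    case (Cons x u)
    show ?case
      by (simp only: lders_simps lder_lower lders_arith lder_simps difference_add
        difference_additive[of "scl _", OF scl_simps(2)]
        Cons.IH[OF local_lder[OF Cons.prems]] localD[OF local_lder[OF Cons.prems]])
  qed
  then show ?thesis by (simp add: local_def)
qed

lemma bounded_lder: "bounded F \<Longrightarrow> bounded (lder x F)"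
  unfolding bounded_def by (metis lders_simps(2))

lemma bounded_add:
  assumes "bounded F" "bounded G"
  shows "bounded (F + G)"
  unfolding bounded_def
proof
  fix u
  obtain N M where "\<forall>k>N. \<forall>i. lder (k, i) (lders u F) = 0" "\<forall>k>M. \<forall>i. lder (k, i) (lders u G) = 0"
    using assms unfolding bounded_def by metis
  then show "\<exists>N. \<forall>k>N. \<forall>i. lder (k, i) (lders u (F + G)) = 0"
    by (intro exI[of _ "max N M"]) simp
qed

lemma bounded_scl: "bounded F \<Longrightarrow> bounded (scl r F)"
  unfolding bounded_def by simp (metis scl_simps(3))

lemma bounded_hd: "bounded F \<Longrightarrow> \<exists>N. \<forall>k>N. \<forall>i. lder (k, i) F = 0"
  unfolding bounded_def by (metis lders_simps(1))

lemma bounded_shp: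
  assumes "bounded F" "bounded G"
  shows "bounded (shp F G)"
proof -
  have "\<exists>N. \<forall>k>N. \<forall>i. lder (k, i) (lders u (shp F G)) = 0" for u
    using assms
  proof (induction u arbitrary: F G)
    case Nil
    then obtain N M where "\<forall>k>N. \<forall>i. lder (k, i) F = 0" "\<forall>k>M. \<forall>i. lder (k, i) G = 0"
      by (metis bounded_hd)
    then show ?case by (intro exI[of _ "max N M"]) simp
  next
    case (Cons x u)
    obtain N M where *: "\<forall>k>N. \<forall>i. lder (k, i) (lders u (shp (lder x F) G)) = 0"
      "\<forall>k>M. \<forall>i. lder (k, i) (lders u (shp F (lder x G))) = 0"
      using Cons bounded_lder by metis
    have "lder (k, i) (lders (x # u) (shp F G)) = 0" if "k > max N M" for k i
      using * that by (simp only: lders_simps lder_shp lders_arith lder_simps) simp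
    then show ?case by blast
  qed
  then show ?thesis by (simp add: bounded_def)
qed

lemma bounded_raise:
  assumes "bounded F"
  shows "bounded (raise F)"
proof -
  have "\<exists>N. \<forall>k>N. \<forall>i. lder (k, i) (lders u (raise F)) = 0" for u
    using assms
  proof (induction u arbitrary: F)
    case Nil
    then obtain N where "\<forall>k>N. \<forall>i. lder (k, i) F = 0"
      by (metis bounded_hd)
    then show ?case by (intro exI[of _ N]) simp
  next
    case (Cons x u)
    obtain N M where *: "\<forall>k>N. \<forall>i. lder (k, i) (lders u (raise (lder x F))) = 0"
      "\<forall>k>M. \<forall>i. lder (k, i) (lders u (lder (fst x + 1, snd x) F)) = 0"
      using Cons bounded_lder unfolding bounded_def by metis
    have "lder (k, i) (lders (x # u) (raise F)) = 0" if "k > max N M" for k i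
      using * that by (simp only: lders_simps lder_raise lders_arith lder_simps) simp
    then show ?case by blast
  qed
  then show ?thesis by (simp add: bounded_def)
qed

lemma bounded_lower:
  assumes "bounded F"
  shows "bounded (lower F)"
proof -
  have "\<exists>N. \<forall>k>N. \<forall>i. lder (k, i) (lders u (lower F)) = 0" for u
    using assms
  proof (induction u arbitrary: F)
    case Nil
    then obtain N where "\<forall>k>N. \<forall>i. lder (k, i) F = 0"
      by (metis bounded_hd)
    then show ?case by (intro exI[of _ "N + 1"]) simp
  next
    case (Cons x u)
    obtain N M where *: "\<forall>k>N. \<forall>i. lder (k, i) (lders u (lower (lder x F))) = 0"
      "\<forall>k>M. \<forall>i. lder (k, i) (lders u (lder (fst x - 1, snd x) F)) = 0"
      using Cons bounded_lder unfolding bounded_def by metis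
    have "lder (k, i) (lders (x # u) (lower F)) = 0" if "k > max N M" for k i
      using * that by (simp only: lders_simps lder_lower lders_arith lder_simps) simp
    then show ?case by blast
  qed
  then show ?thesis by (simp add: bounded_def)
qed

lemma regular_shp: "regular F \<Longrightarrow> regular G \<Longrightarrow> regular (shp F G)"
  by (simp add: regular_def)

lemma regular_raise: "regular F \<Longrightarrow> regular (raise F)"
  by (simp add: regular_def)

lemma regular_lower: "regular F \<Longrightarrow> regular (lower F)"
  unfolding regular_def
proof (intro allI impI)
  fix k :: int and i
  assume *: "\<forall>k>0. \<forall>i. lder (k, i) F = 0" and "k > 0"
  \<comment> \<open>At \<open>k = 1\<close> the lowered letter has first component 0, where
    \<open>F\<close> need not vanish, but there the factor \<open>1 - k\<close> does.\<close>
  show "lder (k, i) (lower F) = 0"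
    using * \<open>k > 0\<close> by (cases "k = 1") simp_all
qed

lemma raise_nonzeroD:
  "raise F w \<noteq> 0 \<Longrightarrow> \<exists>v. F v \<noteq> 0 \<and> colours v = colours w \<and> weight v = weight w + 1"
proof (induction w arbitrary: F)
  case (Cons x w)
  have "lder (fst x + 1, snd x) F w \<noteq> 0 \<or> raise (lder x F) w \<noteq> 0"
    using Cons.prems by (auto simp: raise_Cons)
  then consider "lder (fst x + 1, snd x) F w \<noteq> 0" | "raise (lder x F) w \<noteq> 0" by blast
  then show ?case
  proof cases
    case 1
    then show ?thesis by (intro exI[of _ "(fst x + 1, snd x) # w"]) (simp add: lder_def)
  next
    case 2
    from Cons.IH[OF this] obtain v where "lder x F v \<noteq> 0" "colours v = colours w" "weight v = weight w + 1"
      by blast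
    then show ?thesis by (intro exI[of _ "x # v"]) (simp add: lder_def)
  qed
qed simp

lemma lower_nonzeroD:
  "lower F w \<noteq> 0 \<Longrightarrow> \<exists>v. F v \<noteq> 0 \<and> colours v = colours w \<and> weight v = weight w - 1"
proof (induction w arbitrary: F)
  case (Cons x w)
  have "lder (fst x - 1, snd x) F w \<noteq> 0 \<or> lower (lder x F) w \<noteq> 0"
    using Cons.prems by (auto simp: lower_Cons)
  then consider "lder (fst x - 1, snd x) F w \<noteq> 0" | "lower (lder x F) w \<noteq> 0" by blast
  then show ?case
  proof cases
    case 1
    then show ?thesis by (intro exI[of _ "(fst x - 1, snd x) # w"]) (simp add: lder_def)
  next
    case 2
    from Cons.IH[OF this] obtain v where "lder x F v \<noteq> 0" "colours v = colours w" "weight v = weight w - 1"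
      by blast
    then show ?thesis by (intro exI[of _ "x # v"]) (simp add: lder_def)
  qed
qed simp

lemma fields_0 [simp]: "0 \<in> fields g N"
  by (simp add: fields_def regular_def bounded_def)

lemma fields_add: "F \<in> fields g N \<Longrightarrow> G \<in> fields g N \<Longrightarrow> F + G \<in> fields g N"
  unfolding fields_def regular_def by (auto simp: local_add bounded_add) force+

lemma fields_scl: "F \<in> fields g N \<Longrightarrow> scl r F \<in> fields g N"
  unfolding fields_def regular_def by (auto simp: local_scl bounded_scl scl_apply)

lemma fields_shp:
  assumes "F \<in> fields g N" "G \<in> fields h M"
  shows "shp F G \<in> fields (g + h) (N + M)"
proof -
  have "colours w = g + h \<and> weight w = N + M" if nz: "shp F G w \<noteq> 0" for w
  proof -
    obtain u v where *: "F u \<noteq> 0" "G v \<noteq> 0" "w \<in> shuffles u v"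
      using shp_nonzeroD[OF nz] by blast
    have "mset w = mset (u @ v)" using mset_shuffles[OF *(3)] by simp
    then have "colours w = colours (u @ v)" "weight w = weight (u @ v)"
      by (rule colours_mset_cong, rule weight_mset_cong)
    moreover have "colours u = g" "weight u = N" "colours v = h" "weight v = M"
      using assms * unfolding fields_def by blast+
    ultimately show ?thesis by simp
  qed
  then show ?thesis using assms local_shp bounded_shp regular_shp unfolding fields_def by blast
qed

lemma fields_raise: "F \<in> fields g N \<Longrightarrow> raise F \<in> fields g (N - 1)"
  using raise_nonzeroD[of F] local_raise bounded_raise regular_raise
  unfolding fields_def by fastforce

lemma fields_lower: "F \<in> fields g N \<Longrightarrow> lower F \<in> fields g (N + 1)"
  using lower_nonzeroD[of F] local_lower bounded_lower regular_lower
  unfolding fields_def by fastforce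

section \<open>Leading words of local functions\<close>

lemma leading_lder: "leading F (x # w) \<Longrightarrow> leading (lder x F) w"
  unfolding leading_def lder_def by (metis Cons_le_Cons length_Cons nat.inject order_less_irrefl)

text \<open>A letter of the leading word can be moved to the front by locality; it loses at most the
  weight recorded by \<open>flatten\<close>.\<close>

lemma leading_move_front:
  "local F \<Longrightarrow> leading F w \<Longrightarrow> y \<in> set (flatten w) \<Longrightarrow> \<exists>k v. fst y \<le> k \<and> F ((k, snd y) # v) \<noteq> 0"
proof (induction w arbitrary: F y)
  case (Cons x w)
  from Cons.prems(3) consider "y = x" | z where "z \<in> set (flatten w)" "y = shift x z" by auto
  then show ?case
  proof cases
    case 1
    then show ?thesis using Cons.prems(2) by (intro exI[of _ "fst x"] exI[of _ w]) (simp add: leading_def)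
  next
    case 2
    from Cons.IH[OF local_lder[OF Cons.prems(1)] leading_lder[OF Cons.prems(2)] 2(1)]
    obtain l0 v where v: "fst z \<le> l0" "F (x # (l0, snd z) # v) \<noteq> 0" by (auto simp: lder_def)
    define k0 where "k0 = fst x"
    define i where "i = snd x"
    define j where "j = snd z"
    define n where "n = a i j"
    have x: "x = (k0, i)" by (simp add: k0_def i_def j_def n_def)
    define f where "f = (\<lambda>k l. F ((k, i) # (l, j) # v))"
    define f' where "f' = (\<lambda>k l. F ((l, j) # (k, i) # v))"
    have ev: "difference n (\<lambda>k l. H k l v) = (\<lambda>k l. difference n H k l v)"
      for H :: "int \<Rightarrow> int \<Rightarrow> (int \<times> 'c) list \<Rightarrow> rat"
      by (rule difference_additive[where L = "\<lambda>X. X v"]) simp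
    have "difference n f = difference n f'"
    proof -
      have "difference n (\<lambda>k l. lder (l, j) (lder (k, i) F)) = difference n (\<lambda>k l. lder (k, i) (lder (l, j) F))"
        using Cons.prems(1) unfolding local_def k0_def i_def j_def n_def by (metis lders_simps(1))
      then show ?thesis
        using ev[of "\<lambda>k l. lder (l, j) (lder (k, i) F)"] ev[of "\<lambda>k l. lder (k, i) (lder (l, j) F)"]
        by (simp add: lder_def f_def f'_def)
    qed
    moreover have "\<forall>k>k0. \<forall>l. f k l = 0"
    proof (intro allI impI, rule ccontr)
      fix k l assume "k > k0" "f k l \<noteq> 0"
      then have "(k, i) # (l, j) # v \<le> x # w" using Cons.prems(2) by (auto simp: f_def leading_def)
      then show False using \<open>k > k0\<close> x by simp
    qed
    \<comment> \<open>The coefficient at the largest possible first index \<open>k0\<close> isolates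
      the nonzero value \<open>f k0 l0\<close>. On the other side of the locality relation it has to
      come from words beginning with a letter of colour \<open>j\<close>.\<close>
    then have "difference n f k0 (l0 - int n) = (if even n then f k0 l0 else - f k0 l0)"
      by (rule difference_leading)
    then have "difference n f k0 (l0 - int n) \<noteq> 0"
      using v(2) by (auto simp: f_def x j_def)
    ultimately have "difference n f' k0 (l0 - int n) \<noteq> 0" by simp
    then obtain k' l' where "l0 - int n \<le> l'" "f' k' l' \<noteq> 0" by (blast dest: difference_nonzeroD)
    then show ?thesis
      using v(1) 2(2) by (intro exI[of _ l'] exI[of _ "(k', i) # v"])
        (auto simp: shift_def f'_def k0_def i_def j_def n_def)
  qed
qed simp

text \<open>If \<open>shift x y\<close> exceeded \<open>x\<close>, then
  \<open>leading_move_front\<close> would give a word of the support whose first letter is larger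
  than \<open>x\<close>, contradicting the choice of the leading word.\<close>

lemma leading_good: "local F \<Longrightarrow> leading F w \<Longrightarrow> good w"
proof (induction w arbitrary: F)
  case (Cons x w)
  have "shift x y \<le> x" if "y \<in> set (flatten w)" for y
  proof -
    have "shift x y \<in> set (flatten (x # w))" using that by simp
    from leading_move_front[OF Cons.prems this] obtain k v
      where *: "fst (shift x y) \<le> k" "F ((k, snd (shift x y)) # v) \<noteq> 0" by blast
    then have "(k, snd (shift x y)) # v \<le> x # w"
      using Cons.prems(2) unfolding leading_def by blast
    then have "(k, snd (shift x y)) \<le> x" by auto
    moreover have "shift x y \<le> (k, snd (shift x y))" using *(1) by (cases "shift x y") auto
    ultimately show ?thesis by (rule order_trans[rotated])
  qed
  then show ?case using Cons.IH[OF local_lder[OF Cons.prems(1)] leading_lder[OF Cons.prems(2)]]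
    by simp
qed simp

lemma leading_adm:
  assumes "F \<in> fields g N" "leading F w"
  shows "w \<in> adm g N"
proof -
  have "F w \<noteq> 0" using assms(2) by (simp add: leading_def)
  moreover have "fst (hd w) \<le> 0" if "w \<noteq> []"
  proof (rule ccontr)
    assume "\<not> ?thesis"
    then have "lder (hd w) F = 0" using assms(1) by (cases "hd w") (auto simp: fields_def regular_def)
    then have "F (hd w # tl w) = 0" by (metis lder_def zero_fun_apply)
    then show False using that \<open>F w \<noteq> 0\<close> by simp
  qed
  ultimately show ?thesis
    using assms leading_good[of F w] by (auto simp: adm_def admissible_def fields_def)
qed

lemma leading_ex:
  assumes "bounded F" "F \<noteq> 0" "\<And>w. F w \<noteq> 0 \<Longrightarrow> set w \<subseteq> UNIV \<times> C \<and> length w = n" "finite C"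
  shows "\<exists>w. leading F w"
  using assms(1-3)
proof (induction n arbitrary: F)
  case 0
  then have "F w \<noteq> 0 \<Longrightarrow> w = []" for w by simp
  moreover obtain w where "F w \<noteq> 0" using 0(2) by (auto simp: fun_eq_iff)
  ultimately show ?case by (intro exI[of _ "[]"]) (auto simp: leading_def)
next
  case (Suc n)
  define S where "S = {x. lder x F \<noteq> 0}"
  obtain w0 where w0: "F w0 \<noteq> 0" using Suc(3) by (auto simp: fun_eq_iff)
  then obtain x0 w1 where "w0 = x0 # w1" using Suc.prems(3)[OF w0] by (cases w0) auto
  then have x0: "x0 \<in> S" using w0 by (auto simp: S_def lder_def fun_eq_iff)
  obtain N where N: "\<forall>k>N. \<forall>i. lder (k, i) F = 0" using bounded_hd[OF Suc.prems(1)] by blast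
  \<comment> \<open>The possible first letters are bounded above but not below, so the maximum is
    taken among those that are at least the fixed letter \<open>x0\<close>.\<close>
  have "finite {x \<in> S. x0 \<le> x}"
  proof (rule finite_subset)
    show "{x \<in> S. x0 \<le> x} \<subseteq> {fst x0..N} \<times> C"
    proof
      fix x assume x: "x \<in> {x \<in> S. x0 \<le> x}"
      then obtain w where "F (x # w) \<noteq> 0" by (auto simp: S_def lder_def fun_eq_iff)
      then have "snd x \<in> C" using Suc.prems(3)[of "x # w"] by (cases x) auto
      moreover have "fst x \<le> N" using x N by (cases x) (force simp: S_def)
      moreover have "fst x0 \<le> fst x" using x fst_mono by auto
      ultimately show "x \<in> {fst x0..N} \<times> C" by (cases x) auto
    qed
    show "finite ({fst x0..N} \<times> C)" using assms(4) by simp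
  qed
  then obtain x where x: "x \<in> S" "\<And>y. y \<in> S \<Longrightarrow> y \<le> x"
  proof (intro that[of "Max {x \<in> S. x0 \<le> x}"])
    assume fin: "finite {x \<in> S. x0 \<le> x}"
    have in_S: "Max {x \<in> S. x0 \<le> x} \<in> {x \<in> S. x0 \<le> x}"
      using fin x0 order_refl[of x0] by (intro Max_in) blast+
    then show "Max {x \<in> S. x0 \<le> x} \<in> S" by blast
    fix y assume "y \<in> S"
    show "y \<le> Max {x \<in> S. x0 \<le> x}"
    proof (cases "x0 \<le> y")
      case True
      then show ?thesis using fin \<open>y \<in> S\<close> by (intro Max_ge) auto
    next
      case False
      then show ?thesis using in_S by auto
    qed
  qed
  have "\<exists>w. leading (lder x F) w"
  proof (rule Suc.IH)
    show "bounded (lder x F)" using Suc.prems(1) by (rule bounded_lder)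
    show "lder x F \<noteq> 0" using x by (simp add: S_def)
    show "set w \<subseteq> UNIV \<times> C \<and> length w = n" if "lder x F w \<noteq> 0" for w
      using Suc.prems(3)[of "x # w"] that by (auto simp: lder_def)
  qed
  then obtain w where w: "leading (lder x F) w" by blast
  have "leading F (x # w)"
    unfolding leading_def
  proof (intro conjI allI impI)
    show "F (x # w) \<noteq> 0" using w by (simp add: leading_def lder_def)
    fix v assume v: "F v \<noteq> 0"
    then obtain y v' where y: "v = y # v'" using Suc.prems(3)[OF v] by (cases v) auto
    then have "y \<in> S" using v by (auto simp: S_def lder_def fun_eq_iff)
    then have "y \<le> x" using x by blast
    moreover have "v' \<le> w" if "y = x"
      using v y w that unfolding leading_def lder_def by blast
    ultimately show "v \<le> x # w" using y by auto
    have "F (x # w) \<noteq> 0" using w by (simp add: leading_def lder_def)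
    then show "length v = length (x # w)"
      using Suc.prems(3)[OF v] Suc.prems(3)[of "x # w"] by simp
  qed
  then show ?case by blast
qed

lemma fields_leading_ex:
  assumes "F \<in> fields g N" "F \<noteq> 0"
  shows "\<exists>w\<in>adm g N. leading F w"
proof -
  have "\<exists>w. leading F w"
  proof (rule leading_ex)
    show "bounded F" "F \<noteq> 0" using assms by (auto simp: fields_def)
    show "finite (Poly_Mapping.keys g)" by simp
    show "set w \<subseteq> UNIV \<times> Poly_Mapping.keys g \<and> length w = deg g" if "F w \<noteq> 0" for w
    proof -
      have "colours w = g" using assms that by (auto simp: fields_def)
      then show ?thesis using snd_in_keys_colours[of _ w] deg_colours[of w] by force
    qed
  qed
  then show ?thesis using leading_adm[OF assms(1)] by blast
qed

end

section \<open>Division by products of differences of variables\<close>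

definition inc :: "nat \<Rightarrow> (nat \<Rightarrow> int) \<Rightarrow> nat \<Rightarrow> int" where
  "inc s k = k(s := k s + 1)"

text \<open>Multiplication by \<open>z_s - z_t\<close>, where \<open>k\<close> stands for the
  monomial in which \<open>z_t\<close> has exponent \<open>- k t\<close>.\<close>

definition vdiff :: "nat \<Rightarrow> nat \<Rightarrow> ((nat \<Rightarrow> int) \<Rightarrow> rat) \<Rightarrow> (nat \<Rightarrow> int) \<Rightarrow> rat" where
  "vdiff s t f = (\<lambda>k. f (inc s k) - f (inc t k))"

lemma inc_commute: "inc s (inc t k) = inc t (inc s k)"
  by (auto simp: inc_def)

interpretation vdiff: comp_fun_commute "\<lambda>p. vdiff (fst p) (snd p)"
  by standard (auto simp: vdiff_def fun_eq_iff inc_commute)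

text \<open>Multisets of pairs encode products of differences; as the factors commute, any one of
  them can be split off.\<close>

definition vdiffs :: "(nat \<times> nat) multiset \<Rightarrow> ((nat \<Rightarrow> int) \<Rightarrow> rat) \<Rightarrow> (nat \<Rightarrow> int) \<Rightarrow> rat" where
  "vdiffs X f = fold_mset (\<lambda>p. vdiff (fst p) (snd p)) f X"

lemma vdiffs_empty [simp]: "vdiffs {#} f = f"
  by (simp add: vdiffs_def)

lemma vdiffs_add_mset: "vdiffs (add_mset (s, t) X) f = vdiff s t (vdiffs X f)"
  by (simp add: vdiffs_def)

lemma vdiffs_union: "vdiffs (X + Y) f = vdiffs Y (vdiffs X f)"
  by (simp add: vdiffs_def)

lemma vdiffs_replicate: "vdiffs (replicate_mset n (s, t)) f = (vdiff s t ^^ n) f"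
  by (induction n) (simp_all add: vdiffs_add_mset)

lemma vdiffs_sum:
  "vdiffs X (\<lambda>k. \<Sum>i\<in>A. c i * f i k) = (\<lambda>k. \<Sum>i\<in>A. c i * vdiffs X (f i) k)"
proof (induction X)
  case (add p X)
  obtain s t where "p = (s, t)" by (cases p)
  with add show ?case
    by (simp add: vdiffs_add_mset vdiff_def sum_subtractf algebra_simps)
qed simp

lemma vdiffs_diff: "vdiffs X (\<lambda>k. f k - g k) = (\<lambda>k. vdiffs X f k - vdiffs X g k)"
proof (induction X)
  case (add p X)
  obtain s t where "p = (s, t)" by (cases p)
  with add show ?case by (simp add: vdiffs_add_mset vdiff_def fun_eq_iff)
qed simp

lemma vdiff_swap_power:
  "(vdiff t s ^^ n) f = (\<lambda>k. (- 1) ^ n * (vdiff s t ^^ n) f k)"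
  by (induction n) (auto simp: vdiff_def algebra_simps)

lemma difference_vdiff:
  assumes "s \<noteq> t"
  shows "difference n (\<lambda>k l. f (p(s := k, t := l))) x y = (vdiff s t ^^ n) f (p(s := x, t := y))"
proof (induction n arbitrary: f)
  case (Suc n)
  have "(\<lambda>k l. f (p(s := k + 1, t := l)) - f (p(s := k, t := l + 1)))
      = (\<lambda>k l. vdiff s t f (p(s := k, t := l)))"
    using assms by (auto simp: vdiff_def inc_def fun_eq_iff fun_upd_twist)
  then show ?case
    by (simp only: difference.simps Suc[of "vdiff s t f"] funpow_Suc_right o_apply)
qed simp

text \<open>A function of exponents is \<open>eventually_zero n Pre\<close> if it is a Laurent series in the \<open>p\<close>-th
  variable as soon as the exponents of the variables in \<open>Pre p\<close> are fixed. With
  \<open>Pre p = {..<p}\<close> these are iterated Laurent series, in which all differences of variables are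
  invertible.\<close>

definition eventually_zero :: "nat \<Rightarrow> (nat \<Rightarrow> nat set) \<Rightarrow> ((nat \<Rightarrow> int) \<Rightarrow> rat) \<Rightarrow> bool" where
  "eventually_zero n Pre f \<longleftrightarrow>
     (\<forall>p<n. \<forall>k. \<exists>N. \<forall>k'. (\<forall>q\<in>Pre p. k' q = k q) \<and> k' p > N \<longrightarrow> f k' = 0)"

lemma eventually_zero_mono:
  "eventually_zero n Pre f \<Longrightarrow> (\<And>p. p < n \<Longrightarrow> Pre p \<subseteq> Pre' p) \<Longrightarrow> eventually_zero n Pre' f"
  unfolding eventually_zero_def by (meson subsetD)

lemma eventually_zero_diff:
  assumes "eventually_zero n Pre f" "eventually_zero n Pre g"
  shows "eventually_zero n Pre (\<lambda>k. f k - g k)"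
  unfolding eventually_zero_def
proof (intro allI impI)
  fix p k assume "p < n"
  then obtain N M where
    "\<forall>k'. (\<forall>q\<in>Pre p. k' q = k q) \<and> k' p > N \<longrightarrow> f k' = 0"
    "\<forall>k'. (\<forall>q\<in>Pre p. k' q = k q) \<and> k' p > M \<longrightarrow> g k' = 0"
    using assms unfolding eventually_zero_def by metis
  then show "\<exists>N. \<forall>k'. (\<forall>q\<in>Pre p. k' q = k q) \<and> k' p > N \<longrightarrow> f k' - g k' = 0"
    by (intro exI[of _ "max N M"]) auto
qed

lemma eventually_zero_inc:
  assumes "eventually_zero n Pre f"
  shows "eventually_zero n Pre (\<lambda>k. f (inc s k))"
  unfolding eventually_zero_def
proof (intro allI impI)
  fix p k assume "p < n"
  then obtain N where N: "\<forall>k'. (\<forall>q\<in>Pre p. k' q = inc s k q) \<and> k' p > N \<longrightarrow> f k' = 0"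
    using assms unfolding eventually_zero_def by metis
  have "f (inc s k') = 0" if "\<forall>q\<in>Pre p. k' q = k q" "k' p > N" for k'
    using that by (intro N[rule_format]) (auto simp: inc_def)
  then show "\<exists>N. \<forall>k'. (\<forall>q\<in>Pre p. k' q = k q) \<and> k' p > N \<longrightarrow> f (inc s k') = 0" by blast
qed

lemma eventually_zero_vdiff: "eventually_zero n Pre f \<Longrightarrow> eventually_zero n Pre (vdiff s t f)"
  unfolding vdiff_def by (intro eventually_zero_diff eventually_zero_inc)

lemma eventually_zero_vdiffs: "eventually_zero n Pre f \<Longrightarrow> eventually_zero n Pre (vdiffs X f)"
proof (induction X)
  case (add p X)
  then show ?case by (cases p) (simp add: vdiffs_add_mset eventually_zero_vdiff)
qed simp

text \<open>A solution of the homogeneous equation is constant along the direction in which entry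
  \<open>s\<close> gains what entry \<open>t\<close> loses. Far enough along it, entry
  \<open>s\<close> exceeds its bound, and this bound stays valid because neither \<open>s\<close>
  nor \<open>t\<close> lies in \<open>Pre s\<close>.\<close>

lemma vdiff_inj:
  assumes "eventually_zero n Pre f" "s < n" "s \<notin> Pre s" "t \<notin> Pre s" "s \<noteq> t" "vdiff s t f = (\<lambda>_. 0)"
  shows "f = (\<lambda>_. 0)"
proof
  fix k
  obtain N where N: "\<And>k'. (\<forall>q\<in>Pre s. k' q = k q) \<and> k' s > N \<Longrightarrow> f k' = 0"
    using assms(1,2) unfolding eventually_zero_def by metis
  have step: "f (k(s := k s + int m, t := k t - int m)) = f k" for m
  proof (induction m)
    case (Suc m)
    let ?k = "k(s := k s + int m, t := k t - int m - 1)"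
    have "f (inc s ?k) = f (inc t ?k)" using assms(6) by (simp add: vdiff_def fun_eq_iff)
    moreover have "inc s ?k = k(s := k s + int (Suc m), t := k t - int (Suc m))"
      "inc t ?k = k(s := k s + int m, t := k t - int m)"
      using assms(5) by (auto simp: inc_def)
    ultimately show ?case using Suc by argo
  qed simp
  define m where "m = nat (N + 1 - k s)"
  have "f (k(s := k s + int m, t := k t - int m)) = 0"
    using assms(3-5) by (intro N) (auto simp: m_def)
  then show "f k = 0" using step[of m] by simp
qed

lemma vdiffs_inj:
  assumes "eventually_zero n Pre f"
    and "\<And>s t. (s, t) \<in># X \<Longrightarrow> s < n \<and> s \<notin> Pre s \<and> t \<notin> Pre s \<and> s \<noteq> t"
    and "vdiffs X f = (\<lambda>_. 0)"
  shows "f = (\<lambda>_. 0)"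
  using assms(2,3)
proof (induction X)
  case (add p X)
  obtain s t where p: "p = (s, t)" by (cases p)
  have "vdiffs X f = (\<lambda>_. 0)"
    using add.prems p
    by (intro vdiff_inj[OF eventually_zero_vdiffs[OF assms(1)], of s t]) (auto simp: vdiffs_add_mset)
  then show ?case by (rule add.IH[rotated]) (use add.prems(1) in auto)
qed simp

text \<open>\<open>N\<close> becomes the weight of a word, and the condition on \<open>k 0\<close>
  becomes \<open>regular\<close>.\<close>

definition laurent :: "nat \<Rightarrow> int \<Rightarrow> ((nat \<Rightarrow> int) \<Rightarrow> rat) \<Rightarrow> bool" where
  "laurent n N f \<longleftrightarrow> eventually_zero n lessThan f \<and>
     (\<forall>k. f k \<noteq> 0 \<longrightarrow> (\<Sum>t<n. k t) = N \<and> (0 < n \<longrightarrow> k 0 \<le> 0))"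

lemma eventually_zero_lessThanD:
  "eventually_zero n lessThan f \<Longrightarrow> p < n \<Longrightarrow>
    \<exists>N. \<forall>k'. (\<forall>q<p. k' q = k q) \<and> k' p > N \<longrightarrow> f k' = 0"
  unfolding eventually_zero_def Ball_def lessThan_iff by blast

text \<open>The inverse of \<open>z_s - z_t\<close> is expanded as minus the sum of all
  \<open>z_s^m z_t^(-m-1)\<close>. At each place only finitely many terms survive, because
  \<open>g\<close> vanishes for large entries at \<open>s\<close> once the earlier entries are
  fixed.\<close>

lemma vdiff_surj:
  assumes g: "laurent n N g" and st: "s < t" "t < n"
  shows "\<exists>f. laurent n (N + 1) f \<and> vdiff s t f = g"
proof -
  define mv where "mv k m = k(s := k s + int m, t := k t - 1 - int m)" for k :: "nat \<Rightarrow> int" and m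
  have ez: "eventually_zero n lessThan g" using g by (simp add: laurent_def)
  have "\<exists>N. \<forall>k'. (\<forall>q<s. k' q = k q) \<and> k' s > N \<longrightarrow> g k' = 0" for k
    using eventually_zero_lessThanD[OF ez, of s k] st by simp
  then obtain B where B: "\<And>k k'. (\<forall>q<s. k' q = k q) \<Longrightarrow> k' s > B k \<Longrightarrow> g k' = 0" by metis
  have mv0: "g (mv k m) = 0" if "\<forall>q<s. k q = k0 q" "k s + int m > B k0" for k k0 m
    using that st by (intro B[of _ k0]) (auto simp: mv_def)
  define f where "f k = - (\<Sum>m | g (mv k m) \<noteq> 0. g (mv k m))" for k
  have fin: "{m. g (mv k m) \<noteq> 0} \<subseteq> {..nat (B k - k s)}" for k
  proof
    fix m assume "m \<in> {m. g (mv k m) \<noteq> 0}"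
    then have "k s + int m \<le> B k" using mv0[of k k m] by force
    then show "m \<in> {..nat (B k - k s)}" by simp
  qed
  have f_eq: "f k = - (\<Sum>m\<le>M. g (mv k m))" if "B k - k s \<le> int M" for k M
  proof -
    have "{m. g (mv k m) \<noteq> 0} \<subseteq> {..M}" using fin[of k] that by force
    then show ?thesis unfolding f_def by (intro arg_cong[of _ _ uminus] sum.mono_neutral_left) auto
  qed
  have f_nz: "\<exists>m. g (mv k m) \<noteq> 0" if "f k \<noteq> 0" for k
    using that unfolding f_def by (auto elim: sum.not_neutral_contains_not_neutral)
  have "vdiff s t f = g"
  proof
    fix k
    define M where "M = nat (max (B (inc s k) - inc s k s) (B (inc t k) - inc t k s))"
    have "f (inc s k) = - (\<Sum>m\<le>M. g (mv (inc s k) m))" "f (inc t k) = - (\<Sum>m\<le>Suc M. g (mv (inc t k) m))"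
      unfolding M_def by (rule f_eq, linarith)+
    moreover have "(\<Sum>m\<le>Suc M. g (mv (inc t k) m)) = g k + (\<Sum>m\<le>M. g (mv (inc t k) (Suc m)))"
    proof -
      have "mv (inc t k) 0 = k" using st by (auto simp: mv_def inc_def)
      then show ?thesis by (subst sum.atMost_Suc_shift) simp
    qed
    moreover have "mv (inc t k) (Suc m) = mv (inc s k) m" for m
      using st by (auto simp: mv_def inc_def)
    ultimately show "vdiff s t f k = g k" by (simp add: vdiff_def)
  qed
  moreover have "laurent n (N + 1) f"
    unfolding laurent_def
  proof (intro conjI allI impI)
    fix k assume "f k \<noteq> 0"
    then obtain m where m: "g (mv k m) \<noteq> 0" using f_nz by blast
    have "(\<Sum>q<n. mv k m q) = (\<Sum>q\<in>{..<n} - {s, t}. k q) + (k s + int m) + (k t - 1 - int m)"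
      using st by (subst sum.subset_diff[of "{s, t}"]) (auto simp: mv_def)
    moreover have "(\<Sum>q<n. k q) = (\<Sum>q\<in>{..<n} - {s, t}. k q) + k s + k t"
      using st by (subst sum.subset_diff[of "{s, t}"]) auto
    ultimately show "(\<Sum>q<n. k q) = N + 1" using m g by (auto simp: laurent_def)
    have "mv k m 0 \<le> 0" using m g st by (auto simp: laurent_def)
    then show "k 0 \<le> 0" using st by (auto simp: mv_def split: if_splits)
  next
    show "eventually_zero n lessThan f"
      unfolding eventually_zero_def
    proof (intro allI impI)
      fix p k assume p: "p < n"
      define M where "M = nat (B k - k s)"
      have "\<forall>m. \<exists>N. \<forall>k'. (\<forall>q<p. k' q = mv k m q) \<and> k' p > N \<longrightarrow> g k' = 0"
        using eventually_zero_lessThanD[OF ez p] by blast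
      from choice[OF this] obtain C where C: "\<And>m k'. (\<forall>q<p. k' q = mv k m q) \<Longrightarrow> k' p > C m \<Longrightarrow> g k' = 0" by blast
      \<comment> \<open>For \<open>p > s\<close> the entry at \<open>s\<close> is fixed, so only
        \<open>m \<le> M\<close> matter and finitely many bounds \<open>C m\<close> suffice; the
        additional \<open>m + 1\<close> makes up for what \<open>mv\<close> subtracts at
        \<open>p = t\<close>. The bound \<open>B k\<close> serves the case
        \<open>p = s\<close>.\<close>
      define L where "L = max (B k) (Max ((\<lambda>m. C m + int m + 1) ` {..M}))"
      have L: "C m + int m + 1 \<le> L" if "m \<le> M" for m
        unfolding L_def using that by (intro max.coboundedI2 Max_ge) auto
      have "f k' = 0" if k': "\<forall>q<p. k' q = k q" "k' p > L" for k'
      proof (rule ccontr)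
        assume "f k' \<noteq> 0"
        then obtain m where m: "g (mv k' m) \<noteq> 0" using f_nz by blast
        show False
        proof (cases "p \<le> s")
          case True
          show False
          proof (cases "p = s")
            case True
            then have "g (mv k' m) = 0" using k' by (intro mv0[of k' k]) (auto simp: L_def)
            then show False using m by simp
          next
            case False
            have "g (mv k' m) = 0"
              using C[of "mv k' m" 0] k' L[of 0] True False st by (auto simp: mv_def)
            then show False using m by simp
          qed
        next
          case False
          then have ks: "k' s = k s" using k'(1) by simp
          have "k s + int m \<le> B k" using mv0[of k' k m] m ks k'(1) False by force
          then have "m \<le> M" by (simp add: M_def)
          have "g (mv k' m) = 0"
            using L[OF \<open>m \<le> M\<close>] k' False st ks by (intro C[of _ m]) (auto simp: mv_def)
          then show False using m by simp
        qed
      qed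
      then show "\<exists>N. \<forall>k'. (\<forall>q\<in>{..<p}. k' q = k q) \<and> k' p > N \<longrightarrow> f k' = 0"
        unfolding Ball_def lessThan_iff by blast
    qed
  qed
  ultimately show ?thesis by blast
qed

lemma vdiffs_surj:
  assumes "\<And>s t. (s, t) \<in># X \<Longrightarrow> s < t \<and> t < n" "laurent n N g"
  shows "\<exists>f. laurent n (N + int (size X)) f \<and> vdiffs X f = g"
  using assms
proof (induction X arbitrary: N g)
  case (add p X)
  obtain s t where p: "p = (s, t)" by (cases p)
  obtain h where h: "laurent n (N + 1) h" "vdiff s t h = g"
    using vdiff_surj[OF add.prems(2), of s t] add.prems(1) p by auto
  obtain f where "laurent n (N + 1 + int (size X)) f" "vdiffs X f = h"
    using add.IH[OF _ h(1)] add.prems(1) by auto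
  then show ?case using h p by (intro exI[of _ f]) (auto simp: vdiffs_add_mset algebra_simps)
qed auto

text \<open>Words of length \<open>n\<close> see a coefficient function only at exponents that are 0
  from \<open>n\<close> on, so vanishing must be carried through \<open>vdiffs\<close> within this
  set.\<close>

lemma vdiffs_zero_on:
  assumes "\<And>s t. (s, t) \<in># X \<Longrightarrow> s < n \<and> t < n"
    and "\<And>k. (\<forall>t\<ge>n. k t = 0) \<Longrightarrow> f k = 0" "\<forall>t\<ge>n. k t = 0"
  shows "vdiffs X f k = 0"
  using assms(1,3)
proof (induction X arbitrary: k)
  case (add p X)
  obtain s t where p: "p = (s, t)" by (cases p)
  have "s < n" "t < n" using add.prems(1)[of s t] p by simp_all
  moreover have "s < n \<and> t < n" if "(s, t) \<in># X" for s t using add.prems(1)[of s t] that by simp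
  ultimately have "vdiffs X f (inc s k) = 0" "vdiffs X f (inc t k) = 0"
    using add.prems(2) by (auto intro!: add.IH simp: inc_def)
  then show ?case by (simp add: p vdiffs_add_mset vdiff_def)
qed (use assms in simp)

section \<open>Exchange of two neighbouring variables\<close>

definition adj_swap :: "nat \<Rightarrow> nat \<Rightarrow> nat" where
  "adj_swap t q = (if q = t then Suc t else if q = Suc t then t else q)"

lemma adj_swap_adj_swap [simp]: "adj_swap t (adj_swap t q) = q"
  by (auto simp: adj_swap_def)

lemma adj_swap_less: "s < r \<Longrightarrow> (s, r) \<noteq> (t, Suc t) \<Longrightarrow> adj_swap t s < adj_swap t r"
  by (auto simp: adj_swap_def)

lemma adj_swap_less_n: "Suc t < n \<Longrightarrow> adj_swap t q < n \<longleftrightarrow> q < n"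
  by (auto simp: adj_swap_def)

lemma inc_adj_swap: "inc s (k \<circ> adj_swap t) = inc (adj_swap t s) k \<circ> adj_swap t"
  by (auto simp: inc_def fun_eq_iff) (metis adj_swap_adj_swap)

lemma vdiffs_adj_swap:
  "vdiffs X f (k \<circ> adj_swap t) =
   vdiffs (image_mset (map_prod (adj_swap t) (adj_swap t)) X) (\<lambda>k. f (k \<circ> adj_swap t)) k"
proof (induction X arbitrary: k)
  case (add p X)
  obtain s r where p: "p = (s, r)" by (cases p)
  show ?case
    by (simp only: p vdiffs_add_mset vdiff_def inc_adj_swap add image_mset_add_mset map_prod_simp)
qed simp

definition pairs :: "nat \<Rightarrow> (nat \<times> nat) set" where
  "pairs n = {(s, t). s < t \<and> t < n}"

lemma finite_pairs [simp]: "finite (pairs n)"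
  by (rule finite_subset[of _ "{..<n} \<times> {..<n}"]) (auto simp: pairs_def)

lemma mem_pairs: "(s, t) \<in> pairs n \<longleftrightarrow> s < t \<and> t < n"
  by (simp add: pairs_def)

lemma bij_betw_adj_swap_pairs:
  assumes "Suc t < n"
  shows "bij_betw (map_prod (adj_swap t) (adj_swap t)) (pairs n - {(t, Suc t)}) (pairs n - {(t, Suc t)})"
proof (rule bij_betwI[where g = "map_prod (adj_swap t) (adj_swap t)"])
  have "map_prod (adj_swap t) (adj_swap t) p \<in> pairs n - {(t, Suc t)}"
    if "p \<in> pairs n - {(t, Suc t)}" for p
    using that adj_swap_less[of "fst p" "snd p" t] adj_swap_less_n[OF assms, of "snd p"]
    by (cases p) (auto simp: mem_pairs adj_swap_def split: if_splits)
  then show "map_prod (adj_swap t) (adj_swap t) \<in> pairs n - {(t, Suc t)} \<rightarrow> pairs n - {(t, Suc t)}"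
    by blast
  then show "map_prod (adj_swap t) (adj_swap t) \<in> pairs n - {(t, Suc t)} \<rightarrow> pairs n - {(t, Suc t)}" .
qed auto

lemma size_sum_replicate_mset: "finite A \<Longrightarrow> size (\<Sum>x\<in>A. replicate_mset (f x) (h x)) = sum f A"
  by (induction A rule: finite_induct) auto

lemma mem_sum_replicate_mset:
  "finite A \<Longrightarrow> y \<in># (\<Sum>x\<in>A. replicate_mset (f x) (h x)) \<Longrightarrow> \<exists>x\<in>A. y = h x"
  by (induction A rule: finite_induct) (auto split: if_splits)

lemma image_mset_sum_replicate_mset:
  "finite A \<Longrightarrow> image_mset u (\<Sum>x\<in>A. replicate_mset (f x) (h x)) = (\<Sum>x\<in>A. replicate_mset (f x) (u (h x)))"
  by (induction A rule: finite_induct) auto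

context colour_form
begin

text \<open>The denominator belonging to the colour sequence \<open>c\<close>, with each difference
  taken in the order of the positions.\<close>

definition pair_mset :: "nat \<Rightarrow> (nat \<Rightarrow> 'c) \<Rightarrow> (nat \<times> nat) multiset" where
  "pair_mset n c = (\<Sum>p\<in>pairs n. replicate_mset (a (c (fst p)) (c (snd p))) p)"

definition colour_sign :: "nat \<Rightarrow> (nat \<Rightarrow> 'c) \<Rightarrow> rat" where
  "colour_sign n c = (\<Prod>p\<in>pairs n.
     if c (snd p) < c (fst p) then (- 1) ^ a (c (fst p)) (c (snd p)) else 1)"

definition letters :: "nat \<Rightarrow> (nat \<Rightarrow> 'c) \<Rightarrow> (nat \<Rightarrow> int) \<Rightarrow> (int \<times> 'c) multiset" where
  "letters n c k = image_mset (\<lambda>t. (k t, c t)) (mset_set {..<n})"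

text \<open>The numerator of the correlation functions: a signed symmetric sum of monomials. The sign makes
  up for the antisymmetry of the odd powers of differences in \<open>pair_mset\<close>.\<close>

definition signed_delta :: "nat \<Rightarrow> (int \<times> 'c) multiset \<Rightarrow> (nat \<Rightarrow> 'c) \<Rightarrow> (nat \<Rightarrow> int) \<Rightarrow> rat" where
  "signed_delta n M c k = (if letters n c k = M then colour_sign n c else 0)"

lemma mem_pair_mset: "(s, t) \<in># pair_mset n c \<Longrightarrow> s < t \<and> t < n"
  unfolding pair_mset_def
  by (drule mem_sum_replicate_mset[rotated]) (auto simp: mem_pairs)

lemma colour_sign_neq_0: "colour_sign n c \<noteq> 0"
  by (auto simp: colour_sign_def)

context
  fixes n t :: nat and c c' :: "nat \<Rightarrow> 'c"
  assumes t: "Suc t < n" and c': "\<And>q. q < n \<Longrightarrow> c' q = c (adj_swap t q)"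
begin

definition rest_mset :: "(nat \<Rightarrow> 'c) \<Rightarrow> (nat \<times> nat) multiset" where
  "rest_mset d = (\<Sum>p\<in>pairs n - {(t, Suc t)}. replicate_mset (a (d (fst p)) (d (snd p))) p)"

lemma pair_mset_split: "pair_mset n d = replicate_mset (a (d t) (d (Suc t))) (t, Suc t) + rest_mset d"
  unfolding pair_mset_def rest_mset_def
  by (subst sum.remove[of _ "(t, Suc t)"]) (use t in \<open>auto simp: mem_pairs\<close>)

lemma rest_mset_swap: "image_mset (map_prod (adj_swap t) (adj_swap t)) (rest_mset c') = rest_mset c"
proof -
  let ?m = "map_prod (adj_swap t) (adj_swap t)" and ?A = "pairs n - {(t, Suc t)}"
  have "image_mset ?m (rest_mset c') = (\<Sum>p\<in>?A. replicate_mset (a (c' (fst p)) (c' (snd p))) (?m p))"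
    unfolding rest_mset_def by (rule image_mset_sum_replicate_mset) simp
  also have "\<dots> = (\<Sum>p\<in>?A. replicate_mset (a (c (fst (?m p))) (c (snd (?m p)))) (?m p))"
    by (intro sum.cong refl) (auto simp: mem_pairs c')
  also have "\<dots> = rest_mset c"
    unfolding rest_mset_def by (rule sum.reindex_bij_betw[OF bij_betw_adj_swap_pairs[OF t]])
  finally show ?thesis .
qed

lemma mem_rest_mset: "(s, r) \<in># rest_mset d \<Longrightarrow> s < r \<and> r < n \<and> (s, r) \<noteq> (t, Suc t)"
  unfolding rest_mset_def
  by (drule mem_sum_replicate_mset[rotated]) (auto simp: mem_pairs)

text \<open>Only the pair \<open>(t, Suc t)\<close> is reversed. For different colours this creates
  or removes one inversion, which accounts for the sign; for equal colours the exponent is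
  even.\<close>

lemma colour_sign_swap: "(- 1) ^ a (c t) (c (Suc t)) * colour_sign n c' = colour_sign n c"
proof -
  let ?m = "map_prod (adj_swap t) (adj_swap t)" and ?A = "pairs n - {(t, Suc t)}"
  let ?s = "\<lambda>d p. if d (snd p) < d (fst p) then (- 1 :: rat) ^ a (d (fst p)) (d (snd p)) else 1"
  have split: "colour_sign n d = ?s d (t, Suc t) * prod (?s d) ?A" for d
    unfolding colour_sign_def
    by (subst prod.remove[of _ "(t, Suc t)"]) (use t in \<open>auto simp: mem_pairs\<close>)
  have "prod (?s c') ?A = (\<Prod>p\<in>?A. ?s c (?m p))"
    by (intro prod.cong refl) (auto simp: mem_pairs c')
  also have "\<dots> = prod (?s c) ?A"
    by (rule prod.reindex_bij_betw[OF bij_betw_adj_swap_pairs[OF t]])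
  finally have rest: "prod (?s c') ?A = prod (?s c) ?A" .
  have "c' t = c (Suc t)" "c' (Suc t) = c t" using t by (simp_all add: c' adj_swap_def)
  then have "(- 1) ^ a (c t) (c (Suc t)) * ?s c' (t, Suc t) = ?s c (t, Suc t)"
    using a_diag[of "c t"] a_sym[of "c t" "c (Suc t)"]
    by (cases "c t" "c (Suc t)" rule: linorder_cases) (auto simp flip: power_add)
  then show ?thesis unfolding split rest by (simp add: mult.assoc[symmetric])
qed

lemma letters_swap: "letters n c' (k \<circ> adj_swap t) = letters n c k"
proof -
  have "mset_set {..<n} = image_mset (adj_swap t) (mset_set {..<n})"
  proof (subst image_mset_mset_set)
    show "inj_on (adj_swap t) {..<n}" by (metis adj_swap_adj_swap inj_on_inverseI)
    have "adj_swap t ` {..<n} = {..<n}"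
    proof
      show "adj_swap t ` {..<n} \<subseteq> {..<n}" using adj_swap_less_n[OF t] by auto
      show "{..<n} \<subseteq> adj_swap t ` {..<n}"
      proof
        fix x assume "x \<in> {..<n}"
        then show "x \<in> adj_swap t ` {..<n}"
          using adj_swap_less_n[OF t] by (intro image_eqI[of x "adj_swap t" "adj_swap t x"]) auto
      qed
    qed
    then show "mset_set {..<n} = mset_set (adj_swap t ` {..<n})" by simp
  qed
  from arg_cong[OF this, of "image_mset (\<lambda>q. (k q, c q))"]
  have "letters n c k = image_mset (\<lambda>q. (k (adj_swap t q), c (adj_swap t q))) (mset_set {..<n})"
    by (simp add: letters_def multiset.map_comp comp_def)
  also have "\<dots> = letters n c' (k \<circ> adj_swap t)"
    unfolding letters_def by (intro image_mset_cong) (auto simp: c')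
  finally show ?thesis ..
qed

text \<open>The two sides are expansions of quotients in different orders of the variables. Once the
  factors of the exchanged pair are multiplied back, the remaining denominators agree, and division
  is unique in a domain that contains both expansions.\<close>

lemma vdiff_power_swap:
  assumes f: "laurent n N f" "vdiffs (pair_mset n c) f = signed_delta n M c"
    and f': "laurent n N f'" "vdiffs (pair_mset n c') f' = signed_delta n M c'"
  shows "(vdiff t (Suc t) ^^ a (c t) (c (Suc t))) f =
    (vdiff t (Suc t) ^^ a (c t) (c (Suc t))) (\<lambda>k. f' (k \<circ> adj_swap t))"
proof -
  let ?m = "map_prod (adj_swap t) (adj_swap t)"
  define m where "m = a (c t) (c (Suc t))"
  define h where "h = (\<lambda>k. f' (k \<circ> adj_swap t))"
  have m': "a (c' t) (c' (Suc t)) = m"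
    using t by (simp add: c' adj_swap_def m_def a_sym)
  have 1: "vdiffs (rest_mset c) ((vdiff t (Suc t) ^^ m) f) = signed_delta n M c"
    using f(2) unfolding pair_mset_split vdiffs_union vdiffs_replicate m_def .
  have "image_mset ?m (pair_mset n c') = replicate_mset m (Suc t, t) + rest_mset c"
    by (simp add: pair_mset_split m' rest_mset_swap adj_swap_def)
  moreover have swap: "(vdiff (Suc t) t ^^ m) h = (\<lambda>k. (- 1) ^ m * (vdiff t (Suc t) ^^ m) h k)"
    by (rule vdiff_swap_power)
  ultimately have "vdiffs (replicate_mset m (Suc t, t) + rest_mset c) h k = signed_delta n M c' (k \<circ> adj_swap t)" for k
    using vdiffs_adj_swap[of "pair_mset n c'" f' k t] f'(2) by (simp add: h_def)
  then have "vdiffs (rest_mset c) (\<lambda>k. (- 1) ^ m * (vdiff t (Suc t) ^^ m) h k) k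
      = signed_delta n M c' (k \<circ> adj_swap t)" for k
    by (simp only: vdiffs_union vdiffs_replicate swap)
  moreover have "vdiffs (rest_mset c) (\<lambda>k. (- 1) ^ m * (vdiff t (Suc t) ^^ m) h k)
      = (\<lambda>k. (- 1) ^ m * vdiffs (rest_mset c) ((vdiff t (Suc t) ^^ m) h) k)"
    using vdiffs_sum[of "rest_mset c" "\<lambda>_. (- 1) ^ m" "\<lambda>_. (vdiff t (Suc t) ^^ m) h" "{()}"] by simp
  ultimately have "(- 1) ^ m * vdiffs (rest_mset c) ((vdiff t (Suc t) ^^ m) h) k
      = signed_delta n M c' (k \<circ> adj_swap t)" for k by simp
  \<comment> \<open>The sign from reversing the difference of the exchanged variables cancels
    against the change of \<open>colour_sign\<close>.\<close>
  then have "(- 1) ^ m * ((- 1) ^ m * vdiffs (rest_mset c) ((vdiff t (Suc t) ^^ m) h) k)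
      = signed_delta n M c k" for k
    using colour_sign_swap by (simp add: signed_delta_def letters_swap m_def)
  then have 2: "vdiffs (rest_mset c) ((vdiff t (Suc t) ^^ m) h) = signed_delta n M c"
    by (auto simp: mult.assoc[symmetric] power_mult_distrib[symmetric])
  \<comment> \<open>The entries preceding \<open>p\<close> in at least one of the two orders. For
    every pair \<open>(s, r)\<close> in \<open>rest_mset c\<close> neither \<open>s\<close> nor
    \<open>r\<close> lies in \<open>Pre s\<close>, as \<open>vdiffs_inj\<close> requires.\<close>
  define Pre where "Pre p = {..<p} \<union> adj_swap t ` {..<adj_swap t p}" for p
  have ezf: "eventually_zero n Pre f"
    using f(1) unfolding laurent_def by (auto elim: eventually_zero_mono simp: Pre_def)
  have ezh: "eventually_zero n Pre h"
    unfolding eventually_zero_def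
  proof (intro allI impI)
    fix p k assume p: "p < n"
    have "eventually_zero n lessThan f'" using f'(1) by (simp add: laurent_def)
    then obtain N where N: "\<And>k'. (\<forall>q<adj_swap t p. k' q = (k \<circ> adj_swap t) q) \<and> k' (adj_swap t p) > N \<Longrightarrow> f' k' = 0"
      using p adj_swap_less_n[OF t, of p] unfolding eventually_zero_def lessThan_iff Ball_def by metis
    have "h k' = 0" if "\<forall>q\<in>Pre p. k' q = k q" "k' p > N" for k'
      unfolding h_def using that by (intro N) (auto simp: Pre_def)
    then show "\<exists>N. \<forall>k'. (\<forall>q\<in>Pre p. k' q = k q) \<and> k' p > N \<longrightarrow> h k' = 0" by blast
  qed
  have "(\<lambda>k. (vdiff t (Suc t) ^^ m) f k - (vdiff t (Suc t) ^^ m) h k) = (\<lambda>_. 0)"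
  proof (rule vdiffs_inj)
    show "eventually_zero n Pre (\<lambda>k. (vdiff t (Suc t) ^^ m) f k - (vdiff t (Suc t) ^^ m) h k)"
      unfolding vdiffs_replicate[symmetric]
      by (intro eventually_zero_diff eventually_zero_vdiffs ezf ezh)
    show "vdiffs (rest_mset c) (\<lambda>k. (vdiff t (Suc t) ^^ m) f k - (vdiff t (Suc t) ^^ m) h k) = (\<lambda>_. 0)"
      unfolding vdiffs_diff 1 2 by simp
    fix s r assume "(s, r) \<in># rest_mset c"
    then have sr: "s < r" "r < n" "(s, r) \<noteq> (t, Suc t)" by (auto dest: mem_rest_mset)
    have inv: "q \<notin> adj_swap t ` {..<x}" if "x \<le> adj_swap t q" for q x
      using that by auto
    show "s < n \<and> s \<notin> Pre s \<and> r \<notin> Pre s \<and> s \<noteq> r"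
    proof -
      have "s \<notin> Pre s" using inv[of "adj_swap t s" s] unfolding Pre_def by blast
      moreover have "r \<notin> Pre s"
        using inv[of "adj_swap t s" r] adj_swap_less[OF sr(1,3)] sr(1)
        unfolding Pre_def Un_iff lessThan_iff by simp
      ultimately show ?thesis using sr by simp
    qed
  qed
  then have "(vdiff t (Suc t) ^^ m) f k = (vdiff t (Suc t) ^^ m) h k" for k
    unfolding fun_eq_iff by simp
  then show ?thesis unfolding m_def h_def by (rule ext)
qed

end

end

section \<open>Existence of local functions with prescribed leading word\<close>

definition exponents :: "(int \<times> 'c) list \<Rightarrow> nat \<Rightarrow> int" where
  "exponents w t = (if t < length w then fst (w ! t) else 0)"

lemma weight_exponents: "(\<Sum>t<length w. exponents w t) = weight w"
proof -
  have "(\<Sum>t<length w. exponents w t) = (\<Sum>t<length w. fst (w ! t))"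
    by (rule sum.cong) (auto simp: exponents_def)
  also have "\<dots> = weight w"
    by (simp add: weight_def sum_list_sum_nth atLeast0LessThan)
  finally show ?thesis .
qed

lemma exponents_two:
  "exponents (u @ (k, i) # (l, j) # v) =
   (exponents (u @ (0, i) # (0, j) # v))(length u := k, Suc (length u) := l)"
  by (auto simp: exponents_def fun_eq_iff nth_append nth_Cons split: nat.splits)

lemma exponents_two_swap:
  "exponents (u @ (l, j) # (k, i) # v) =
   (exponents (u @ (0, i) # (0, j) # v))(length u := k, Suc (length u) := l) \<circ> adj_swap (length u)"
  by (auto simp: exponents_def adj_swap_def fun_eq_iff nth_append nth_Cons split: nat.splits)

text \<open>Gaussian elimination, one equation at a time. It takes the place of dimension arguments
  for spaces of functions on words.\<close>

lemma homogeneous_system_nontrivial: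
  fixes v :: "'i \<Rightarrow> 'b \<Rightarrow> 'k::field"
  assumes "finite B" "finite A" "card B < card A"
  shows "\<exists>c. (\<exists>i\<in>A. c i \<noteq> 0) \<and> (\<forall>b\<in>B. (\<Sum>i\<in>A. c i * v i b) = 0)"
  using assms
proof (induction B arbitrary: A v rule: finite_induct)
  case empty
  then obtain i where "i \<in> A" by (metis card.empty equals0I less_nat_zero_code)
  then show ?case by (intro exI[of _ "\<lambda>_. 1"]) auto
next
  case (insert b B)
  show ?case
  proof (cases "\<forall>i\<in>A. v i b = 0")
    case True
    obtain c where "\<exists>i\<in>A. c i \<noteq> 0" "\<forall>b\<in>B. (\<Sum>i\<in>A. c i * v i b) = 0"
      using insert.IH[of A v] insert.prems insert.hyps by auto
    then show ?thesis using True by (intro exI[of _ c]) auto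
  next
    case False
    then obtain i0 where i0: "i0 \<in> A" "v i0 b \<noteq> 0" by blast
    define v' where "v' i d = v i d - v i b / v i0 b * v i0 d" for i d
    have "card B < card (A - {i0})" using insert.prems insert.hyps i0 by simp
    then obtain c where c: "\<exists>i\<in>A - {i0}. c i \<noteq> 0" "\<forall>d\<in>B. (\<Sum>i\<in>A - {i0}. c i * v' i d) = 0"
      using insert.IH[of "A - {i0}" v'] insert.prems(1) by blast
    define c0 where "c0 = - (\<Sum>i\<in>A - {i0}. c i * (v i b / v i0 b))"
    have sum: "(\<Sum>i\<in>A. (c(i0 := c0)) i * v i d) = (\<Sum>i\<in>A - {i0}. c i * v' i d)" for d
    proof -
      have "(\<Sum>i\<in>A. (c(i0 := c0)) i * v i d) = c0 * v i0 d + (\<Sum>i\<in>A - {i0}. c i * v i d)"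
        using insert.prems i0 by (subst sum.remove[of _ i0]) auto
      also have "c0 * v i0 d = - (\<Sum>i\<in>A - {i0}. c i * (v i b / v i0 b * v i0 d))"
        by (simp add: c0_def sum_distrib_right mult.assoc)
      also have "- (\<Sum>i\<in>A - {i0}. c i * (v i b / v i0 b * v i0 d)) + (\<Sum>i\<in>A - {i0}. c i * v i d)
          = (\<Sum>i\<in>A - {i0}. c i * v' i d)"
        unfolding v'_def right_diff_distrib sum_subtractf by simp
      finally show ?thesis .
    qed
    have "v' i b = 0" for i using i0 by (simp add: v'_def)
    then have "\<forall>d\<in>insert b B. (\<Sum>i\<in>A. (c(i0 := c0)) i * v i d) = 0"
      unfolding sum using c by simp
    moreover have "\<exists>i\<in>A. (c(i0 := c0)) i \<noteq> 0" using c by auto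
    ultimately show ?thesis by blast
  qed
qed

lemma sum_pairs_Cons:
  "(\<Sum>p\<in>pairs (Suc (length cs)). f ((x # cs) ! fst p) ((x # cs) ! snd p)) =
   (\<Sum>y\<leftarrow>cs. f x y) + (\<Sum>p\<in>pairs (length cs). f (cs ! fst p) (cs ! snd p) :: nat)"
proof -
  have split: "pairs (Suc n) = (\<lambda>t. (0, Suc t)) ` {..<n} \<union> map_prod Suc Suc ` pairs n" for n
  proof (rule set_eqI)
    fix p show "p \<in> pairs (Suc n) \<longleftrightarrow> p \<in> (\<lambda>t. (0, Suc t)) ` {..<n} \<union> map_prod Suc Suc ` pairs n"
    proof (cases p)
      case (Pair s t)
      then show ?thesis
        by (cases s; cases t) (auto simp: mem_pairs image_iff map_prod_def split: prod.splits)
    qed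
  qed
  have "(\<Sum>p\<in>pairs (Suc (length cs)). f ((x # cs) ! fst p) ((x # cs) ! snd p)) =
     (\<Sum>p\<in>(\<lambda>t. (0, Suc t)) ` {..<length cs}. f ((x # cs) ! fst p) ((x # cs) ! snd p)) +
     (\<Sum>p\<in>map_prod Suc Suc ` pairs (length cs). f ((x # cs) ! fst p) ((x # cs) ! snd p))"
    unfolding split by (rule sum.union_disjoint) auto
  also have "(\<Sum>p\<in>(\<lambda>t. (0, Suc t)) ` {..<length cs}. f ((x # cs) ! fst p) ((x # cs) ! snd p))
      = (\<Sum>y\<leftarrow>cs. f x y)"
    by (subst sum.reindex) (auto simp: inj_on_def sum_list_sum_nth atLeast0LessThan)
  also have "(\<Sum>p\<in>map_prod Suc Suc ` pairs (length cs). f ((x # cs) ! fst p) ((x # cs) ! snd p))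
      = (\<Sum>p\<in>pairs (length cs). f (cs ! fst p) (cs ! snd p))"
    by (subst sum.reindex) (auto simp: inj_on_def)
  finally show ?thesis .
qed

context colour_form
begin

lemma sum_pairs_weight:
  "int (\<Sum>p\<in>pairs (length w). a (map snd w ! fst p) (map snd w ! snd p)) = weight w - weight (flatten w)"
proof (induction w)
  case Nil
  have "pairs 0 = {}" by (auto simp: pairs_def)
  then show ?case by simp
next
  case (Cons x w)
  have "(\<Sum>y\<leftarrow>map snd w. a (snd x) y) = lin (a (snd x)) (colours w)"
    by (simp add: lin_colours comp_def)
  then show ?case
    using Cons sum_pairs_Cons[of a "snd x" "map snd w"] by (simp add: weight_map_shift)
qed

text \<open>The number of factors in the denominator is the amount by which division raises the
  weight; hence numerators of weight \<open>N + lin b g - quad g\<close> for fields of weight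
  \<open>N\<close>.\<close>

lemma size_pair_mset:
  "int (size (pair_mset (length w) ((!) (map snd w)))) = int (quad (colours w)) - int (lin b (colours w))"
proof -
  have "size (pair_mset (length w) ((!) (map snd w)))
      = (\<Sum>p\<in>pairs (length w). a (map snd w ! fst p) (map snd w ! snd p))"
    unfolding pair_mset_def by (rule size_sum_replicate_mset) simp
  then show ?thesis using sum_pairs_weight[of w] weight_flatten[of w] by simp
qed

lemma letters_eq_mset: "letters n c k = mset (map (\<lambda>t. (k t, c t)) [0..<n])"
  unfolding letters_def by (simp flip: mset_upt) (simp add: atLeast0LessThan)

lemma laurent_signed_delta:
  assumes "M \<in> colour_multisets g N"
  shows "laurent n N (signed_delta n M c)"
proof -
  obtain w where w: "M = mset w" "\<forall>x\<in>set w. fst x \<le> 0" "weight w = N"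
    using assms unfolding colour_multisets_def by blast
  have eq: "letters n c k = mset w" if "signed_delta n M c k \<noteq> 0" for k
    using that w by (auto simp: signed_delta_def split: if_splits)
  have le: "k t \<le> 0" if "signed_delta n M c k \<noteq> 0" "t < n" for k t
  proof -
    have "(k t, c t) \<in># letters n c k" using that(2) by (auto simp: letters_def)
    then show ?thesis using eq[OF that(1)] w(2) by auto
  qed
  have sum: "(\<Sum>t<n. k t) = N" if "signed_delta n M c k \<noteq> 0" for k
  proof -
    have "weight (map (\<lambda>t. (k t, c t)) [0..<n]) = weight w"
      by (rule weight_mset_cong) (metis eq[OF that] letters_eq_mset)
    moreover have "weight (map (\<lambda>t. (k t, c t)) [0..<n]) = (\<Sum>t<n. k t)"
      by (simp add: weight_def comp_def interv_sum_list_conv_sum_set_nat atLeast0LessThan)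
    ultimately show ?thesis using w by simp
  qed
  have "eventually_zero n lessThan (signed_delta n M c)"
    unfolding eventually_zero_def by (intro allI impI exI[of _ 0]) (metis le not_less)
  then show ?thesis using le sum by (auto simp: laurent_def)
qed

definition quotient :: "nat \<Rightarrow> int \<Rightarrow> (int \<times> 'c) multiset \<Rightarrow> 'c list \<Rightarrow> (nat \<Rightarrow> int) \<Rightarrow> rat" where
  "quotient n N M cs =
     (SOME f. laurent n N f \<and> vdiffs (pair_mset n ((!) cs)) f = signed_delta n M ((!) cs))"

lemma quotient_props:
  assumes M: "M \<in> colour_multisets g (N + int (lin b g) - int (quad g))" and w: "colours w = g"
  shows "laurent (deg g) N (quotient (deg g) N M (map snd w))" (is ?A)
    and "vdiffs (pair_mset (deg g) ((!) (map snd w))) (quotient (deg g) N M (map snd w))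
      = signed_delta (deg g) M ((!) (map snd w))" (is ?B)
proof -
  have n: "length w = deg g" using w deg_colours[of w] by simp
  have size: "int (size (pair_mset (deg g) ((!) (map snd w)))) = int (quad g) - int (lin b g)"
    using size_pair_mset[of w] n w by simp
  have "\<exists>f. laurent (deg g) (N + int (lin b g) - int (quad g) +
      int (size (pair_mset (deg g) ((!) (map snd w))))) f
    \<and> vdiffs (pair_mset (deg g) ((!) (map snd w))) f = signed_delta (deg g) M ((!) (map snd w))"
    by (rule vdiffs_surj) (use M mem_pair_mset laurent_signed_delta in blast)+
  then have "\<exists>f. laurent (deg g) N f \<and>
      vdiffs (pair_mset (deg g) ((!) (map snd w))) f = signed_delta (deg g) M ((!) (map snd w))"
    unfolding size by simp
  then have "?A \<and> ?B" unfolding quotient_def by (rule someI_ex)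
  then show ?A ?B by blast+
qed

text \<open>The expansions for all colour sequences with multiplicities \<open>g\<close> are
  collected into one function on words; each word selects the expansion in its own order of
  variables.\<close>

definition quotient_field :: "('c \<Rightarrow>\<^sub>0 nat) \<Rightarrow> int \<Rightarrow> (int \<times> 'c) multiset \<Rightarrow> (int \<times> 'c) list \<Rightarrow> rat" where
  "quotient_field g N M w =
     (if colours w = g then quotient (deg g) N M (map snd w) (exponents w) else 0)"

lemma quotient_field_local:
  assumes M: "M \<in> colour_multisets g (N + int (lin b g) - int (quad g))"
  shows "local (quotient_field g N M)"
proof -
  let ?F = "quotient_field g N M"
  have "difference (a i j) (\<lambda>k l. ?F (u @ (k, i) # (l, j) # v)) =
        difference (a i j) (\<lambda>k l. ?F (u @ (l, j) # (k, i) # v))" for u v i j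
  proof (cases "colours (u @ (0, i) # (0, j) # v) = g")
    case False
    then have "(\<lambda>k l. ?F (u @ (k, i) # (l, j) # v)) = (\<lambda>k l. ?F (u @ (l, j) # (k, i) # v))"
      by (simp add: quotient_field_def ac_simps)
    then show ?thesis by simp
  next
    case True
    define w where "w = u @ (0 :: int, i) # (0 :: int, j) # v"
    define w' where "w' = u @ (0 :: int, j) # (0 :: int, i) # v"
    define t n where "t = length u" and "n = deg g"
    have cw: "colours w = g" "colours w' = g" using True by (simp_all add: w_def w'_def ac_simps)
    have n: "n = length w" "n = length w'" using cw deg_colours unfolding n_def by metis+
    have t: "Suc t < n" using n by (simp add: w_def t_def)
    define f where "f = quotient n N M (map snd w)"
    define f' where "f' = quotient n N M (map snd w')"
    have F: "?F (u @ (k, i) # (l, j) # v) = f ((exponents w)(t := k, Suc t := l))" for k l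
    proof -
      have "colours (u @ (k, i) # (l, j) # v) = g" "map snd (u @ (k, i) # (l, j) # v) = map snd w"
        using cw by (simp_all add: w_def)
      then show ?thesis
        unfolding quotient_field_def f_def n_def
        by (simp only: exponents_two[of u k i l j v] simp_thms if_True t_def w_def)
    qed
    have F': "?F (u @ (l, j) # (k, i) # v) = f' ((exponents w)(t := k, Suc t := l) \<circ> adj_swap t)" for k l
    proof -
      have "colours (u @ (l, j) # (k, i) # v) = g" "map snd (u @ (l, j) # (k, i) # v) = map snd w'"
        using cw by (simp_all add: w'_def)
      then show ?thesis
        unfolding quotient_field_def f'_def n_def
        by (simp only: exponents_two_swap[of u l j k i v] simp_thms if_True t_def w_def)
    qed
    have cc: "map snd w' ! q = map snd w ! adj_swap t q" if "q < n" for q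
      using that n unfolding w_def w'_def t_def adj_swap_def
      by (auto simp: nth_append nth_Cons split: nat.splits)
    have ij: "map snd w ! t = i" "map snd w ! Suc t = j"
      by (simp_all add: w_def t_def nth_append)
    have "(vdiff t (Suc t) ^^ a (map snd w ! t) (map snd w ! Suc t)) f
        = (vdiff t (Suc t) ^^ a (map snd w ! t) (map snd w ! Suc t)) (\<lambda>k. f' (k \<circ> adj_swap t))"
      unfolding f_def f'_def n_def
      by (rule vdiff_power_swap[OF t[unfolded n_def] cc[unfolded n_def]
            quotient_props[OF M cw(1)] quotient_props[OF M cw(2)]])
    then have "(vdiff t (Suc t) ^^ a i j) f = (vdiff t (Suc t) ^^ a i j) (\<lambda>k. f' (k \<circ> adj_swap t))"
      unfolding ij .
    then show ?thesis
      unfolding F F' by (intro ext) (simp only: difference_vdiff[of t "Suc t", OF n_not_Suc_n]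
        difference_vdiff[of t "Suc t" _ "\<lambda>k. f' (k \<circ> adj_swap t)", OF n_not_Suc_n])
  qed
  note eq = this
  have ev: "difference m H k l v = difference m (\<lambda>k l. H k l v) k l"
    for m v k l and H :: "int \<Rightarrow> int \<Rightarrow> (int \<times> 'c) list \<Rightarrow> rat"
    by (subst difference_additive[where L = "\<lambda>X. X v"]) simp_all
  show ?thesis
    unfolding local_def
  proof (intro allI ext)
    fix u i j k l v
    show "difference (a i j) (\<lambda>k l. lder (l, j) (lder (k, i) (lders u ?F))) k l v
        = difference (a i j) (\<lambda>k l. lder (k, i) (lder (l, j) (lders u ?F))) k l v"
      unfolding ev lder_def lders_def by (simp only: eq append.assoc append_Cons append_Nil)
  qed
qed

lemma quotient_field_in_fields:
  assumes M: "M \<in> colour_multisets g (N + int (lin b g) - int (quad g))"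
  shows "quotient_field g N M \<in> fields g N"
proof -
  let ?F = "quotient_field g N M"
  have length: "length w = deg g" if "colours w = g" for w :: "(int \<times> 'c) list"
    using that deg_colours[of w] by simp
  have weight: "weight w = N" if "?F w \<noteq> 0" for w
  proof -
    have w: "colours w = g" using that by (auto simp: quotient_field_def split: if_splits)
    then have "(\<Sum>t<deg g. exponents w t) = N"
      using that quotient_props(1)[OF M w] unfolding laurent_def quotient_field_def by auto
    then show ?thesis using weight_exponents[of w] length[OF w] by simp
  qed
  have "lder (k, i) ?F = 0" if "k > 0" for k i
  proof
    fix v
    show "lder (k, i) ?F v = 0 v"
    proof (rule ccontr)
      assume "lder (k, i) ?F v \<noteq> 0 v"
      then have nz: "?F ((k, i) # v) \<noteq> 0" by (simp add: lder_def)
      then have w: "colours ((k, i) # v) = g" by (auto simp: quotient_field_def split: if_splits)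
      have "exponents ((k, i) # v) 0 \<le> 0"
        using nz quotient_props(1)[OF M w] length[OF w] w unfolding laurent_def quotient_field_def by auto
      then show False using that by (simp add: exponents_def)
    qed
  qed
  then have reg: "regular ?F" by (simp add: regular_def)
  have "bounded ?F"
    unfolding bounded_def
  proof
    fix u
    show "\<exists>B. \<forall>k>B. \<forall>i. lder (k, i) (lders u ?F) = 0"
    proof (cases "length u < deg g")
      case False
      have "lder (k, i) (lders u ?F) = 0" for k i
        using False length[of "u @ (k, i) # v" for v] by (auto simp: lder_def lders_def quotient_field_def fun_eq_iff)
      then show ?thesis by blast
    next
      case True
      \<comment> \<open>There are finitely many colour sequences, so their individual bounds can be
        replaced by a common one.\<close>
      define CS where "CS = {cs. set cs \<subseteq> Poly_Mapping.keys g \<and> length cs = deg g}"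
      have "\<exists>B. \<forall>k'. laurent (deg g) N (quotient (deg g) N M cs) \<and>
          (\<forall>q<length u. k' q = exponents u q) \<and> k' (length u) > B \<longrightarrow> quotient (deg g) N M cs k' = 0" for cs
      proof (cases "laurent (deg g) N (quotient (deg g) N M cs)")
        case True
        then show ?thesis
          using eventually_zero_lessThanD[of "deg g" "quotient (deg g) N M cs" "length u" "exponents u"]
            \<open>length u < deg g\<close> by (auto simp: laurent_def)
      qed auto
      then obtain B where B: "\<And>cs k'. laurent (deg g) N (quotient (deg g) N M cs) \<Longrightarrow>
          (\<forall>q<length u. k' q = exponents u q) \<Longrightarrow> k' (length u) > B cs \<Longrightarrow> quotient (deg g) N M cs k' = 0"
        by metis
      have fin: "finite CS" unfolding CS_def by (rule finite_lists_length_eq) simp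
      have "lder (k, i) (lders u ?F) v = 0" if k: "k > Max (insert 0 (B ` CS))" for k i v
      proof -
        let ?w = "u @ (k, i) # v"
        have "?F ?w = 0"
        proof (cases "colours ?w = g")
          case True
          have "map snd ?w \<in> CS"
            using snd_in_keys_colours[of _ ?w] length[OF True] True unfolding CS_def by fastforce
          then have "B (map snd ?w) \<le> Max (insert 0 (B ` CS))" using fin by (intro Max_ge) auto
          then have "quotient (deg g) N M (map snd ?w) (exponents ?w) = 0"
            using k quotient_props(1)[OF M True] by (intro B) (auto simp: exponents_def nth_append)
          then show ?thesis by (simp add: quotient_field_def)
        qed (simp add: quotient_field_def)
        then show ?thesis by (simp add: lder_def lders_def)
      qed
      then show ?thesis by (intro exI[of _ "Max (insert 0 (B ` CS))"]) (auto simp: fun_eq_iff)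
    qed
  qed
  then show ?thesis
    using reg quotient_field_local[OF M] weight
    by (auto simp: fields_def quotient_field_def split: if_splits)
qed

text \<open>Multiplying back by the denominator yields the signed monomials of distinct multisets.
  Evaluation at a word with the letters \<open>M0\<close> then isolates \<open>c M0\<close>, because
  the sign is nonzero.\<close>

lemma quotient_field_independent:
  fixes c :: "(int \<times> 'c) multiset \<Rightarrow> rat"
  assumes A_def: "A = colour_multisets g (N + int (lin b g) - int (quad g))"
    and zero: "\<And>w. (\<Sum>M\<in>A. c M * quotient_field g N M w) = 0" and M0: "M0 \<in> A"
  shows "c M0 = 0"
proof -
  obtain w0 where w0: "M0 = mset w0" "colours w0 = g"
    using M0 unfolding A_def colour_multisets_def by blast
  define n where "n = deg g"
  define cs where "cs = map snd w0"
  have n: "length w0 = n" using w0 deg_colours[of w0] by (simp add: n_def)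
  have "(\<Sum>M\<in>A. c M * quotient n N M cs k) = 0" if k: "\<forall>t\<ge>n. k t = 0" for k
  proof -
    define w where "w = map (\<lambda>t. (k t, cs ! t)) [0..<n]"
    have cs: "map snd w = cs" using n by (intro nth_equalityI) (auto simp: w_def cs_def)
    have "colours w = (\<Sum>x\<leftarrow>map snd w. Poly_Mapping.single x 1)"
      by (simp add: colours_def comp_def)
    also have "\<dots> = colours w0" unfolding cs by (simp add: colours_def cs_def comp_def)
    finally have "colours w = g" using w0 by simp
    moreover have "exponents w = k" using k by (auto simp: exponents_def w_def fun_eq_iff)
    ultimately show ?thesis using zero[of w] cs by (simp add: quotient_field_def n_def)
  qed
  then have "vdiffs (pair_mset n ((!) cs)) (\<lambda>k. \<Sum>M\<in>A. c M * quotient n N M cs k) (exponents w0) = 0"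
    using mem_pair_mset n by (intro vdiffs_zero_on[of _ n]) (force simp: exponents_def)+
  moreover have "vdiffs (pair_mset n ((!) cs)) (quotient n N M cs) = signed_delta n M ((!) cs)"
    if "M \<in> A" for M
    using quotient_props(2)[OF _ w0(2)] that unfolding A_def n_def cs_def by blast
  ultimately have "(\<Sum>M\<in>A. c M * signed_delta n M ((!) cs) (exponents w0)) = 0"
    by (simp add: vdiffs_sum)
  moreover have "letters n ((!) cs) (exponents w0) = M0"
  proof -
    have "map (\<lambda>t. (exponents w0 t, cs ! t)) [0..<n] = w0"
      using n by (intro nth_equalityI) (auto simp: exponents_def cs_def)
    then show ?thesis by (simp only: letters_eq_mset w0)
  qed
  ultimately have "(\<Sum>M\<in>A. if M0 = M then c M * colour_sign n ((!) cs) else 0) = 0"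
    by (simp add: signed_delta_def if_distrib cong: if_cong)
  then show ?thesis
    using M0 finite_colour_multisets colour_sign_neq_0 by (simp add: A_def)
qed

lemma fields_sum:
  "finite A \<Longrightarrow> (\<And>i. i \<in> A \<Longrightarrow> F i \<in> fields g N) \<Longrightarrow> (\<Sum>i\<in>A. scl (c i) (F i)) \<in> fields g N"
  by (induction A rule: finite_induct) (auto intro: fields_add fields_scl)

lemma sum_scl_apply: "(\<Sum>i\<in>A. scl (c i) (F i)) w = (\<Sum>i\<in>A. c i * F i w)"
  by (induction A rule: infinite_finite_induct) (auto simp: scl_apply)

text \<open>There are at least as many independent quotient fields as admissible words, so a nonzero
  combination of them vanishes at all admissible words other than \<open>w\<close>. Its leading word
  is admissible and can only be \<open>w\<close>.\<close>

lemma adm_leading_ex: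
  assumes "w \<in> adm g N"
  shows "\<exists>F\<in>fields g N. leading F w"
proof (rule ccontr)
  assume contr: "\<not> ?thesis"
  define A where "A = colour_multisets g (N + int (lin b g) - int (quad g))"
  have fin: "finite A" unfolding A_def by (rule finite_colour_multisets)
  have "card (adm g N - {w}) < card A"
    using card_adm_le[of g N] assms finite_adm[of g N] card_Diff1_less[of "adm g N" w]
    unfolding A_def by linarith
  then obtain c where c: "\<exists>M\<in>A. c M \<noteq> 0"
    "\<forall>v\<in>adm g N - {w}. (\<Sum>M\<in>A. c M * quotient_field g N M v) = 0"
    using homogeneous_system_nontrivial[of "adm g N - {w}" A "quotient_field g N"] finite_adm fin
    by auto
  define G where "G = (\<Sum>M\<in>A. scl (c M) (quotient_field g N M))"
  have G: "G v = (\<Sum>M\<in>A. c M * quotient_field g N M v)" for v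
    by (simp only: G_def sum_scl_apply)
  have "G \<noteq> 0"
  proof
    assume "G = 0"
    then have "(\<Sum>M\<in>A. c M * quotient_field g N M v) = 0" for v
      using G[of v] by simp
    then show False using c(1) quotient_field_independent[OF A_def, of c] by blast
  qed
  have "G \<in> fields g N"
    unfolding G_def using fin quotient_field_in_fields by (intro fields_sum) (auto simp: A_def)
  then obtain v where v: "v \<in> adm g N" "leading G v"
    using fields_leading_ex \<open>G \<noteq> 0\<close> by blast
  have "v \<noteq> w" using contr v \<open>G \<in> fields g N\<close> by blast
  then have "G v = 0" using c(2) v G by simp
  then show False using v by (simp add: leading_def)
qed


section \<open>Indecomposables and the monotonicity of Lyndon word counts\<close>

definition generator :: "(int \<times> 'c) list \<Rightarrow> (int \<times> 'c) list \<Rightarrow> rat" where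
  "generator l = (SOME F. F \<in> fields (colours l) (weight l) \<and> leading F l)"

lemma generator:
  assumes "admissible l"
  shows "generator l \<in> fields (colours l) (weight l)" "leading (generator l) l"
proof -
  have "\<exists>F. F \<in> fields (colours l) (weight l) \<and> leading F l"
    using adm_leading_ex[of l "colours l" "weight l"] assms by (auto simp: adm_def)
  from someI_ex[OF this]
  show "generator l \<in> fields (colours l) (weight l)" "leading (generator l) l"
    unfolding generator_def by blast+
qed

definition monomial :: "(int \<times> 'c) list multiset \<Rightarrow> (int \<times> 'c) list \<Rightarrow> rat" where
  "monomial A = fold_mset (\<lambda>l. shp (generator l)) (word_delta []) A"

lemma monomial_empty [simp]: "monomial {#} = word_delta []"
  by (simp add: monomial_def)

lemma monomial_add_mset [simp]: "monomial (add_mset l A) = shp (generator l) (monomial A)"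
proof -
  interpret comp_fun_commute "\<lambda>l. shp (generator l)"
    by standard (auto simp: fun_eq_iff shp_assoc[symmetric] shp_commute[of "generator _" "generator _"])
  show ?thesis by (simp add: monomial_def)
qed

lemma monomial_union: "monomial (A + B) = shp (monomial A) (monomial B)"
  by (induction A) (simp_all add: shp_assoc)

lemma word_delta_fields: "word_delta [] \<in> fields 0 0"
  by (auto simp: fields_def regular_def local_def bounded_def word_delta_def lder_def lders_def fun_eq_iff)

lemma monomial_lyndon_seq:
  "lyndon_seq ls \<Longrightarrow> \<forall>l\<in>set ls. admissible l \<Longrightarrow>
    monomial (mset ls) \<in> fields (colours (concat ls)) (weight (concat ls)) \<and>
    leading (monomial (mset ls)) (concat ls)"
proof (induction ls)
  case Nil
  then show ?case using word_delta_fields by (auto simp: leading_def word_delta_def)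
next
  case (Cons l ls)
  then have ls: "lyndon_seq ls" and l: "lyndon l" by (auto simp: lyndon_seq_Cons)
  have "max_shuffle l (concat ls) = mset_concat (mset (l # ls))"
    by (simp add: max_shuffle_def lyndon_factors_lyndon[OF l] lyndon_factors_concat[OF ls])
  also have "\<dots> = l @ concat ls" using mset_concat_mset[OF Cons.prems(1)] by simp
  finally show ?case
    using Cons ls generator[of l] leading_shp[of "generator l" l "monomial (mset ls)" "concat ls"]
      fields_shp[of "generator l" "colours l" "weight l" "monomial (mset ls)"]
    by auto
qed

text \<open>A basis of Poincare-Birkhoff-Witt type: ordered products of generators, one for each
  possible leading word.\<close>

definition basis :: "(int \<times> 'c) list \<Rightarrow> (int \<times> 'c) list \<Rightarrow> rat" where
  "basis w = monomial (mset (lyndon_factors w))"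

lemma basis:
  assumes "w \<in> adm g N"
  shows "basis w \<in> fields g N" "leading (basis w) w"
  using monomial_lyndon_seq[of "lyndon_factors w"] assms admissible_iff_factors[of w]
  by (auto simp: basis_def adm_def)

lemma shp_basis: "shp (basis u) (basis v) = basis (max_shuffle u v)"
  by (simp add: basis_def mset_lyndon_factors_max_shuffle monomial_union)

lemma fields_diff: "F \<in> fields g N \<Longrightarrow> G \<in> fields g N \<Longrightarrow> F - G \<in> fields g N"
  using fields_add[of F g N "scl (- 1) G"] fields_scl[of G g N "- 1"]
  by (simp add: scl_def fun_diff_def plus_fun_def)

text \<open>Subtracting a multiple of \<open>basis w\<close> removes the leading word
  \<open>w\<close>, and only finitely many admissible words lie below it.\<close>

lemma basis_span:
  assumes "F \<in> fields g N"
  shows "\<exists>c. F = (\<Sum>w\<in>adm g N. scl (c w) (basis w))"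
proof (cases "F = 0")
  case True
  then show ?thesis by (intro exI[of _ "\<lambda>_. 0"]) simp
next
  case False
  then obtain w where "w \<in> adm g N" "leading F w" using fields_leading_ex assms by blast
  then show ?thesis using assms
  proof (induction "card {v \<in> adm g N. v < w}" arbitrary: w F rule: less_induct)
    case less
    note w = less.prems(1) and F = less.prems(2) and FF = less.prems(3)
    define r where "r = F w / basis w w"
    define F' where "F' = F - scl r (basis w)"
    have bw: "basis w w \<noteq> 0" using basis(2)[OF w] by (simp add: leading_def)
    have F': "F' \<in> fields g N"
      unfolding F'_def using FF basis(1)[OF w] by (intro fields_diff fields_scl)
    have eq: "F = F' + scl r (basis w)" by (simp add: F'_def)
    have "\<exists>c. F' = (\<Sum>w\<in>adm g N. scl (c w) (basis w))"
    proof (cases "F' = 0")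
      case True
      then show ?thesis by (intro exI[of _ "\<lambda>_. 0"]) simp
    next
      case False
      then obtain v where v: "v \<in> adm g N" "leading F' v" using fields_leading_ex F' by blast
      have "F' v \<noteq> 0" using v by (simp add: leading_def)
      then have "F v \<noteq> 0 \<or> basis w v \<noteq> 0" by (auto simp: F'_def scl_apply)
      then have "v \<le> w" using F basis(2)[OF w] unfolding leading_def by blast
      moreover have "F' w = 0" using bw by (simp add: F'_def scl_apply r_def)
      then have "v \<noteq> w" using \<open>F' v \<noteq> 0\<close> by auto
      ultimately have "v < w" by simp
      have "card {x \<in> adm g N. x < v} < card {x \<in> adm g N. x < w}"
        using finite_adm[of g N] v \<open>v < w\<close> by (intro psubset_card_mono) auto
      then show ?thesis using less.hyps v F' by blast
    qed
    then obtain c where c: "F' = (\<Sum>w\<in>adm g N. scl (c w) (basis w))" by blast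
    have "(\<Sum>v\<in>adm g N. scl ((c(w := c w + r)) v) (basis v))
        = scl (c w + r) (basis w) + (\<Sum>v\<in>adm g N - {w}. scl (c v) (basis v))"
      using w finite_adm[of g N] by (subst sum.remove[of _ w]) auto
    also have "scl (c w + r) (basis w) = scl (c w) (basis w) + scl r (basis w)"
      by (auto simp: scl_def algebra_simps)
    also have "scl (c w) (basis w) + scl r (basis w) + (\<Sum>v\<in>adm g N - {w}. scl (c v) (basis v))
        = F' + scl r (basis w)"
      unfolding c using w finite_adm[of g N] by (subst (2) sum.remove[of _ w]) (auto simp: algebra_simps)
    finally show ?case using eq by metis
  qed
qed

lemma basis_independent:
  assumes "S \<subseteq> adm g N" "(\<Sum>w\<in>S. scl (c w) (basis w)) = 0" "v \<in> S"
  shows "c v = 0"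
proof (rule ccontr)
  assume nz: "c v \<noteq> 0"
  have fin: "finite S" using assms(1) finite_adm finite_subset by blast
  define w where "w = Max {w \<in> S. c w \<noteq> 0}"
  have w: "w \<in> S" "c w \<noteq> 0"
    using Max_in[of "{w \<in> S. c w \<noteq> 0}"] fin assms(3) nz unfolding w_def by auto
  have max: "u \<le> w" if "u \<in> S" "c u \<noteq> 0" for u
    unfolding w_def using fin that by (intro Max_ge) auto
  have "c u * basis u w = 0" if "u \<in> S" "u \<noteq> w" for u
  proof (cases "c u = 0")
    case False
    then have "u < w" using max that by (metis order.not_eq_order_implies_strict)
    then have "basis u w = 0"
      using basis(2)[of u g N] assms(1) that(1) unfolding leading_def by (meson leD subsetD)
    then show ?thesis by simp
  qed simp
  then have "(\<Sum>u\<in>S - {w}. c u * basis u w) = 0"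
    by (intro sum.neutral) blast
  then have "(\<Sum>u\<in>S. c u * basis u w) = c w * basis w w"
    using fin w by (subst sum.remove[of _ w]) auto
  moreover have "(\<Sum>u\<in>S. c u * basis u w) = 0"
    using assms(2) by (metis sum_scl_apply zero_fun_apply)
  ultimately show False
    using w basis(2)[of w g N] assms(1) by (auto simp: leading_def)
qed

section \<open>Decomposables and the action of the two derivations\<close>

text \<open>For \<open>g \<noteq> 0\<close> this is the span of the products of fields of nonzero
  degree, one inclusion being \<open>shp_decomposable\<close>. In this form the Lyndon words
  evidently index a basis of the quotient, the indecomposables.\<close>

definition decomposable :: "('c \<Rightarrow>\<^sub>0 nat) \<Rightarrow> int \<Rightarrow> ((int \<times> 'c) list \<Rightarrow> rat) set" where
  "decomposable g N = {F. \<exists>c. F = (\<Sum>w\<in>{w \<in> adm g N. \<not> lyndon w}. scl (c w) (basis w))}"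

lemma decomposable_0 [simp]: "0 \<in> decomposable g N"
  unfolding decomposable_def by (auto intro!: exI[of _ "\<lambda>_. 0"])

lemma decomposable_add:
  assumes "F \<in> decomposable g N" "G \<in> decomposable g N"
  shows "F + G \<in> decomposable g N"
proof -
  obtain c d where "F = (\<Sum>w\<in>{w \<in> adm g N. \<not> lyndon w}. scl (c w) (basis w))"
    "G = (\<Sum>w\<in>{w \<in> adm g N. \<not> lyndon w}. scl (d w) (basis w))"
    using assms unfolding decomposable_def by blast
  then have "F + G = (\<Sum>w\<in>{w \<in> adm g N. \<not> lyndon w}. scl (c w + d w) (basis w))"
    by (simp only: sum.distrib[symmetric]) (auto intro!: sum.cong simp: scl_def algebra_simps)
  then show ?thesis unfolding decomposable_def by (intro CollectI exI)
qed

lemma scl_sum: "scl r (\<Sum>i\<in>A. F i) = (\<Sum>i\<in>A. scl r (F i))"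
  by (induction A rule: infinite_finite_induct)
    (simp_all only: sum.infinite sum.empty sum.insert not_False_eq_True scl_simps)

lemma decomposable_scl: "F \<in> decomposable g N \<Longrightarrow> scl r F \<in> decomposable g N"
proof -
  assume "F \<in> decomposable g N"
  then obtain c where "F = (\<Sum>w\<in>{w \<in> adm g N. \<not> lyndon w}. scl (c w) (basis w))"
    unfolding decomposable_def by blast
  then have "scl r F = (\<Sum>w\<in>{w \<in> adm g N. \<not> lyndon w}. scl (r * c w) (basis w))"
    by (simp add: scl_sum)
  then show ?thesis unfolding decomposable_def by (intro CollectI exI)
qed

lemma decomposable_sum:
  "finite A \<Longrightarrow> (\<And>i. i \<in> A \<Longrightarrow> F i \<in> decomposable g N) \<Longrightarrow> (\<Sum>i\<in>A. F i) \<in> decomposable g N"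
  by (induction A rule: finite_induct) (auto intro: decomposable_add)

lemma basis_decomposable: "w \<in> adm g N \<Longrightarrow> \<not> lyndon w \<Longrightarrow> basis w \<in> decomposable g N"
  unfolding decomposable_def using finite_adm[of g N]
  by (intro CollectI exI[of _ "\<lambda>v. if v = w then 1 else 0"])
    (simp add: sum.remove[of _ w] sum.neutral)

lemma shp_sum_left: "shp (\<Sum>i\<in>A. F i) G = (\<Sum>i\<in>A. shp (F i) G)"
  by (induction A rule: infinite_finite_induct)
    (simp_all only: sum.infinite sum.empty sum.insert not_False_eq_True shp_0_left shp_add_left)

lemma shp_sum_right: "shp G (\<Sum>i\<in>A. F i) = (\<Sum>i\<in>A. shp G (F i))"
  by (induction A rule: infinite_finite_induct)
    (simp_all only: sum.infinite sum.empty sum.insert not_False_eq_True shp_0_right shp_add_right)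

text \<open>A product of two basis elements is the basis element of a word with at least two Lyndon
  factors.\<close>

lemma shp_decomposable:
  assumes "F \<in> fields g N" "G \<in> fields h M" "g \<noteq> 0" "h \<noteq> 0"
  shows "shp F G \<in> decomposable (g + h) (N + M)"
proof -
  obtain c d where F: "F = (\<Sum>w\<in>adm g N. scl (c w) (basis w))"
    and G: "G = (\<Sum>w\<in>adm h M. scl (d w) (basis w))"
    using basis_span[OF assms(1)] basis_span[OF assms(2)] by blast
  have "shp (basis u) (basis v) \<in> decomposable (g + h) (N + M)"
    if u: "u \<in> adm g N" and v: "v \<in> adm h M" for u v
  proof -
    have ne: "u \<noteq> []" "v \<noteq> []" using u v assms(3,4) by (auto simp: adm_def)
    have "\<not> lyndon (max_shuffle u v)"
    proof
      assume "lyndon (max_shuffle u v)"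
      then have "size (mset (lyndon_factors (max_shuffle u v))) = 1"
        by (simp add: lyndon_factors_lyndon)
      then have "length (lyndon_factors u) + length (lyndon_factors v) = 1"
        by (simp only: mset_lyndon_factors_max_shuffle size_union size_mset)
      moreover have "length (lyndon_factors u) > 0" "length (lyndon_factors v) > 0"
        using ne by simp_all
      ultimately show False by linarith
    qed
    then show ?thesis
      unfolding shp_basis using adm_max_shuffle[OF u v] by (rule basis_decomposable[rotated])
  qed
  then show ?thesis
    unfolding F G shp_sum_left shp_sum_right shp_scl_left shp_scl_right
    by (intro decomposable_sum decomposable_scl finite_adm)
qed

text \<open>After one Lyndon factor is split off, the Leibniz rule gives two products whose factors
  still have nonzero degree.\<close>

lemma decomposable_derivation:
  assumes F: "F \<in> decomposable g N" and "g \<noteq> 0"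
    and add: "\<And>F G. E (F + G) = E F + E G" and scl: "\<And>r F. E (scl r F) = scl r (E F)"
    and der: "\<And>F G. E (shp F G) = shp (E F) G + shp F (E G)"
    and fields: "\<And>F g N. F \<in> fields g N \<Longrightarrow> E F \<in> fields g (N + d)"
  shows "E F \<in> decomposable g (N + d)"
proof -
  have basis: "E (basis w) \<in> decomposable g (N + d)" if w: "w \<in> adm g N" "\<not> lyndon w" for w
  proof -
    have "w \<noteq> []" using w assms(2) by (auto simp: adm_def)
    then obtain l ls where ls: "lyndon_factors w = l # ls" by (cases "lyndon_factors w") auto
    have seq: "lyndon_seq (l # ls)" by (metis ls lyndon_seq_lyndon_factors)
    have conc: "w = l @ concat ls" using concat_lyndon_factors[of w] ls by simp
    have "ls \<noteq> []" using w(2) seq conc by (auto simp: lyndon_seq_Cons)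
    moreover have "\<forall>k\<in>set (l # ls). k \<noteq> []"
      using seq lyndon_neq_Nil unfolding lyndon_seq_def by blast
    ultimately have "l \<noteq> []" "concat ls \<noteq> []"
      by (metis list.set_intros(1), metis concat_eq_Nil_conv list.set_intros last_in_set)
    then have ne: "colours l \<noteq> 0" "colours (concat ls) \<noteq> 0"
      by simp_all
    have adm: "\<forall>k\<in>set (l # ls). admissible k"
      using w(1) admissible_iff_factors[of w] ls by (auto simp: adm_def)
    have 1: "generator l \<in> fields (colours l) (weight l)" using generator adm by simp
    have 2: "monomial (mset ls) \<in> fields (colours (concat ls)) (weight (concat ls))"
      using monomial_lyndon_seq[of ls] seq adm by (simp add: lyndon_seq_Cons)
    have gN: "g = colours l + colours (concat ls)" "N = weight l + weight (concat ls)"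
      using w(1) conc by (auto simp: adm_def)
    have "shp (E (generator l)) (monomial (mset ls)) \<in> decomposable g (N + d)"
      "shp (generator l) (E (monomial (mset ls))) \<in> decomposable g (N + d)"
      using shp_decomposable[OF fields[OF 1] 2 ne] shp_decomposable[OF 1 fields[OF 2] ne]
      by (simp_all add: gN ac_simps)
    then show ?thesis
      using der[of "generator l" "monomial (mset ls)"]
      by (simp add: basis_def ls decomposable_add)
  qed
  have E0: "E 0 = 0" using scl[of 0 0] by simp
  have sum: "E (\<Sum>i\<in>A. F i) = (\<Sum>i\<in>A. E (F i))" for A and F :: "(int \<times> 'c) list \<Rightarrow> _"
    by (induction A rule: infinite_finite_induct)
      (simp_all only: sum.infinite sum.empty sum.insert not_False_eq_True E0 add)
  obtain c where "F = (\<Sum>w\<in>{w \<in> adm g N. \<not> lyndon w}. scl (c w) (basis w))"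
    using F unfolding decomposable_def by blast
  then have "E F = (\<Sum>w\<in>{w \<in> adm g N. \<not> lyndon w}. scl (c w) (E (basis w)))"
    by (simp only: sum scl)
  then show ?thesis
    using basis finite_adm[of g N] by (auto intro!: decomposable_sum decomposable_scl)
qed

lemma raise_decomposable: "F \<in> decomposable g N \<Longrightarrow> g \<noteq> 0 \<Longrightarrow> raise F \<in> decomposable g (N - 1)"
  using decomposable_derivation[of F g N raise "- 1", OF _ _ raise_add raise_scl raise_shp] fields_raise
  by simp

lemma lower_decomposable: "F \<in> decomposable g N \<Longrightarrow> g \<noteq> 0 \<Longrightarrow> lower F \<in> decomposable g (N + 1)"
  using decomposable_derivation[of F g N lower 1, OF _ _ lower_add lower_scl lower_shp] fields_lower
  by simp

lemma lower_raise_fields: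
  assumes "F \<in> fields g N"
  shows "lower (raise F) = raise (lower F) + scl (of_nat (deg g)) F"
proof
  fix w
  have "of_nat (length w) * F w = of_nat (deg g) * F w"
    using assms deg_colours[of w] by (cases "F w = 0") (auto simp: fields_def)
  then show "lower (raise F) w = (raise (lower F) + scl (of_nat (deg g)) F) w"
    by (simp add: lower_raise scl_apply)
qed

lemma lower_power_fields: "F \<in> fields g N \<Longrightarrow> (lower ^^ j) F \<in> fields g (N + int j)"
  by (induction j) (auto dest: fields_lower simp: algebra_simps)

text \<open>The Weyl algebra formula for the commutator of a power of \<open>lower\<close> with
  \<open>raise\<close>, given that \<open>lower\<close> and \<open>raise\<close> commute up to the
  scalar \<open>deg g\<close>.\<close>

lemma lower_power_raise:
  assumes "F \<in> fields g N"
  shows "(lower ^^ Suc j) (raise F) =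
    raise ((lower ^^ Suc j) F) + scl (of_nat (Suc j) * of_nat (deg g)) ((lower ^^ j) F)"
proof (induction j)
  case 0
  then show ?case using lower_raise_fields[OF assms] by simp
next
  case (Suc j)
  let ?G = "(lower ^^ Suc j) F"
  have "(lower ^^ Suc (Suc j)) (raise F) = lower ((lower ^^ Suc j) (raise F))" by simp
  also have "\<dots> = lower (raise ?G) + scl (of_nat (Suc j) * of_nat (deg g)) (lower ((lower ^^ j) F))"
    unfolding Suc lower_add lower_scl ..
  also have "lower (raise ?G) = raise (lower ?G) + scl (of_nat (deg g)) ?G"
    by (rule lower_raise_fields[OF lower_power_fields[OF assms]])
  finally show ?case
    by (auto simp: scl_def algebra_simps)
qed

text \<open>\<open>lower\<close> and \<open>raise\<close> generate an action of the Weyl algebra on the indecomposables, and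
  \<open>lower\<close> acts locally nilpotently.\<close>

lemma raise_inj_mod_decomposable:
  assumes F: "F \<in> fields g N" and "g \<noteq> 0" and raise: "raise F \<in> decomposable g (N - 1)"
  shows "F \<in> decomposable g N"
proof -
  let ?P = "\<lambda>j. (lower ^^ j) F \<in> decomposable g (N + int j)"
  \<comment> \<open>\<open>lower\<close> increases the weight by 1, and beyond the bound of
    \<open>adm_empty\<close> there is no leading word left, so the \<open>J\<close>-th power kills
    \<open>F\<close>.\<close>
  define J where "J = nat (int (quad g) - int (lin b g) - N + 1)"
  have "adm g (N + int J) = {}" by (rule adm_empty) (simp add: J_def)
  then have "(lower ^^ J) F = 0"
    using fields_leading_ex[OF lower_power_fields[OF F, of J]] by blast
  then have "?P J" by simp
  \<comment> \<open>If the least \<open>j\<close> were \<open>Suc i\<close>, both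
    \<open>raise\<close> of the \<open>j\<close>-th power and the \<open>j\<close>-th power applied
    to \<open>raise F\<close> would be decomposable. By \<open>lower_power_raise\<close> so would be
    a nonzero multiple of the \<open>i\<close>-th power, against minimality.\<close>
  define j where "j = (LEAST j. ?P j)"
  have j: "?P j" unfolding j_def using \<open>?P J\<close> by (rule LeastI)
  have "j = 0"
  proof (rule ccontr)
    assume "j \<noteq> 0"
    then obtain i where i: "j = Suc i" by (cases j) auto
    have "\<not> ?P i" using not_less_Least[of i ?P] i by (simp add: j_def)
    have low: "(lower ^^ m) (raise F) \<in> decomposable g (N - 1 + int m)" for m
      by (induction m) (use raise assms(2) in \<open>auto dest: lower_decomposable simp: algebra_simps\<close>)
    have "raise ((lower ^^ Suc i) F) \<in> decomposable g (N + int i)"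
      using raise_decomposable[OF j assms(2)] i by simp
    moreover have "(lower ^^ Suc i) (raise F) \<in> decomposable g (N + int i)"
      using low[of "Suc i"] by simp
    moreover define r :: rat where "r = of_nat (Suc i) * of_nat (deg g)"
    ultimately have "scl r ((lower ^^ i) F) \<in> decomposable g (N + int i)"
      using lower_power_raise[OF F, of i]
        decomposable_add[of "(lower ^^ Suc i) (raise F)" g "N + int i" "scl (- 1) (raise ((lower ^^ Suc i) F))"]
        decomposable_scl[of "raise ((lower ^^ Suc i) F)" g "N + int i" "- 1"]
      by (auto simp: scl_def plus_fun_def)
    then have "scl (1 / r) (scl r ((lower ^^ i) F)) \<in> decomposable g (N + int i)"
      by (rule decomposable_scl)
    moreover have "deg g \<noteq> 0" using assms(2) deg_eq_0_iff by blast
    then have "r \<noteq> 0" unfolding r_def mult_eq_0_iff of_nat_eq_0_iff by simp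
    ultimately show False using \<open>\<not> ?P i\<close> by simp
  qed
  then show ?thesis using j by simp
qed

definition lyndon_adm :: "('c \<Rightarrow>\<^sub>0 nat) \<Rightarrow> int \<Rightarrow> (int \<times> 'c) list set" where
  "lyndon_adm g N = {w \<in> adm g N. lyndon w}"

lemma finite_lyndon_adm: "finite (lyndon_adm g N)"
  using finite_adm[of g N] by (simp add: lyndon_adm_def)

lemma card_lyndon_adm_mono:
  assumes "g \<noteq> 0"
  shows "card (lyndon_adm g N) \<le> card (lyndon_adm g (N - 1))"
proof (rule ccontr)
  let ?A = "lyndon_adm g N" and ?B = "lyndon_adm g (N - 1)"
  let ?D = "{w \<in> adm g (N - 1). \<not> lyndon w}"
  assume "\<not> ?thesis"
  then have less: "card ?B < card ?A" by simp
  have split: "adm g (N - 1) = ?B \<union> ?D" by (auto simp: lyndon_adm_def)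
  have "\<exists>c. raise (basis l) = (\<Sum>w\<in>adm g (N - 1). scl (c w) (basis w))" if "l \<in> ?A" for l
    using that by (intro basis_span fields_raise basis) (simp add: lyndon_adm_def)
  then obtain t where t: "\<And>l. l \<in> ?A \<Longrightarrow> raise (basis l) = (\<Sum>w\<in>adm g (N - 1). scl (t l w) (basis w))"
    by metis
  \<comment> \<open>With more Lyndon words in weight \<open>N\<close> than in weight
    \<open>N - 1\<close>, some nontrivial combination of their basis elements has an image under
    \<open>raise\<close> without Lyndon components, that is, a decomposable one.\<close>
  obtain c where c: "\<exists>l\<in>?A. c l \<noteq> 0" "\<forall>w\<in>?B. (\<Sum>l\<in>?A. c l * t l w) = 0"
    using homogeneous_system_nontrivial[OF finite_lyndon_adm finite_lyndon_adm less] by blast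
  define F where "F = (\<Sum>l\<in>?A. scl (c l) (basis l))"
  have F: "F \<in> fields g N"
    unfolding F_def using finite_lyndon_adm by (intro fields_sum basis) (auto simp: lyndon_adm_def)
  have raise_sum: "raise (\<Sum>i\<in>A. G i) = (\<Sum>i\<in>A. raise (G i))" for A and G :: "(int \<times> 'c) list \<Rightarrow> _"
    by (induction A rule: infinite_finite_induct)
      (simp_all only: sum.infinite sum.empty sum.insert not_False_eq_True raise_0 raise_add)
  have "raise F = (\<Sum>w\<in>?D. scl (\<Sum>l\<in>?A. c l * t l w) (basis w))"
  proof
    fix v
    have "raise F v = (\<Sum>l\<in>?A. c l * raise (basis l) v)"
      unfolding F_def raise_sum raise_scl by (rule sum_scl_apply)
    also have "\<dots> = (\<Sum>l\<in>?A. \<Sum>w\<in>adm g (N - 1). c l * t l w * basis w v)"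
      by (intro sum.cong refl) (simp only: t sum_scl_apply sum_distrib_left mult.assoc)
    also have "\<dots> = (\<Sum>w\<in>adm g (N - 1). (\<Sum>l\<in>?A. c l * t l w) * basis w v)"
      by (subst sum.swap) (simp only: sum_distrib_right)
    also have "\<dots> = (\<Sum>w\<in>?D. (\<Sum>l\<in>?A. c l * t l w) * basis w v)"
      using c(2) finite_adm by (intro sum.mono_neutral_right) (auto simp: lyndon_adm_def)
    finally show "raise F v = (\<Sum>w\<in>?D. scl (\<Sum>l\<in>?A. c l * t l w) (basis w)) v"
      by (simp only: sum_scl_apply)
  qed
  then have "raise F \<in> decomposable g (N - 1)" unfolding decomposable_def by (intro CollectI exI)
  then have "F \<in> decomposable g N" using raise_inj_mod_decomposable F assms by blast
  then obtain d where d: "F = (\<Sum>w\<in>{w \<in> adm g N. \<not> lyndon w}. scl (d w) (basis w))"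
    unfolding decomposable_def by blast
  define e where "e w = (if lyndon w then c w else - d w)" for w
  have "(\<Sum>w\<in>adm g N. scl (e w) (basis w)) = 0"
  proof
    fix v
    have "adm g N = ?A \<union> {w \<in> adm g N. \<not> lyndon w}" by (auto simp: lyndon_adm_def)
    then have "(\<Sum>w\<in>adm g N. e w * basis w v) =
        (\<Sum>w\<in>?A. e w * basis w v) + (\<Sum>w\<in>{w \<in> adm g N. \<not> lyndon w}. e w * basis w v)"
      using sum.union_disjoint[of ?A "{w \<in> adm g N. \<not> lyndon w}" "\<lambda>w. e w * basis w v"]
        finite_adm[of g N] finite_lyndon_adm[of g N] by (simp add: lyndon_adm_def disjoint_iff)
    also have "(\<Sum>w\<in>?A. e w * basis w v) = F v"
      unfolding F_def sum_scl_apply by (rule sum.cong) (auto simp: e_def lyndon_adm_def)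
    also have "(\<Sum>w\<in>{w \<in> adm g N. \<not> lyndon w}. e w * basis w v) = - F v"
      by (subst d) (simp add: sum_scl_apply e_def sum_negf)
    finally show "(\<Sum>w\<in>adm g N. scl (e w) (basis w)) v = 0 v"
      by (simp only: sum_scl_apply) simp
  qed
  then have "e w = 0" if "w \<in> adm g N" for w using basis_independent[of "adm g N"] that by blast
  note zero = this
  obtain l where "l \<in> ?A" "c l \<noteq> 0" using c(1) by blast
  then show False using zero[of l] by (simp add: e_def lyndon_adm_def)
qed

end

unbundle fps_syntax

section \<open>Generating Laurent series of admissible words\<close>

definition tame :: "('i \<Rightarrow> int) \<Rightarrow> 'i set \<Rightarrow> bool" where
  "tame v A \<longleftrightarrow> (\<exists>B. \<forall>x\<in>A. B \<le> v x) \<and> (\<forall>n. finite {x \<in> A. v x = n})"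

text \<open>The formal sum of \<open>f x\<close> times \<open>X\<close> to the power
  \<open>v x\<close>, where \<open>X\<close> will stand for \<open>q^-1\<close>.\<close>

definition gen_series :: "('i \<Rightarrow> int) \<Rightarrow> ('i \<Rightarrow> rat) \<Rightarrow> 'i set \<Rightarrow> rat fls" where
  "gen_series v f A = Abs_fls (\<lambda>n. \<Sum>x\<in>{x \<in> A. v x = n}. f x)"

lemma gen_series_nth:
  assumes "tame v A"
  shows "gen_series v f A $$ n = (\<Sum>x\<in>{x \<in> A. v x = n}. f x)"
  unfolding gen_series_def
proof (rule nth_Abs_fls_ex_lower_bound)
  obtain B where "\<forall>x\<in>A. B \<le> v x" using assms by (auto simp: tame_def)
  then have "{x \<in> A. v x = n} = {}" if "n < B" for n using that by auto
  then show "\<exists>N. \<forall>n<N. (\<Sum>x\<in>{x \<in> A. v x = n}. f x) = 0" by (metis sum.empty)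
qed

lemma gen_series_eqI:
  assumes "\<And>n. (\<Sum>x\<in>{x \<in> A. v x = n}. f x) = (\<Sum>y\<in>{y \<in> B. u y = n}. g y)"
  shows "gen_series v f A = gen_series u g B"
  unfolding gen_series_def assms ..

lemma gen_series_cong:
  assumes "\<And>x. x \<in> A \<Longrightarrow> v x = u x" "\<And>x. x \<in> A \<Longrightarrow> f x = g x"
  shows "gen_series v f A = gen_series u g A"
  by (rule gen_series_eqI, rule sum.cong) (use assms in auto)

lemma fls_times_nth_bounds:
  fixes F G :: "rat fls"
  assumes "\<And>n. n < a \<Longrightarrow> F $$ n = 0" "\<And>n. n < b \<Longrightarrow> G $$ n = 0"
  shows "(F * G) $$ n = (\<Sum>i=a..n - b. F $$ i * G $$ (n - i))"
proof (cases "F = 0 \<or> G = 0")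
  case False
  then have "a \<le> fls_subdegree F" "b \<le> fls_subdegree G"
    using assms nth_fls_subdegree_nonzero by (meson not_less)+
  then have "(\<Sum>i=a..n - b. F $$ i * G $$ (n - i))
      = (\<Sum>i=fls_subdegree F..n - fls_subdegree G. F $$ i * G $$ (n - i))"
    by (intro sum.mono_neutral_right) (auto intro: fls_eq0_below_subdegree)
  then show ?thesis by (simp add: fls_times_nth(2))
qed auto

lemma
  assumes "tame v A" "tame u B"
  shows tame_times: "tame (\<lambda>p. v (fst p) + u (snd p)) (A \<times> B)"
    and gen_series_times: "gen_series v f A * gen_series u g B =
      gen_series (\<lambda>p. v (fst p) + u (snd p)) (\<lambda>p. f (fst p) * g (snd p)) (A \<times> B)"
proof -
  obtain a b where a: "\<And>x. x \<in> A \<Longrightarrow> a \<le> v x" and b: "\<And>y. y \<in> B \<Longrightarrow> b \<le> u y"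
    using assms unfolding tame_def by blast
  let ?X = "\<lambda>n. {x \<in> A. v x = n}" and ?Y = "\<lambda>n. {y \<in> B. u y = n}"
  let ?P = "\<lambda>n. {p \<in> A \<times> B. v (fst p) + u (snd p) = n}"
  have P: "?P n = (\<Union>i\<in>{a..n - b}. ?X i \<times> ?Y (n - i))" for n
    using a b by force
  have fin: "finite (?X n)" "finite (?Y n)" for n using assms by (auto simp: tame_def)
  show tame: "tame (\<lambda>p. v (fst p) + u (snd p)) (A \<times> B)"
    unfolding tame_def
  proof
    show "\<exists>c. \<forall>p\<in>A \<times> B. c \<le> v (fst p) + u (snd p)"
      using a b by (intro exI[of _ "a + b"]) (auto intro: add_mono)
    show "\<forall>n. finite (?P n)" unfolding P using fin by blast
  qed
  show "gen_series v f A * gen_series u g B =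
      gen_series (\<lambda>p. v (fst p) + u (snd p)) (\<lambda>p. f (fst p) * g (snd p)) (A \<times> B)"
  proof (rule fls_eqI)
    fix n
    have "gen_series v f A $$ i = 0" if "i < a" for i
      using that a by (subst gen_series_nth[OF assms(1)]) (force intro: sum.neutral)
    moreover have "gen_series u g B $$ i = 0" if "i < b" for i
      using that b by (subst gen_series_nth[OF assms(2)]) (force intro: sum.neutral)
    ultimately have "(gen_series v f A * gen_series u g B) $$ n =
        (\<Sum>i=a..n - b. gen_series v f A $$ i * gen_series u g B $$ (n - i))"
      by (rule fls_times_nth_bounds)
    also have "\<dots> = (\<Sum>i=a..n - b. \<Sum>p\<in>?X i \<times> ?Y (n - i). f (fst p) * g (snd p))"
      by (intro sum.cong refl)
        (simp add: gen_series_nth[OF assms(1)] gen_series_nth[OF assms(2)] sum_product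
          sum.cartesian_product case_prod_unfold)
    also have "\<dots> = (\<Sum>p\<in>?P n. f (fst p) * g (snd p))"
      unfolding P using fin by (intro sum.UNION_disjoint[symmetric]) auto
    finally show "(gen_series v f A * gen_series u g B) $$ n =
        gen_series (\<lambda>p. v (fst p) + u (snd p)) (\<lambda>p. f (fst p) * g (snd p)) (A \<times> B) $$ n"
      by (simp add: gen_series_nth[OF tame])
  qed
qed

lemma gen_series_reindex:
  assumes "bij_betw h A B"
  shows "gen_series u g B = gen_series (\<lambda>x. u (h x)) (\<lambda>x. g (h x)) A"
proof (rule gen_series_eqI)
  fix n
  have "bij_betw h {x \<in> A. u (h x) = n} {y \<in> B. u y = n}"
    using assms by (auto simp: bij_betw_def inj_on_def)
  then show "(\<Sum>y\<in>{y \<in> B. u y = n}. g y) = (\<Sum>x\<in>{x \<in> A. u (h x) = n}. g (h x))"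
    by (rule sum.reindex_bij_betw[symmetric])
qed

lemma gen_series_UN:
  assumes "finite I" "\<And>i. i \<in> I \<Longrightarrow> tame v (A i)"
    and "\<And>i j. i \<in> I \<Longrightarrow> j \<in> I \<Longrightarrow> i \<noteq> j \<Longrightarrow> A i \<inter> A j = {}"
  shows "tame v (\<Union>i\<in>I. A i)" (is ?t)
    and "(\<Sum>i\<in>I. gen_series v f (A i)) = gen_series v f (\<Union>i\<in>I. A i)"
proof -
  have eq: "{x \<in> \<Union>i\<in>I. A i. v x = n} = (\<Union>i\<in>I. {x \<in> A i. v x = n})" for n by auto
  have fin: "finite {x \<in> A i. v x = n}" if "i \<in> I" for i n
    using assms(2)[OF that] by (simp add: tame_def)
  have "\<forall>i\<in>I. \<exists>B. \<forall>x\<in>A i. B \<le> v x" using assms(2) by (auto simp: tame_def)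
  then obtain B where B: "\<And>i x. i \<in> I \<Longrightarrow> x \<in> A i \<Longrightarrow> B i \<le> v x" by metis
  have "Min (insert 0 (B ` I)) \<le> v x" if "x \<in> (\<Union>i\<in>I. A i)" for x
  proof -
    from that obtain i where i: "i \<in> I" "x \<in> A i" by blast
    have "Min (insert 0 (B ` I)) \<le> B i" using assms(1) i by (intro Min_le) auto
    then show ?thesis using B[OF i] by simp
  qed
  then show t: ?t using fin assms(1) unfolding tame_def eq by blast
  show "(\<Sum>i\<in>I. gen_series v f (A i)) = gen_series v f (\<Union>i\<in>I. A i)"
  proof (rule fls_eqI)
    fix n
    have "(\<Sum>i\<in>I. gen_series v f (A i)) $$ n = (\<Sum>i\<in>I. \<Sum>x\<in>{x \<in> A i. v x = n}. f x)"
      unfolding fls_nth_sum by (intro sum.cong refl gen_series_nth assms(2))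
    also have "\<dots> = (\<Sum>x\<in>(\<Union>i\<in>I. {x \<in> A i. v x = n}). f x)"
      using assms fin by (intro sum.UNION_disjoint[symmetric]) auto
    finally show "(\<Sum>i\<in>I. gen_series v f (A i)) $$ n = gen_series v f (\<Union>i\<in>I. A i) $$ n"
      by (simp only: gen_series_nth[OF t] eq)
  qed
qed

lemma gen_series_Sigma:
  assumes "tame v A" "\<And>x. x \<in> A \<Longrightarrow> finite (Y x)"
  shows "gen_series v (\<lambda>x. \<Sum>y\<in>Y x. g x y) A =
    gen_series (\<lambda>p. v (fst p)) (\<lambda>p. g (fst p) (snd p)) (Sigma A Y)"
proof (rule gen_series_eqI)
  fix n
  have "(\<Sum>x\<in>{x \<in> A. v x = n}. \<Sum>y\<in>Y x. g x y) =
      (\<Sum>p\<in>Sigma {x \<in> A. v x = n} Y. g (fst p) (snd p))"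
    using assms by (subst sum.Sigma) (auto simp: tame_def case_prod_unfold)
  also have "Sigma {x \<in> A. v x = n} Y = {p \<in> Sigma A Y. v (fst p) = n}" by auto
  finally show "(\<Sum>x\<in>{x \<in> A. v x = n}. \<Sum>y\<in>Y x. g x y) =
      (\<Sum>p\<in>{p \<in> Sigma A Y. v (fst p) = n}. g (fst p) (snd p))" .
qed

lemma tame_scale:
  assumes "tame v A" "j > 0"
  shows "tame (\<lambda>x. int j * v x) A"
  unfolding tame_def
proof (intro conjI allI)
  obtain B where "\<forall>x\<in>A. B \<le> v x" using assms by (auto simp: tame_def)
  then show "\<exists>B. \<forall>x\<in>A. B \<le> int j * v x"
    by (intro exI[of _ "int j * B"]) (auto intro: mult_left_mono)
  fix n
  have "{x \<in> A. int j * v x = n} \<subseteq> {x \<in> A. v x = n div int j}" using assms(2) by auto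
  then show "finite {x \<in> A. int j * v x = n}"
    using assms(1) finite_subset unfolding tame_def by blast
qed

lemma gen_series_compose_power:
  assumes "tame v A" "j > 0"
  shows "fls_compose_power (gen_series v f A) j = gen_series (\<lambda>x. int j * v x) f A"
proof (rule fls_eqI)
  fix n
  have "{x \<in> A. int j * v x = n} = (if int j dvd n then {x \<in> A. v x = n div int j} else {})"
    using assms(2) by auto
  then show "fls_compose_power (gen_series v f A) j $$ n = gen_series (\<lambda>x. int j * v x) f A $$ n"
    using assms by (simp add: fls_nth_compose_power gen_series_nth tame_scale)
qed

lemma gen_series_const:
  assumes "tame v A"
  shows "of_nat c * gen_series v f A = gen_series v (\<lambda>x. of_nat c * f x) A"
  by (rule fls_eqI) (simp add: gen_series_nth[OF assms] sum_distrib_left fls_of_nat)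

section \<open>Multiples of exponent vectors and Lyndon words under letterwise maps\<close>

definition pscale :: "nat \<Rightarrow> ('c \<Rightarrow>\<^sub>0 nat) \<Rightarrow> 'c \<Rightarrow>\<^sub>0 nat" where
  "pscale n g = Poly_Mapping.map ((*) n) g"

lemma lookup_pscale [simp]: "Poly_Mapping.lookup (pscale n g) c = n * Poly_Mapping.lookup g c"
  by (simp add: pscale_def Poly_Mapping.map.rep_eq when_def)

lemma pscale_simps [simp]: "pscale 0 g = 0" "pscale (Suc n) g = g + pscale n g" "pscale n 0 = 0"
  by (auto intro!: poly_mapping_eqI simp: lookup_add)

lemma pscale_1: "pscale 1 g = g"
  by (auto intro!: poly_mapping_eqI)

lemma pscale_pscale: "pscale n (pscale m g) = pscale (n * m) g"
  by (auto intro!: poly_mapping_eqI simp: mult.assoc)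

lemma lin_pscale [simp]: "lin f (pscale n g) = n * lin f g"
  by (induction n) simp_all

lemma pscale_inj: "n > 0 \<Longrightarrow> pscale n g = pscale n h \<Longrightarrow> g = h"
  by (rule poly_mapping_eqI) (metis lookup_pscale mult_left_cancel not_gr_zero)

lemma pscale_eq_0_iff [simp]: "pscale n g = 0 \<longleftrightarrow> n = 0 \<or> g = 0"
  by (metis deg_eq_0_iff lin_pscale mult_eq_0_iff)

text \<open>The index set of plethystic sums: the \<open>n\<close>-th Adams operation takes the
  exponent vector \<open>h\<close> to \<open>g\<close>.\<close>

definition quotients :: "('c \<Rightarrow>\<^sub>0 nat) \<Rightarrow> (nat \<times> ('c \<Rightarrow>\<^sub>0 nat)) set" where
  "quotients g = {(n, h). 1 \<le> n \<and> pscale n h = g}"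

lemma finite_quotients: "g \<noteq> 0 \<Longrightarrow> finite (quotients g)"
proof -
  assume g: "g \<noteq> 0"
  have "n \<le> deg g" if "(n, h) \<in> quotients g" for n h
  proof -
    have "deg g = n * deg h" "h \<noteq> 0" using that g by (auto simp: quotients_def)
    moreover have "deg h \<noteq> 0" using \<open>h \<noteq> 0\<close> deg_eq_0_iff by blast
    ultimately show ?thesis by simp
  qed
  then have "fst ` quotients g \<subseteq> {..deg g}" by auto
  moreover have "inj_on fst (quotients g)"
    by (rule inj_onI) (auto simp: quotients_def, metis pscale_inj Suc_le_lessD)
  ultimately show ?thesis by (meson finite_atMost finite_imageD finite_subset)
qed

text \<open>A sum over an infinite set is 0 by convention, so this removes the terms of degree 0
  from the recursions below.\<close>

lemma infinite_quotients_0: "infinite (quotients (0 :: 'c \<Rightarrow>\<^sub>0 nat))"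
proof
  assume "finite (quotients (0 :: 'c \<Rightarrow>\<^sub>0 nat))"
  then have "finite (fst ` quotients (0 :: 'c \<Rightarrow>\<^sub>0 nat))" by simp
  moreover have "{1..} \<subseteq> fst ` quotients (0 :: 'c \<Rightarrow>\<^sub>0 nat)"
    by (force simp: quotients_def image_iff)
  ultimately show False using finite_subset infinite_Ici by blast
qed

lemma map_less_map_iff:
  fixes f :: "'a::linorder \<Rightarrow> 'b::linorder"
  assumes "strict_mono f"
  shows "map f u < map f v \<longleftrightarrow> u < v"
proof (induction u arbitrary: v)
  case Nil
  then show ?case by (cases v) auto
next
  case (Cons x u)
  then show ?case using assms by (cases v) (auto simp: strict_mono_less strict_mono_eq)
qed

lemma lyndon_map:
  assumes "strict_mono f" "lyndon w"
  shows "lyndon (map f w)"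
  unfolding lyndon_def
proof (intro conjI allI impI)
  show "map f w \<noteq> []" using lyndon_neq_Nil[OF assms(2)] by simp
  fix u v assume "map f w = u @ v \<and> u \<noteq> [] \<and> v \<noteq> []"
  then obtain u' v' where "w = u' @ v'" "u = map f u'" "v = map f v'" "u' \<noteq> []" "v' \<noteq> []"
    by (auto simp: map_eq_append_conv)
  moreover from this have "w < v'" using assms(2) unfolding lyndon_def by blast
  ultimately show "map f w < v" by (simp only: map_less_map_iff[OF assms(1)])
qed

lemma colours_mset_concat_add:
  "colours (mset_concat (A + B)) = colours (mset_concat A) + colours (mset_concat B)"
  "weight (mset_concat (A + B)) = weight (mset_concat A) + weight (mset_concat B)"
proof -
  have "mset (mset_concat (A + B)) = mset (mset_concat A @ mset_concat B)"
    using mset_shuffles[OF mset_concat_in_shuffles[of A B]] by simp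
  from colours_mset_cong[OF this] weight_mset_cong[OF this]
  show "colours (mset_concat (A + B)) = colours (mset_concat A) + colours (mset_concat B)"
    "weight (mset_concat (A + B)) = weight (mset_concat A) + weight (mset_concat B)" by simp_all
qed

lemma colours_mset_concat_replicate:
  "colours (mset_concat (replicate_mset j l)) = pscale j (colours l)"
  "weight (mset_concat (replicate_mset j l)) = int j * weight l"
proof (induction j)
  case (Suc j)
  have "replicate_mset (Suc j) l = {#l#} + replicate_mset j l" by simp
  then show "colours (mset_concat (replicate_mset (Suc j) l)) = pscale (Suc j) (colours l)"
    "weight (mset_concat (replicate_mset (Suc j) l)) = int (Suc j) * weight l"
    using Suc by (simp_all only: colours_mset_concat_add mset_concat_single) (simp_all add: algebra_simps)
qed simp_all

context colour_form
begin

definition words :: "('c \<Rightarrow>\<^sub>0 nat) \<Rightarrow> (int \<times> 'c) list set" where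
  "words g = {w. admissible w \<and> colours w = g}"

definition lyndon_words :: "('c \<Rightarrow>\<^sub>0 nat) \<Rightarrow> (int \<times> 'c) list set" where
  "lyndon_words g = {w \<in> words g. lyndon w}"

text \<open>The exponent of \<open>q\<^sup>-\<^sup>1\<close> attached to a word.\<close>

definition val :: "(int \<times> 'c) list \<Rightarrow> int" where
  "val w = - weight w - int (lin b (colours w))"

lemma words_val: "{w \<in> words g. val w = n} = adm g (- n - int (lin b g))"
  by (auto simp: words_def val_def adm_def)

lemma lyndon_words_val: "{w \<in> lyndon_words g. val w = n} = lyndon_adm g (- n - int (lin b g))"
  by (auto simp: lyndon_words_def words_def val_def adm_def lyndon_adm_def)

lemma tame_words: "tame val (words g)"
  unfolding tame_def
proof (intro conjI allI exI ballI)
  fix w assume "w \<in> words g"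
  then have "w \<in> adm g (weight w)" by (simp add: words_def adm_def)
  then show "- int (quad g) \<le> val w"
    using adm_empty[of g "weight w"] \<open>w \<in> words g\<close> by (force simp: val_def words_def)
next
  show "finite {w \<in> words g. val w = n}" for n unfolding words_val by (rule finite_adm)
qed

lemma tame_lyndon_words: "tame val (lyndon_words g)"
  unfolding tame_def
proof
  show "\<exists>B. \<forall>w\<in>lyndon_words g. B \<le> val w"
    using tame_words[of g] unfolding tame_def lyndon_words_def by blast
  show "\<forall>n. finite {w \<in> lyndon_words g. val w = n}"
    unfolding lyndon_words_val using finite_lyndon_adm by blast
qed

definition word_series :: "('c \<Rightarrow>\<^sub>0 nat) \<Rightarrow> rat fls" where
  "word_series g = gen_series val (\<lambda>_. 1) (words g)"

definition lyndon_series :: "('c \<Rightarrow>\<^sub>0 nat) \<Rightarrow> rat fls" where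
  "lyndon_series g = gen_series val (\<lambda>_. 1) (lyndon_words g)"

lemma word_series_nth: "word_series g $$ n = of_nat (card (adm g (- n - int (lin b g))))"
  by (simp add: word_series_def gen_series_nth[OF tame_words] words_val)

lemma lyndon_series_nth: "lyndon_series g $$ n = of_nat (card (lyndon_adm g (- n - int (lin b g))))"
  by (simp add: lyndon_series_def gen_series_nth[OF tame_lyndon_words] lyndon_words_val)

text \<open>A pair \<open>(l, j)\<close> stands for \<open>j\<close> copies of a Lyndon factor
  \<open>l\<close>; weighted by \<open>length l\<close>, these are the terms in the logarithmic
  derivative of \<open>Exp\<close>.\<close>

definition lyndon_powers :: "('c \<Rightarrow>\<^sub>0 nat) \<Rightarrow> ((int \<times> 'c) list \<times> nat) set" where
  "lyndon_powers e = {(l, j). lyndon l \<and> admissible l \<and> 1 \<le> j \<and> pscale j (colours l) = e}"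

lemma lyndon_powers_UN:
  "lyndon_powers e = (\<Union>p\<in>quotients e. (\<lambda>l. (l, fst p)) ` lyndon_words (snd p))"
  by (auto simp: lyndon_powers_def quotients_def lyndon_words_def words_def)

lemma lyndon_powers_series:
  assumes "e \<noteq> 0"
  shows "tame (\<lambda>p. int (snd p) * val (fst p)) (lyndon_powers e)"
    and "gen_series (\<lambda>p. int (snd p) * val (fst p)) (\<lambda>p. of_nat (length (fst p))) (lyndon_powers e) =
      (\<Sum>(j, h)\<in>quotients e. of_nat (deg h) * fls_compose_power (lyndon_series h) j)"
proof -
  let ?v = "\<lambda>p. int (snd p) * val (fst p)" and ?f = "\<lambda>p. of_nat (length (fst p)) :: rat"
  let ?A = "\<lambda>p. (\<lambda>l. (l, fst p)) ` lyndon_words (snd p)"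
  have bij: "bij_betw (\<lambda>l. (l, fst p)) (lyndon_words (snd p)) (?A p)" for p :: "nat \<times> ('c \<Rightarrow>\<^sub>0 nat)"
    by (rule bij_betw_imageI) (auto simp: inj_on_def)
  have tame: "tame ?v (?A p)" if "p \<in> quotients e" for p
  proof -
    have sc: "tame (\<lambda>l. int (fst p) * val l) (lyndon_words (snd p))"
      using that by (intro tame_scale tame_lyndon_words) (auto simp: quotients_def)
    have "{x \<in> ?A p. ?v x = n} = (\<lambda>l. (l, fst p)) ` {l \<in> lyndon_words (snd p). int (fst p) * val l = n}" for n
      by auto
    then show ?thesis using sc by (auto simp: tame_def)
  qed
  have disj: "?A p \<inter> ?A p' = {}" if "p \<in> quotients e" "p' \<in> quotients e" "p \<noteq> p'" for p p'
    using that by (auto simp: lyndon_words_def words_def quotients_def)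
  note UN = gen_series_UN[OF finite_quotients[OF assms] tame disj]
  show "tame ?v (lyndon_powers e)" unfolding lyndon_powers_UN by (rule UN(1))
  have "of_nat (deg (snd p)) * fls_compose_power (lyndon_series (snd p)) (fst p) = gen_series ?v ?f (?A p)"
    if "p \<in> quotients e" for p
  proof -
    have j: "fst p > 0" using that by (auto simp: quotients_def)
    have "gen_series ?v ?f (?A p) = gen_series (\<lambda>l. int (fst p) * val l) (\<lambda>l. of_nat (length l)) (lyndon_words (snd p))"
      using gen_series_reindex[OF bij, of ?v ?f p] by simp
    also have "\<dots> = gen_series (\<lambda>l. int (fst p) * val l) (\<lambda>l. of_nat (deg (snd p)) * 1) (lyndon_words (snd p))"
      by (rule gen_series_cong) (auto simp: lyndon_words_def words_def simp flip: deg_colours)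
    also have "\<dots> = of_nat (deg (snd p)) * fls_compose_power (lyndon_series (snd p)) (fst p)"
      unfolding lyndon_series_def
      by (subst gen_series_compose_power[OF tame_lyndon_words j],
          subst gen_series_const[OF tame_scale[OF tame_lyndon_words j]]) simp
    finally show ?thesis ..
  qed
  note eq = this
  have "gen_series ?v ?f (lyndon_powers e) = (\<Sum>p\<in>quotients e. gen_series ?v ?f (?A p))"
    unfolding lyndon_powers_UN by (rule UN(2)[symmetric])
  also have "\<dots> = (\<Sum>p\<in>quotients e. of_nat (deg (snd p)) * fls_compose_power (lyndon_series (snd p)) (fst p))"
    by (intro sum.cong refl eq[symmetric])
  finally show "gen_series ?v ?f (lyndon_powers e) =
      (\<Sum>(j, h)\<in>quotients e. of_nat (deg h) * fls_compose_power (lyndon_series h) j)"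
    by (simp only: case_prod_unfold)
qed

lemma words_props:
  "w \<in> words g \<Longrightarrow> \<forall>l\<in>#mset (lyndon_factors w). lyndon l \<and> admissible l"
  using admissible_iff_factors[of w] lyndon_factors_lyndon_elem by (auto simp: words_def)

lemma admissible_mset_concat:
  "\<forall>l\<in>#M. lyndon l \<and> admissible l \<Longrightarrow> admissible (mset_concat M)"
  using admissible_iff_factors[of "mset_concat M"] lyndon_factors_mset_concat[of M]
  by (metis set_mset_mset)

text \<open>Counting pairs of a word and one of its Lyndon factors, with multiplicity, in two ways.\<close>

lemma word_series_recursion:
  "of_nat (deg g) * word_series g =
   (\<Sum>(e, u) | e + u = g.
     (\<Sum>(j, h)\<in>quotients e. of_nat (deg h) * fls_compose_power (lyndon_series h) j) * word_series u)"
proof -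
  \<comment> \<open>Each Lyndon factor \<open>l\<close> is paired with every \<open>j\<close> up to
    its multiplicity, so that the lengths \<open>length l\<close> add up to
    \<open>length w\<close>.\<close>
  let ?Y = "\<lambda>w. Sigma (set (lyndon_factors w)) (\<lambda>l. {1..count (mset (lyndon_factors w)) l})"
  let ?v = "\<lambda>p. int (snd p) * val (fst p)" and ?f = "\<lambda>p. of_nat (length (fst p)) :: rat"
  have "of_nat (deg g) * word_series g = gen_series val (\<lambda>w. of_nat (deg g) * 1) (words g)"
    unfolding word_series_def by (rule gen_series_const[OF tame_words])
  also have "\<dots> = gen_series val (\<lambda>w. \<Sum>p\<in>?Y w. ?f p) (words g)"
  proof (rule gen_series_cong)
    fix w assume w: "w \<in> words g"
    have "(\<Sum>p\<in>?Y w. ?f p) = (\<Sum>l\<in>set (lyndon_factors w). \<Sum>j\<in>{1..count (mset (lyndon_factors w)) l}. of_nat (length l))"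
      by (subst sum.Sigma) (auto simp: case_prod_unfold)
    also have "\<dots> = of_nat (\<Sum>l\<in>set (lyndon_factors w). count (mset (lyndon_factors w)) l * length l)"
      by simp
    also have "(\<Sum>l\<in>set (lyndon_factors w). count (mset (lyndon_factors w)) l * length l)
        = (\<Sum>l\<leftarrow>lyndon_factors w. length l)"
      by (simp add: sum_list_map_eq_sum_count count_mset)
    also have "\<dots> = length w" by (metis concat_lyndon_factors length_concat)
    also have "\<dots> = deg g" using w deg_colours[of w] by (simp add: words_def)
    finally show "of_nat (deg g) * 1 = (\<Sum>p\<in>?Y w. ?f p)" by simp
  qed simp
  also have "\<dots> = gen_series (\<lambda>p. val (fst p)) (\<lambda>p. ?f (snd p)) (Sigma (words g) ?Y)"
    by (rule gen_series_Sigma[OF tame_words]) simp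
  finally have lhs: "of_nat (deg g) * word_series g =
    gen_series (\<lambda>p. val (fst p)) (\<lambda>p. ?f (snd p)) (Sigma (words g) ?Y)" .
  let ?I = "{p. fst p + snd p = g \<and> fst p \<noteq> (0 :: 'c \<Rightarrow>\<^sub>0 nat)}"
  let ?U = "\<lambda>p. lyndon_powers (fst p) \<times> words (snd p)"
  have fin: "finite ?I"
    by (rule finite_subset[OF _ finite_exponent_splits[of g]]) auto
  \<comment> \<open>The term with \<open>e = 0\<close> drops out, since its inner sum runs over the
    infinite set \<open>quotients 0\<close>.\<close>
  have "(\<Sum>(e, u) | e + u = g.
     (\<Sum>(j, h)\<in>quotients e. of_nat (deg h) * fls_compose_power (lyndon_series h) j) * word_series u)
    = (\<Sum>p\<in>?I. (\<Sum>(j, h)\<in>quotients (fst p). of_nat (deg h) * fls_compose_power (lyndon_series h) j)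
      * word_series (snd p))"
    unfolding case_prod_unfold using finite_exponent_splits[of g] infinite_quotients_0[where 'c = 'c]
    by (intro sum.mono_neutral_right) (auto simp: case_prod_unfold)
  also have "\<dots> = (\<Sum>p\<in>?I. gen_series (\<lambda>x. ?v (fst x) + val (snd x)) (\<lambda>x. ?f (fst x)) (?U p))"
  proof (rule sum.cong[OF refl])
    fix p assume "p \<in> ?I"
    then have e: "fst p \<noteq> 0" by simp
    show "(\<Sum>(j, h)\<in>quotients (fst p). of_nat (deg h) * fls_compose_power (lyndon_series h) j)
      * word_series (snd p) = gen_series (\<lambda>x. ?v (fst x) + val (snd x)) (\<lambda>x. ?f (fst x)) (?U p)"
      unfolding lyndon_powers_series(2)[OF e, symmetric] word_series_def
      by (subst gen_series_times[OF lyndon_powers_series(1)[OF e] tame_words]) simp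
  qed
  also have "\<dots> = gen_series (\<lambda>x. ?v (fst x) + val (snd x)) (\<lambda>x. ?f (fst x)) (\<Union>p\<in>?I. ?U p)"
  proof (rule gen_series_UN(2)[OF fin])
    show "tame (\<lambda>x. ?v (fst x) + val (snd x)) (?U p)" if "p \<in> ?I" for p
      using that by (intro tame_times lyndon_powers_series(1) tame_words) simp
    show "?U p \<inter> ?U p' = {}" if "p \<in> ?I" "p' \<in> ?I" "p \<noteq> p'" for p p'
      using that by (auto simp: lyndon_powers_def words_def prod_eq_iff)
  qed
  also have "\<dots> = gen_series (\<lambda>p. val (fst p)) (\<lambda>p. ?f (snd p)) (Sigma (words g) ?Y)"
  proof -
    \<comment> \<open>Removing \<open>j\<close> copies of \<open>l\<close> leaves an arbitrary
      admissible word of the complementary colours, which may still contain \<open>l\<close>; adding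
      them back is the inverse \<open>h'\<close>.\<close>
    define h where "h p = (snd p, mset_concat (mset (lyndon_factors (fst p)) - replicate_mset (snd (snd p)) (fst (snd p))))"
      for p :: "(int \<times> 'c) list \<times> (int \<times> 'c) list \<times> nat"
    define h' where "h' p = (mset_concat (mset (lyndon_factors (snd p)) + replicate_mset (snd (fst p)) (fst (fst p))), fst p)"
      for p :: "((int \<times> 'c) list \<times> nat) \<times> (int \<times> 'c) list"
    let ?S = "Sigma (words g) ?Y" and ?T = "\<Union>p\<in>?I. ?U p"
    have T: "((l, j), u) \<in> ?T \<longleftrightarrow> lyndon l \<and> admissible l \<and> 1 \<le> j \<and> admissible u \<and>
        pscale j (colours l) + colours u = g" for l j u
      using lyndon_neq_Nil[of l] by (auto simp: lyndon_powers_def words_def)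
    have split: "w = mset_concat (mset (lyndon_factors w) - replicate_mset j l + replicate_mset j l)"
      if "(w, l, j) \<in> ?S" for w l j
    proof -
      have "replicate_mset j l \<subseteq># mset (lyndon_factors w)"
        using that by (auto simp: subseteq_mset_def)
      then show ?thesis by simp
    qed
    have hS: "h p \<in> ?T \<and> h' (h p) = p \<and> val (fst p) = ?v (fst (h p)) + val (snd (h p))" if p: "p \<in> ?S" for p
    proof -
      obtain w l j where p_eq: "p = (w, l, j)" by (cases p) auto
      have S: "(w, l, j) \<in> ?S" using p p_eq by simp
      define R where "R = mset (lyndon_factors w) - replicate_mset j l"
      have w: "w = mset_concat (R + replicate_mset j l)" using split[OF S] by (simp add: R_def)
      have lj: "lyndon l" "admissible l" "1 \<le> j"
        using S words_props[of w g] by auto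
      have R: "\<forall>k\<in>#R. lyndon k \<and> admissible k"
        using S words_props[of w g] by (auto simp: R_def dest: in_diffD)
      have cw: "colours w = colours (mset_concat R) + pscale j (colours l)"
        "weight w = weight (mset_concat R) + int j * weight l"
        by (simp_all only: w colours_mset_concat_add colours_mset_concat_replicate)
      have "colours w = g" using S by (auto simp: words_def)
      then have "h p \<in> ?T"
        using lj admissible_mset_concat[OF R] cw unfolding p_eq h_def T fst_conv snd_conv R_def[symmetric]
        by (simp add: ac_simps)
      moreover have "h' (h p) = p"
      proof -
        have "mset (lyndon_factors (mset_concat R)) = R"
          using R by (intro lyndon_factors_mset_concat) blast
        then show ?thesis
          unfolding p_eq h_def h'_def fst_conv snd_conv R_def[symmetric] by (simp only: w[symmetric])
      qed
      moreover have "val w = int j * val l + val (mset_concat R)"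
        using cw by (simp add: val_def algebra_simps)
      ultimately show ?thesis by (simp add: p_eq h_def R_def)
    qed
    have hT: "h' y \<in> ?S \<and> h (h' y) = y" if y: "y \<in> ?T" for y
    proof -
      obtain l j u where y_eq: "y = ((l, j), u)" by (cases y) auto
      have T': "lyndon l" "admissible l" "1 \<le> j" "admissible u" "pscale j (colours l) + colours u = g"
        using y T[of l j u] y_eq by auto
      define R where "R = mset (lyndon_factors u)"
      define w where "w = mset_concat (R + replicate_mset j l)"
      have "\<forall>k\<in>#R. lyndon k \<and> admissible k"
        unfolding R_def using T'(4) by (intro words_props[of u "colours u"]) (simp add: words_def)
      then have all: "\<forall>k\<in>#R + replicate_mset j l. lyndon k \<and> admissible k"
        using T'(1,2) by (metis union_iff in_replicate_mset)
      have fw: "mset (lyndon_factors w) = R + replicate_mset j l"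
        unfolding w_def using all by (intro lyndon_factors_mset_concat) blast
      have "colours w = g"
        using T' by (simp add: w_def colours_mset_concat_add colours_mset_concat_replicate R_def add.commute)
      then have "w \<in> words g" using admissible_mset_concat[OF all] by (simp add: words_def w_def)
      moreover have "l \<in> set (lyndon_factors w)"
        using T'(3) fw by (metis Suc_le_eq One_nat_def in_replicate_mset set_mset_mset union_iff)
      moreover have "j \<le> count (mset (lyndon_factors w)) l" unfolding fw by simp
      ultimately have "(w, l, j) \<in> ?S" using T'(3) by simp
      moreover have "h' y = (w, l, j)" by (simp add: y_eq h'_def w_def R_def)
      moreover have "h (w, l, j) = y" using fw by (simp add: h_def y_eq R_def)
      ultimately show ?thesis by simp
    qed
    have bij: "bij_betw h ?S ?T"
      by (rule bij_betw_byWitness[where f' = h']) (use hS hT in blast)+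
    have "gen_series (\<lambda>x. ?v (fst x) + val (snd x)) (\<lambda>x. ?f (fst x)) ?T =
      gen_series (\<lambda>p. ?v (fst (h p)) + val (snd (h p))) (\<lambda>p. ?f (fst (h p))) ?S"
      by (rule gen_series_reindex[OF bij])
    also have "\<dots> = gen_series (\<lambda>p. val (fst p)) (\<lambda>p. ?f (snd p)) ?S"
    proof (rule gen_series_cong)
      fix p assume "p \<in> ?S"
      then show "?v (fst (h p)) + val (snd (h p)) = val (fst p)" using hS[of p] by simp
      show "?f (fst (h p)) = ?f (snd p)" by (simp add: h_def)
    qed
    finally show ?thesis .
  qed
  finally show ?thesis using lhs by simp
qed

section \<open>Positivity of the indecomposable part\<close>

lemma card_lyndon_adm_antimono:
  assumes "g \<noteq> 0" "M \<le> N"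
  shows "card (lyndon_adm g N) \<le> card (lyndon_adm g M)"
  using assms(2)
proof (induction N rule: int_ge_induct)
  case (step N)
  then show ?case using card_lyndon_adm_mono[OF assms(1), of "N + 1"] by simp
qed simp

definition translate :: "int \<Rightarrow> (int \<times> 'c) list \<Rightarrow> (int \<times> 'c) list" where
  "translate d w = map (\<lambda>x. (fst x + d, snd x)) w"

lemma translate_translate: "translate d (translate e w) = translate (d + e) w"
  by (simp add: translate_def comp_def add.commute add.left_commute)

lemma translate_0 [simp]: "translate 0 w = w"
  by (simp add: translate_def)

lemma colours_translate [simp]: "colours (translate d w) = colours w"
  by (induction w) (auto simp: translate_def)

lemma weight_translate [simp]: "weight (translate d w) = weight w + int (length w) * d"
  by (induction w) (auto simp: translate_def algebra_simps)

lemma strict_mono_translate: "strict_mono (\<lambda>x :: int \<times> 'c. (fst x + d, snd x))"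
  by (rule strict_monoI) (auto simp: less_prod_def)

lemma flatten_translate: "flatten (translate d w) = translate d (flatten w)"
  by (induction w) (auto simp: translate_def shift_def)

lemma good_translate: "good w \<Longrightarrow> good (translate d w)"
proof (induction w)
  case (Cons x w)
  have "shift (fst x + d, snd x) y \<le> (fst x + d, snd x)" if "y \<in> set (flatten (translate d w))" for y
  proof -
    obtain z where "z \<in> set (flatten w)" "y = (fst z + d, snd z)"
      using \<open>y \<in> set (flatten (translate d w))\<close> unfolding flatten_translate by (auto simp: translate_def)
    then show ?thesis using Cons.prems by (cases x; cases z) (auto simp: shift_def)
  qed
  then show ?case using Cons by (auto simp: translate_def)
qed (simp add: translate_def)

lemma weight_ge:
  "(\<And>x. x \<in> set w \<Longrightarrow> m \<le> fst x) \<Longrightarrow> int (length w) * m \<le> weight w"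
proof (induction w)
  case (Cons x w)
  then have "int (length w) * m \<le> weight w" "m \<le> fst x" by auto
  then show ?case by (simp add: algebra_simps)
qed simp

text \<open>Below the threshold the condition on the first letter of an admissible word is automatic
  for Lyndon words, so that all letters may be translated.\<close>

lemma card_lyndon_adm_periodic:
  assumes "N < int (deg g)" "g \<noteq> 0"
  shows "card (lyndon_adm g N) = card (lyndon_adm g (N - int (deg g)))"
proof (rule bij_betw_same_card)
  have len: "length w = deg g" if "w \<in> lyndon_adm g M" for w M
    using that deg_colours[of w] by (auto simp: lyndon_adm_def adm_def)
  have translate: "translate d w \<in> lyndon_adm g (M + int (deg g) * d)"
    if w: "w \<in> lyndon_adm g M" and neg: "M + int (deg g) * d < int (deg g)" for w M d
  proof -
    have lyn: "lyndon w" and c: "colours w = g" "weight w = M" "good w"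
      using w by (auto simp: lyndon_adm_def adm_def admissible_def)
    have lyn': "lyndon (translate d w)"
      unfolding translate_def using strict_mono_translate lyn by (rule lyndon_map)
    have wt: "weight (translate d w) = M + int (deg g) * d" using c len[OF w] by simp
    \<comment> \<open>The first letter of a Lyndon word has the smallest first component, so
      \<open>deg g\<close> times it is at most the weight, which is below
      \<open>deg g\<close>.\<close>
    have "int (length (translate d w)) * fst (hd (translate d w)) \<le> weight (translate d w)"
      using lyndon_hd_le[OF lyn'] fst_mono by (intro weight_ge) blast
    then have "int (deg g) * fst (hd (translate d w)) < int (deg g) * 1"
      using wt neg len[OF w] by (simp add: translate_def)
    moreover have "deg g \<noteq> 0" using assms(2) deg_eq_0_iff by blast
    then have "0 < int (deg g)" by simp
    ultimately have "fst (hd (translate d w)) < 1" by (simp only: mult_less_cancel_left_pos)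
    then show ?thesis
      using lyn' wt c good_translate[OF c(3)] by (simp add: lyndon_adm_def adm_def admissible_def)
  qed
  show "bij_betw (translate (- 1)) (lyndon_adm g N) (lyndon_adm g (N - int (deg g)))"
  proof (rule bij_betw_byWitness[where f' = "translate 1"])
    show "translate (- 1) ` lyndon_adm g N \<subseteq> lyndon_adm g (N - int (deg g))"
      using translate[of _ N "- 1"] assms(1) by auto
    show "translate 1 ` lyndon_adm g (N - int (deg g)) \<subseteq> lyndon_adm g N"
      using translate[of _ "N - int (deg g)" 1] assms(1) by auto
  qed (auto simp: translate_translate)
qed

text \<open>The counts are monotone and agree at distance \<open>deg g\<close>, so they are constant
  in between.\<close>

lemma card_lyndon_adm_const:
  assumes "N < int (deg g)" "g \<noteq> 0"
  shows "card (lyndon_adm g N) = card (lyndon_adm g (N - 1))"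
proof (rule antisym)
  show "card (lyndon_adm g N) \<le> card (lyndon_adm g (N - 1))"
    using assms(2) by (rule card_lyndon_adm_mono)
  have "deg g \<noteq> 0" using assms(2) deg_eq_0_iff by blast
  then have "card (lyndon_adm g (N - 1)) \<le> card (lyndon_adm g (N - int (deg g)))"
    by (intro card_lyndon_adm_antimono assms(2)) simp
  then show "card (lyndon_adm g (N - 1)) \<le> card (lyndon_adm g N)"
    using card_lyndon_adm_periodic[OF assms] by simp
qed

text \<open>A polynomial in \<open>q\<close> has only exponents \<open>n \<le> 0\<close> in
  \<open>X\<close>. For \<open>n > 0\<close> the two counts compared lie in the range where they are
  constant; for \<open>n < - quad h\<close> both are 0.\<close>

lemma lyndon_series_positive:
  assumes "h \<noteq> 0"
  obtains p :: "rat poly" where "\<And>n. coeff p n \<ge> 0"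
    "\<And>n. ((1 - fls_X) * lyndon_series h) $$ n = (if n \<le> 0 then coeff p (nat (- n)) else 0)"
proof -
  let ?d = "\<lambda>n. ((1 - fls_X) * lyndon_series h) $$ n"
  let ?N = "\<lambda>n. - n - int (lin b h)"
  have d: "?d n = of_nat (card (lyndon_adm h (?N n))) - of_nat (card (lyndon_adm h (?N n + 1)))" for n
  proof -
    have "(1 - fls_X) * lyndon_series h = lyndon_series h - fls_shift (- 1) (lyndon_series h)"
      by (simp only: left_diff_distrib mult_1_left fls_X_times_conv_shift(1))
    then have "?d n = lyndon_series h $$ n - lyndon_series h $$ (n - 1)"
      by (simp only: fls_minus_nth fls_shift_nth) simp
    then show ?thesis by (simp add: lyndon_series_nth algebra_simps)
  qed
  have nonneg: "?d n \<ge> 0" for n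
    unfolding d using card_lyndon_adm_mono[OF assms, of "?N n + 1"] by simp
  have "deg h \<noteq> 0" using assms deg_eq_0_iff by blast
  then have zero: "?d n = 0" if "n > 0" for n
    using card_lyndon_adm_const[OF _ assms, of "?N n + 1"] that unfolding d by simp
  have empty: "lyndon_adm h N = {}" if "N > int (quad h) - int (lin b h)" for N
    using adm_empty[OF that] by (simp add: lyndon_adm_def)
  have zero': "?d n = 0" if "n < - int (quad h)" for n
    unfolding d using empty[of "?N n"] empty[of "?N n + 1"] that by simp
  define p where "p = (\<Sum>i\<le>quad h. monom (?d (- int i)) i)"
  have coeff: "coeff p i = ?d (- int i)" for i
    using zero'[of "- int i"] by (auto simp: p_def coeff_sum sum.delta)
  show thesis
  proof (rule that[of p])
    show "coeff p n \<ge> 0" for n unfolding coeff by (rule nonneg)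
    show "?d n = (if n \<le> 0 then coeff p (nat (- n)) else 0)" for n
      using zero[of n] by (auto simp: coeff)
  qed
qed

section \<open>Coefficients of the generating series of words\<close>

text \<open>With fewer admissible words than multisets, some nonzero combination of quotient fields
  would vanish at all admissible words, although its leading word is one of them. So
  \<open>flatten\<close> is bijective here without an explicit inverse.\<close>

lemma card_adm: "card (adm g N) = card (colour_multisets g (N + int (lin b g) - int (quad g)))"
proof (rule antisym[OF card_adm_le], rule ccontr)
  define A where "A = colour_multisets g (N + int (lin b g) - int (quad g))"
  assume "\<not> card A \<le> card (adm g N)"
  then obtain c where c: "\<exists>M\<in>A. c M \<noteq> 0"
    "\<forall>v\<in>adm g N. (\<Sum>M\<in>A. c M * quotient_field g N M v) = 0"
    using homogeneous_system_nontrivial[of "adm g N" A "quotient_field g N"] finite_adm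
      finite_colour_multisets by (auto simp: A_def)
  define G where "G = (\<Sum>M\<in>A. scl (c M) (quotient_field g N M))"
  have G: "G v = (\<Sum>M\<in>A. c M * quotient_field g N M v)" for v
    by (simp only: G_def sum_scl_apply)
  have "G \<in> fields g N"
    unfolding G_def using quotient_field_in_fields
    by (intro fields_sum) (auto simp: A_def finite_colour_multisets)
  moreover have "G \<noteq> 0"
  proof
    assume "G = 0"
    then have "(\<Sum>M\<in>A. c M * quotient_field g N M v) = 0" for v using G[of v] by simp
    then show False using c(1) quotient_field_independent[OF A_def, of c] by blast
  qed
  ultimately obtain v where "v \<in> adm g N" "leading G v" using fields_leading_ex by blast
  then show False using c(2) G by (auto simp: leading_def)
qed

lemma colour_multisets_alt:
  "colour_multisets g N = {M. (\<forall>x\<in>#M. fst x \<le> 0) \<and>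
     (\<Sum>x\<in>#M. Poly_Mapping.single (snd x) 1) = g \<and> (\<Sum>x\<in>#M. fst x) = N}"
proof (rule set_eqI)
  fix M :: "(int \<times> 'c) multiset"
  obtain w where M: "M = mset w" by (metis ex_mset)
  have sums: "(\<Sum>x\<in>#mset v. Poly_Mapping.single (snd x) 1) = colours v" "(\<Sum>x\<in>#mset v. fst x) = weight v"
    for v :: "(int \<times> 'c) list"
    unfolding colours_def weight_def by (simp_all only: sum_mset_sum_list[symmetric] mset_map)
  show "M \<in> colour_multisets g N \<longleftrightarrow> M \<in> {M. (\<forall>x\<in>#M. fst x \<le> 0) \<and>
     (\<Sum>x\<in>#M. Poly_Mapping.single (snd x) 1) = g \<and> (\<Sum>x\<in>#M. fst x) = N}"
  proof
    assume "M \<in> colour_multisets g N"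
    then obtain v where "M = mset v" "\<forall>x\<in>set v. fst x \<le> 0" "colours v = g" "weight v = N"
      unfolding colour_multisets_def by blast
    then show "M \<in> {M. (\<forall>x\<in>#M. fst x \<le> 0) \<and>
     (\<Sum>x\<in>#M. Poly_Mapping.single (snd x) 1) = g \<and> (\<Sum>x\<in>#M. fst x) = N}"
      by (simp add: sums del: One_nat_def)
  next
    assume "M \<in> {M. (\<forall>x\<in>#M. fst x \<le> 0) \<and>
     (\<Sum>x\<in>#M. Poly_Mapping.single (snd x) 1) = g \<and> (\<Sum>x\<in>#M. fst x) = N}"
    then show "M \<in> colour_multisets g N"
      unfolding M colour_multisets_def by (intro imageI) (simp add: sums del: One_nat_def)
  qed
qed

lemma lookup_colour_multiset:
  "Poly_Mapping.lookup (\<Sum>x\<in>#M. Poly_Mapping.single (snd x) (1 :: nat)) c = size {#x \<in># M. snd x = c#}"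
  by (induction M) (auto simp: lookup_add lookup_single)

text \<open>Either a multiset contains the letter \<open>(0, c)\<close>, or all its letters of colour \<open>c\<close> may be
  raised.\<close>

lemma card_colour_multisets_rec:
  assumes c: "c \<in> Poly_Mapping.keys g"
  shows "card (colour_multisets g N) =
    card (colour_multisets (g - Poly_Mapping.single c 1) N) +
    card (colour_multisets g (N + int (Poly_Mapping.lookup g c)))"
proof -
  let ?m = "Poly_Mapping.lookup g c" and ?g' = "g - Poly_Mapping.single c 1"
  let ?col = "\<lambda>M. (\<Sum>x\<in>#M. Poly_Mapping.single (snd x) (1 :: nat))"
  let ?A = "{M \<in> colour_multisets g N. (0, c) \<in># M}" and ?B = "{M \<in> colour_multisets g N. (0, c) \<notin># M}"
  have g: "g = Poly_Mapping.single c 1 + ?g'"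
    using c by (intro poly_mapping_eqI) (auto simp: lookup_add lookup_minus lookup_single when_def in_keys_iff)
  have "card (colour_multisets g N) = card ?A + card ?B"
  proof -
    have "colour_multisets g N = ?A \<union> ?B" by auto
    then show ?thesis
      using card_Un_disjoint[of ?A ?B] finite_colour_multisets[of g N] by auto
  qed
  moreover have "card ?A = card (colour_multisets ?g' N)"
  proof (rule bij_betw_same_card[symmetric])
    show "bij_betw (add_mset (0, c)) (colour_multisets ?g' N) ?A"
    proof (rule bij_betw_byWitness[where f' = "\<lambda>M. M - {#(0, c)#}"])
      show "add_mset (0, c) ` colour_multisets ?g' N \<subseteq> ?A"
        using g by (auto simp: colour_multisets_alt)
      show "(\<lambda>M. M - {#(0, c)#}) ` ?A \<subseteq> colour_multisets ?g' N"
      proof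
        fix M' assume "M' \<in> (\<lambda>M. M - {#(0, c)#}) ` ?A"
        then obtain M where "M \<in> ?A" "M' = M - {#(0, c)#}" by blast
        then have "add_mset (0, c) M' \<in> colour_multisets g N" by simp
        then show "M' \<in> colour_multisets ?g' N" by (auto simp: colour_multisets_alt)
      qed
    qed auto
  qed
  moreover have "card ?B = card (colour_multisets g (N + int ?m))"
  proof (rule bij_betw_same_card)
    define up where "up d x = (if snd x = c then (fst x + d, c) else x)" for d :: int and x :: "int \<times> 'c"
    have col: "?col (image_mset (up d) M) = ?col M" for d M
      by (induction M) (auto simp: up_def)
    have wt: "(\<Sum>x\<in>#image_mset (up d) M. fst x) = (\<Sum>x\<in>#M. fst x) + d * int (Poly_Mapping.lookup (?col M) c)" for d M
      unfolding lookup_colour_multiset by (induction M) (auto simp: up_def algebra_simps)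
    have upup: "image_mset (up d) (image_mset (up e) M) = M" if "d + e = 0" for d e M
    proof -
      have "up d \<circ> up e = id" using that by (auto simp: up_def fun_eq_iff add.assoc add.commute)
      then show ?thesis by (metis multiset.map_comp multiset.map_id)
    qed
    show "bij_betw (image_mset (up 1)) ?B (colour_multisets g (N + int ?m))"
    proof (rule bij_betw_byWitness[where f' = "image_mset (up (- 1))"])
      show "image_mset (up 1) ` ?B \<subseteq> colour_multisets g (N + int ?m)"
      proof
        fix M' assume "M' \<in> image_mset (up 1) ` ?B"
        then obtain M where M: "M \<in> ?B" "M' = image_mset (up 1) M" by blast
        have "fst (up 1 x) \<le> 0" if "x \<in># M" for x
          using M(1) that by (cases "x = (0, c)") (force simp: up_def colour_multisets_alt prod_eq_iff)+
        then show "M' \<in> colour_multisets g (N + int ?m)"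
          using M col[of 1 M] wt[of 1 M] by (auto simp: colour_multisets_alt)
      qed
      show "image_mset (up (- 1)) ` colour_multisets g (N + int ?m) \<subseteq> ?B"
      proof
        fix M' assume "M' \<in> image_mset (up (- 1)) ` colour_multisets g (N + int ?m)"
        then obtain M where M: "M \<in> colour_multisets g (N + int ?m)" "M' = image_mset (up (- 1)) M" by blast
        have "fst (up (- 1) x) \<le> 0 \<and> up (- 1) x \<noteq> (0, c)" if "x \<in># M" for x
          using M(1) that by (cases x) (force simp: up_def colour_multisets_alt)
        then show "M' \<in> ?B"
          using M col[of "- 1" M] wt[of "- 1" M] by (fastforce simp: colour_multisets_alt)
      qed
    qed (auto simp: upup)
  qed
  ultimately show ?thesis by simp
qed

text \<open>The shift cancels the factor \<open>q^quad\<close>; by \<open>card_adm\<close>, what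
  remains counts multisets of letters.\<close>

definition multiset_series :: "('c \<Rightarrow>\<^sub>0 nat) \<Rightarrow> rat fls" where
  "multiset_series g = fls_shift (- int (quad g)) (word_series g)"

lemma multiset_series_nth: "multiset_series g $$ n = of_nat (card (colour_multisets g (- n)))"
  by (simp add: multiset_series_def word_series_nth card_adm)

lemma multiset_series_rec:
  assumes "c \<in> Poly_Mapping.keys g"
  shows "(1 - fls_X ^ Poly_Mapping.lookup g c) * multiset_series g =
    multiset_series (g - Poly_Mapping.single c 1)"
proof (rule fls_eqI)
  fix n
  let ?m = "Poly_Mapping.lookup g c"
  have "(1 - fls_X ^ ?m) * multiset_series g = multiset_series g - fls_shift (- int ?m) (multiset_series g)"
    by (simp only: left_diff_distrib mult_1_left fls_X_power_times_conv_shift(1))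
  then show "((1 - fls_X ^ ?m) * multiset_series g) $$ n = multiset_series (g - Poly_Mapping.single c 1) $$ n"
    using card_colour_multisets_rec[OF assms, of "- n"] by (simp add: multiset_series_nth)
qed

lemma multiset_series_0: "multiset_series 0 = 1"
proof (rule fls_eqI)
  fix n
  have eq: "(\<Sum>x\<in>#M. Poly_Mapping.single (snd x) 1) = (0 :: 'c \<Rightarrow>\<^sub>0 nat) \<longleftrightarrow> M = {#}"
    for M :: "(int \<times> 'c) multiset"
  proof
    assume "(\<Sum>x\<in>#M. Poly_Mapping.single (snd x) 1) = (0 :: 'c \<Rightarrow>\<^sub>0 nat)"
    moreover obtain w where "M = mset w" by (metis ex_mset)
    ultimately have "colours w = 0"
      unfolding colours_def by (simp only: sum_mset_sum_list[symmetric] mset_map)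
    then show "M = {#}" using \<open>M = mset w\<close> by simp
  qed simp
  have "colour_multisets 0 N = (if N = 0 then {{#}} else {})" for N
    by (auto simp: colour_multisets_alt eq simp del: One_nat_def)
  then show "multiset_series 0 $$ n = 1 $$ n" by (simp add: multiset_series_nth)
qed

text \<open>Each use of \<open>multiset_series_rec\<close> removes one letter of a colour and
  supplies the factor \<open>1 - X^j\<close>, with \<open>j\<close> the current multiplicity of that
  colour.\<close>

lemma multiset_series_qfact:
  "multiset_series g * (\<Prod>c\<in>Poly_Mapping.keys g. \<Prod>j=1..Poly_Mapping.lookup g c. 1 - fls_X ^ j) = 1"
proof (induction "deg g" arbitrary: g)
  case 0
  then have "g = 0" by (metis deg_eq_0_iff)
  then show ?case by (simp add: multiset_series_0)
next
  case (Suc n)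
  let ?q = "\<lambda>n. \<Prod>j=1..n. (1 :: rat fls) - fls_X ^ j"
  have "g \<noteq> 0" using Suc(2) by auto
  then obtain c where c: "c \<in> Poly_Mapping.keys g" by (metis keys_eq_empty equals0I)
  define g' where "g' = g - Poly_Mapping.single c 1"
  have g: "g = Poly_Mapping.single c 1 + g'"
    using c unfolding g'_def
    by (intro poly_mapping_eqI) (auto simp: lookup_add lookup_minus lookup_single when_def in_keys_iff)
  have "deg g = Suc (deg g')" by (subst g) simp
  then have IH: "multiset_series g' * (\<Prod>c\<in>Poly_Mapping.keys g'. ?q (Poly_Mapping.lookup g' c)) = 1"
    using Suc by simp
  have keys: "Poly_Mapping.keys g' \<subseteq> Poly_Mapping.keys g"
    using g by (auto simp: in_keys_iff lookup_add)
  have "(\<Prod>d\<in>Poly_Mapping.keys g'. ?q (Poly_Mapping.lookup g' d)) =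
      (\<Prod>d\<in>Poly_Mapping.keys g. ?q (Poly_Mapping.lookup g' d))"
    using keys by (intro prod.mono_neutral_left) (auto simp: in_keys_iff)
  also have "\<dots> = ?q (Poly_Mapping.lookup g' c) * (\<Prod>d\<in>Poly_Mapping.keys g - {c}. ?q (Poly_Mapping.lookup g d))"
    using c by (subst prod.remove[of _ c]) (auto simp: g lookup_add lookup_single intro!: prod.cong)
  finally have 1: "(\<Prod>d\<in>Poly_Mapping.keys g'. ?q (Poly_Mapping.lookup g' d)) =
      ?q (Poly_Mapping.lookup g' c) * (\<Prod>d\<in>Poly_Mapping.keys g - {c}. ?q (Poly_Mapping.lookup g d))" .
  have lc: "Poly_Mapping.lookup g c = Suc (Poly_Mapping.lookup g' c)"
    by (subst g) (simp add: lookup_add lookup_single)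
  have "(\<Prod>d\<in>Poly_Mapping.keys g. ?q (Poly_Mapping.lookup g d)) =
      ?q (Poly_Mapping.lookup g c) * (\<Prod>d\<in>Poly_Mapping.keys g - {c}. ?q (Poly_Mapping.lookup g d))"
    using c by (intro prod.remove) auto
  also have "?q (Poly_Mapping.lookup g c) = ?q (Poly_Mapping.lookup g' c) * (1 - fls_X ^ Poly_Mapping.lookup g c)"
    unfolding lc by simp
  finally have "(\<Prod>d\<in>Poly_Mapping.keys g. ?q (Poly_Mapping.lookup g d)) =
      (1 - fls_X ^ Poly_Mapping.lookup g c) * (\<Prod>d\<in>Poly_Mapping.keys g'. ?q (Poly_Mapping.lookup g' d))"
    unfolding 1 by (simp add: mult_ac)
  then have "multiset_series g * (\<Prod>d\<in>Poly_Mapping.keys g. ?q (Poly_Mapping.lookup g d)) =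
      ((1 - fls_X ^ Poly_Mapping.lookup g c) * multiset_series g) *
      (\<Prod>d\<in>Poly_Mapping.keys g'. ?q (Poly_Mapping.lookup g' d))"
    by (simp add: mult_ac)
  also have "\<dots> = 1" unfolding multiset_series_rec[OF c] g'_def[symmetric] by (rule IH)
  finally show ?case .
qed

end

section \<open>Expansion of rational functions at infinity\<close>

text \<open>\<open>fls_X\<close> plays the role of \<open>q^-1\<close>, so \<open>q\<close> is sent
  to \<open>fls_X_inv\<close>.\<close>

definition fls_of_poly :: "rat poly \<Rightarrow> rat fls" where
  "fls_of_poly p = poly (map_poly fls_const p) fls_X_inv"

lemma fls_of_poly_0 [simp]: "fls_of_poly 0 = 0"
  by (simp add: fls_of_poly_def)

lemma fls_of_poly_pCons: "fls_of_poly (pCons a p) = fls_const a + fls_X_inv * fls_of_poly p"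
  by (simp add: fls_of_poly_def map_poly_pCons)

lemma fls_of_poly_add: "fls_of_poly (p + q) = fls_of_poly p + fls_of_poly q"
  by (induction p q rule: poly_induct2) (simp_all add: fls_of_poly_pCons fls_plus_const algebra_simps)

lemma fls_of_poly_smult: "fls_of_poly (smult a p) = fls_const a * fls_of_poly p"
  by (induction p) (simp_all add: fls_of_poly_pCons fls_const_mult_const algebra_simps)

lemma fls_of_poly_mult: "fls_of_poly (p * q) = fls_of_poly p * fls_of_poly q"
  by (induction p)
    (simp_all add: fls_of_poly_pCons fls_of_poly_add fls_of_poly_smult algebra_simps)

lemma fls_of_poly_nth:
  "fls_of_poly p $$ n = (if n \<le> 0 then coeff p (nat (- n)) else 0)"
proof (induction p arbitrary: n)
  case (pCons a p)
  have "fls_of_poly (pCons a p) $$ n = (if n = 0 then a else 0) + fls_of_poly p $$ (n + 1)"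
    by (simp add: fls_of_poly_pCons fls_X_inv_times_conv_shift(1))
  also have "\<dots> = (if n \<le> 0 then coeff (pCons a p) (nat (- n)) else 0)"
  proof (cases "n < 0")
    case True
    then have "nat (- n) = Suc (nat (- (n + 1)))" by simp
    then show ?thesis using True by (simp add: pCons.IH)
  next
    case False
    then show ?thesis by (auto simp: pCons.IH)
  qed
  finally show ?case .
qed simp

lemma fls_of_poly_eq_0_iff [simp]: "fls_of_poly p = 0 \<longleftrightarrow> p = 0"
proof
  assume "fls_of_poly p = 0"
  then have "coeff p n = 0" for n
    using fls_of_poly_nth[of p "- int n"] by simp
  then show "p = 0" by (simp add: poly_eq_iff)
qed simp

lemma fls_of_poly_1 [simp]: "fls_of_poly 1 = 1"
  by (simp add: one_pCons fls_of_poly_pCons)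

lemma fls_of_poly_monom: "fls_of_poly (monom 1 n) = fls_X_inv ^ n"
  by (induction n) (simp_all add: monom_0 monom_Suc fls_of_poly_pCons one_pCons[symmetric])

text \<open>The embedding of the rational functions into Laurent series in \<open>q^-1\<close>.
  Being injective, it lets identities between rational functions be checked on coefficients.\<close>

definition fls_of_ratfun :: "ratfun \<Rightarrow> rat fls" where
  "fls_of_ratfun x =
     (THE y. \<exists>a b. b \<noteq> 0 \<and> x = Fraction_Field.Fract a b \<and> y = fls_of_poly a / fls_of_poly b)"

lemma fls_of_ratfun_Fract:
  assumes "b \<noteq> 0"
  shows "fls_of_ratfun (Fraction_Field.Fract a b) = fls_of_poly a / fls_of_poly b"
  unfolding fls_of_ratfun_def
proof (rule the_equality)
  fix y assume "\<exists>c d. d \<noteq> 0 \<and> Fraction_Field.Fract a b = Fraction_Field.Fract c d \<and>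
    y = fls_of_poly c / fls_of_poly d"
  then obtain c d where cd: "d \<noteq> 0" "Fraction_Field.Fract a b = Fraction_Field.Fract c d"
    "y = fls_of_poly c / fls_of_poly d" by blast
  then have "c * b = a * d" using assms by (simp add: Fraction_Field.eq_fract)
  then have "fls_of_poly c * fls_of_poly b = fls_of_poly a * fls_of_poly d"
    by (simp flip: fls_of_poly_mult)
  then show "y = fls_of_poly a / fls_of_poly b"
    using assms cd by (simp add: frac_eq_eq)
qed (use assms in blast)

lemma ratfun_cases:
  fixes x :: ratfun
  obtains a b where "x = Fraction_Field.Fract a b" "b \<noteq> 0"
  by (cases x rule: Fract_cases) auto

lemma fls_of_ratfun_to_fract: "fls_of_ratfun (to_fract p) = fls_of_poly p"
  by (simp add: to_fract_def fls_of_ratfun_Fract)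

lemma fls_of_ratfun_0 [simp]: "fls_of_ratfun 0 = 0" and fls_of_ratfun_1 [simp]: "fls_of_ratfun 1 = 1"
  using fls_of_ratfun_to_fract[of 0] fls_of_ratfun_to_fract[of 1] by simp_all

lemma fls_of_ratfun_add: "fls_of_ratfun (x + y) = fls_of_ratfun x + fls_of_ratfun y"
  by (cases x rule: ratfun_cases; cases y rule: ratfun_cases)
    (simp add: fls_of_ratfun_Fract fls_of_poly_add fls_of_poly_mult add_frac_eq)

lemma fls_of_ratfun_mult: "fls_of_ratfun (x * y) = fls_of_ratfun x * fls_of_ratfun y"
  by (cases x rule: ratfun_cases; cases y rule: ratfun_cases)
    (simp add: fls_of_ratfun_Fract fls_of_poly_mult)

lemma fls_of_ratfun_eq_0_iff [simp]: "fls_of_ratfun x = 0 \<longleftrightarrow> x = 0"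
  by (cases x rule: ratfun_cases) (auto simp: fls_of_ratfun_Fract eq_fract Zero_fract_def)

lemma fls_of_ratfun_uminus: "fls_of_ratfun (- x) = - fls_of_ratfun x"
  using fls_of_ratfun_add[of x "- x"] by (simp add: eq_neg_iff_add_eq_0 add.commute)

lemma fls_of_ratfun_diff: "fls_of_ratfun (x - y) = fls_of_ratfun x - fls_of_ratfun y"
  using fls_of_ratfun_add[of x "- y"] by (simp add: fls_of_ratfun_uminus)

lemma fls_of_ratfun_inj: "fls_of_ratfun x = fls_of_ratfun y \<longleftrightarrow> x = y"
  using fls_of_ratfun_eq_0_iff[of "x - y"] by (simp add: fls_of_ratfun_diff)

lemma fls_of_ratfun_divide: "fls_of_ratfun (x / y) = fls_of_ratfun x / fls_of_ratfun y"
proof (cases "y = 0")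
  case False
  then show ?thesis using fls_of_ratfun_mult[of "x / y" y] by (simp add: field_simps)
qed simp

lemma fls_of_ratfun_inverse: "fls_of_ratfun (inverse x) = inverse (fls_of_ratfun x)"
  using fls_of_ratfun_divide[of 1 x] by (simp add: inverse_eq_divide)

lemma fls_of_ratfun_power: "fls_of_ratfun (x ^ n) = fls_of_ratfun x ^ n"
  by (induction n) (simp_all add: fls_of_ratfun_mult)

lemma fls_of_ratfun_sum: "fls_of_ratfun (sum f A) = (\<Sum>x\<in>A. fls_of_ratfun (f x))"
  by (induction A rule: infinite_finite_induct) (simp_all add: fls_of_ratfun_add)

lemma fls_of_ratfun_prod: "fls_of_ratfun (prod f A) = (\<Prod>x\<in>A. fls_of_ratfun (f x))"
  by (induction A rule: infinite_finite_induct) (simp_all add: fls_of_ratfun_mult)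

lemma fls_of_ratfun_of_nat: "fls_of_ratfun (of_nat n) = of_nat n"
  by (induction n) (simp_all add: fls_of_ratfun_add)

lemma fls_of_ratfun_q: "fls_of_ratfun ratfun_q = fls_X_inv"
  by (simp add: ratfun_q_def fls_of_ratfun_to_fract fls_of_poly_pCons)

lemma fls_of_ratfun_inverse_q: "fls_of_ratfun (inverse ratfun_q) = fls_X"
  by (simp add: fls_of_ratfun_inverse fls_of_ratfun_q fls_inverse_X_inv)

lemma fls_of_poly_pcompose:
  assumes "n > 0"
  shows "fls_of_poly (pcompose p (monom 1 n)) = fls_compose_power (fls_of_poly p) n"
proof (induction p)
  case (pCons a p)
  have "fls_X_inv ^ n = (fls_X_intpow (- int n) :: rat fls)"
    by (simp add: fls_X_inv_power_conv_shift_1)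
  then show ?case
    using assms by (simp add: pcompose_pCons fls_of_poly_add fls_of_poly_mult fls_of_poly_monom
        fls_of_poly_pCons pCons.IH)
qed simp

lemma fls_compose_power_divide':
  assumes "n > 0" "g \<noteq> (0 :: rat fls)"
  shows "fls_compose_power (f / g) n = fls_compose_power f n / fls_compose_power g n"
proof -
  have "fls_compose_power g n \<noteq> 0"
  proof
    assume *: "fls_compose_power g n = 0"
    have "g $$ k = fls_compose_power g n $$ (int n * k)" for k
      using assms(1) by (simp add: fls_nth_compose_power)
    then have "g = 0" using * by (intro fls_eqI) simp
    then show False using assms(2) by simp
  qed
  moreover have "fls_compose_power (f / g) n * fls_compose_power g n = fls_compose_power f n"
    using assms by (simp flip: fls_compose_power_mult)
  ultimately show ?thesis by (simp add: field_simps)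
qed

lemma fls_of_ratfun_adams:
  assumes "n > 0"
  shows "fls_of_ratfun (ratfun_adams n x) = fls_compose_power (fls_of_ratfun x) n"
proof (cases x rule: ratfun_cases)
  case (1 a b)
  then show ?thesis
    using assms by (simp add: ratfun_adams_Fract fls_of_ratfun_Fract pcompose_monom_eq_0_iff
        fls_of_poly_pcompose fls_compose_power_divide')
qed

lemma ratfun_adams_0 [simp]: "n > 0 \<Longrightarrow> ratfun_adams n 0 = 0"
  using fls_of_ratfun_adams[of n 0] by simp

lemma ratfun_adams_add: "n > 0 \<Longrightarrow> ratfun_adams n (x + y) = ratfun_adams n x + ratfun_adams n y"
  by (subst fls_of_ratfun_inj[symmetric]) (simp add: fls_of_ratfun_adams fls_of_ratfun_add)

lemma ratfun_adams_sum: "n > 0 \<Longrightarrow> ratfun_adams n (sum f A) = (\<Sum>x\<in>A. ratfun_adams n (f x))"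
  by (induction A rule: infinite_finite_induct) (simp_all add: ratfun_adams_add)

lemma ratfun_adams_mult: "n > 0 \<Longrightarrow> ratfun_adams n (x * y) = ratfun_adams n x * ratfun_adams n y"
  by (subst fls_of_ratfun_inj[symmetric]) (simp add: fls_of_ratfun_adams fls_of_ratfun_mult)

lemma ratfun_adams_1: "n > 0 \<Longrightarrow> ratfun_adams n 1 = 1"
  by (subst fls_of_ratfun_inj[symmetric]) (simp add: fls_of_ratfun_adams)

lemma ratfun_adams_of_nat: "n > 0 \<Longrightarrow> ratfun_adams n (of_nat k) = of_nat k"
  by (induction k) (simp_all add: ratfun_adams_add ratfun_adams_1)

lemma ratfun_adams_inverse_of_nat: "n > 0 \<Longrightarrow> ratfun_adams n (1 / of_nat k) = 1 / of_nat k"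
  using ratfun_adams_mult[of n "1 / of_nat k" "of_nat k"]
  by (cases "k = 0") (simp_all add: ratfun_adams_of_nat ratfun_adams_1 field_simps)

lemma ratfun_adams_divide_of_nat:
  "n > 0 \<Longrightarrow> ratfun_adams n (x / of_nat k) = ratfun_adams n x / of_nat k"
  using ratfun_adams_mult[of n x "1 / of_nat k"] by (simp add: ratfun_adams_inverse_of_nat)

lemma ratfun_adams_adams:
  assumes "n > 0" "m > 0"
  shows "ratfun_adams n (ratfun_adams m x) = ratfun_adams (n * m) x"
proof (subst fls_of_ratfun_inj[symmetric], rule fls_eqI)
  fix k
  have "int n dvd k \<and> int m dvd k div int n \<longleftrightarrow> int n * int m dvd k"
    using assms by (auto simp: dvd_div_iff_mult mult.commute intro: dvd_mult_left)
  then show "fls_of_ratfun (ratfun_adams n (ratfun_adams m x)) $$ k =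
      fls_of_ratfun (ratfun_adams (n * m) x) $$ k"
    using assms by (auto simp: fls_of_ratfun_adams fls_nth_compose_power div_mult2_eq zdiv_zmult2_eq)
qed


section \<open>Logarithms of power series in several variables\<close>

lemma mfps_nth_simps [simp]:
  "mfps_nth 0 m = 0" "mfps_nth 1 m = (if m = 0 then 1 else 0)"
  "mfps_nth (f + g) m = mfps_nth f m + mfps_nth g m" "mfps_nth (f - g) m = mfps_nth f m - mfps_nth g m"
  "mfps_nth (- f) m = - mfps_nth f m"
  by (simp_all add: zero_mfps.rep_eq one_mfps.rep_eq plus_mfps.rep_eq minus_mfps.rep_eq uminus_mfps.rep_eq)

lemma mfps_nth_mult: "mfps_nth (f * g) m = (\<Sum>(a, b) | a + b = m. mfps_nth f a * mfps_nth g b)"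
  by (simp add: times_mfps.rep_eq)

lemma mfps_nth_sum: "mfps_nth (sum f A) m = (\<Sum>x\<in>A. mfps_nth (f x) m)"
  by (induction A rule: infinite_finite_induct) simp_all

lemma mfps_nth_monom: "mfps_nth (mfps_monom m c) k = (if k = m then c else 0)"
  by (simp add: mfps_monom_def)

lemma mfps_nth_const_mult: "mfps_nth (mfps_const c * f) m = c * mfps_nth f m"
proof -
  have "mfps_nth (mfps_const c * f) m = (\<Sum>p\<in>{(a, b). a + b = m}. if p = (0, m) then c * mfps_nth f m else 0)"
    unfolding mfps_nth_mult by (rule sum.cong) (auto simp: mfps_nth_monom split: if_splits)
  then show ?thesis by (simp add: finite_exponent_splits)
qed

text \<open>The derivation multiplying each monomial by its degree. It turns the logarithm into the
  equation \<open>f * euler (log f) = euler f\<close>, which determines the coefficients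
  recursively.\<close>

definition euler :: "('v, 'a) mfps \<Rightarrow> ('v, 'a :: comm_ring_1) mfps" where
  "euler f = Abs_mfps (\<lambda>m. of_nat (deg m) * mfps_nth f m)"

lemma mfps_nth_euler: "mfps_nth (euler f) m = of_nat (deg m) * mfps_nth f m"
  by (simp add: euler_def)

lemma euler_mult: "euler (f * g) = euler f * g + f * euler g"
proof (rule mfps_eqI)
  fix m
  show "mfps_nth (euler (f * g)) m = mfps_nth (euler f * g + f * euler g) m"
    unfolding mfps_nth_euler mfps_nth_mult mfps_nth_simps sum_distrib_left sum.distrib[symmetric]
    by (rule sum.cong) (auto simp: algebra_simps simp del: One_nat_def)
qed

lemma euler_const_mult: "euler (mfps_const c * f) = mfps_const c * euler f"
  by (rule mfps_eqI) (simp add: mfps_nth_euler mfps_nth_const_mult mult.left_commute)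

lemma euler_sum: "euler (sum f A) = (\<Sum>x\<in>A. euler (f x))"
  by (rule mfps_eqI) (simp add: mfps_nth_euler mfps_nth_sum sum_distrib_left)

lemma euler_power: "euler (f ^ Suc n) = of_nat (Suc n) * (f ^ n * euler f)"
proof (induction n)
  case (Suc n)
  have "euler (f ^ Suc (Suc n)) = euler f * f ^ Suc n + f * euler (f ^ Suc n)"
    by (simp only: power_Suc[of f "Suc n"] euler_mult)
  also have "\<dots> = of_nat (Suc (Suc n)) * (f ^ Suc n * euler f)"
    unfolding Suc by (simp add: algebra_simps)
  finally show ?case .
qed simp

lemma mfps_power_nth_eq_0:
  assumes "mfps_nth u 0 = 0" "deg m < n"
  shows "mfps_nth (u ^ n) m = 0"
  using assms(2)
proof (induction n arbitrary: m)
  case (Suc n)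
  have "mfps_nth u a * mfps_nth (u ^ n) b = 0" if "a + b = m" for a b
  proof (cases "a = 0")
    case False
    then have "deg a \<noteq> 0" using deg_eq_0_iff by blast
    moreover have "deg m = deg a + deg b" unfolding that[symmetric] by simp
    ultimately have "deg b < n" using Suc.prems by linarith
    then show ?thesis using Suc.IH by simp
  qed (use assms in simp)
  then show ?case by (auto simp: mfps_nth_mult intro!: sum.neutral)
qed simp

lemma mfps_log_nth:
  assumes "mfps_nth f 0 = 1" "deg m \<le> N"
  shows "mfps_nth (mfps_log f) m =
    mfps_nth (\<Sum>n=1..N. mfps_const ((- 1) ^ (n + 1) / of_nat n) * (f - 1) ^ n) m"
proof -
  let ?t = "\<lambda>n. mfps_nth (mfps_const ((- 1) ^ (n + 1) / of_nat n) * (f - 1) ^ n) m"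
  have "?t n = 0" if "n > N" for n
    using mfps_power_nth_eq_0[of "f - 1" m n] that assms by (simp add: mfps_nth_const_mult)
  then have "{n \<in> {1..}. ?t n \<noteq> 0} \<subseteq> {1..N}" by (auto simp: not_less[symmetric])
  then have "(\<Sum>n\<in>{n \<in> {1..}. ?t n \<noteq> 0}. ?t n) = (\<Sum>n=1..N. ?t n)"
    by (intro sum.mono_neutral_left) auto
  then show ?thesis by (simp add: mfps_log_def mfps_suminf_def mfps_nth_sum)
qed

lemma mfps_log_recursion:
  fixes f :: "('v, 'a :: field_char_0) mfps"
  assumes "mfps_nth f 0 = 1"
  shows "of_nat (deg m) * mfps_nth f m =
    (\<Sum>(a, b) | a + b = m. mfps_nth f a * (of_nat (deg b) * mfps_nth (mfps_log f) b))"
proof -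
  define N where "N = deg m"
  define u where "u = f - 1"
  define L where "L = (\<Sum>n=1..N. mfps_const ((- 1) ^ (n + 1) / of_nat n) * u ^ n)"
  have "euler L = (\<Sum>n=1..N. (- u) ^ (n - 1)) * euler u"
  proof -
    have "euler (mfps_const ((- 1) ^ (n + 1) / of_nat n) * u ^ n) = (- u) ^ (n - 1) * euler u"
      if "n \<in> {1..N}" for n
    proof -
      have "n \<noteq> 0" using that by simp
      then obtain k where k: "n = Suc k" using not0_implies_Suc by blast
      have c: "mfps_const (c / of_nat (Suc k)) * (of_nat (Suc k) * g) = mfps_const c * g"
        for c :: 'a and g :: "('v, 'a) mfps"
      proof (rule mfps_eqI)
        fix m
        have "mfps_nth (of_nat j * g) m = of_nat j * mfps_nth g m" for j
          by (induction j) (simp_all add: algebra_simps)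
        then show "mfps_nth (mfps_const (c / of_nat (Suc k)) * (of_nat (Suc k) * g)) m =
            mfps_nth (mfps_const c * g) m"
          by (simp add: mfps_nth_const_mult del: of_nat_Suc)
      qed
      have "mfps_const ((- 1) ^ k) * (u ^ k * g) = (- u) ^ k * g" for g
        by (cases "even k") (auto intro!: mfps_eqI simp: mfps_nth_const_mult)
      then show ?thesis
        unfolding k euler_const_mult euler_power c by simp
    qed
    then show ?thesis unfolding L_def euler_sum sum_distrib_right by (rule sum.cong[OF refl])
  qed
  also have "(\<Sum>n=1..N. (- u) ^ (n - 1)) = (\<Sum>k<N. (- u) ^ k)"
    by (rule sum.reindex_bij_witness[where i = Suc and j = "\<lambda>n. n - 1"]) auto
  \<comment> \<open>The truncated geometric series telescopes. The remainder has order greater than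
    \<open>deg m\<close>, so it does not reach the coefficient at \<open>m\<close>.\<close>
  finally have "f * euler L = (1 - (- u)) * (\<Sum>k<N. (- u) ^ k) * euler u"
    by (simp add: u_def mult.assoc)
  also have "(1 - (- u)) * (\<Sum>k<N. (- u) ^ k) = 1 - (- u) ^ N"
    by (rule one_diff_power_eq[symmetric])
  finally have eq: "f * euler L = euler u - (- u) ^ N * euler u"
    by (simp add: algebra_simps)
  have "mfps_nth ((- u) ^ N * euler u) m = 0"
    unfolding mfps_nth_mult
  proof (rule sum.neutral, clarify)
    fix a b assume m: "m = a + b"
    show "mfps_nth ((- u) ^ N) a * mfps_nth (euler u) b = 0"
    proof (cases "deg a < N")
      case True
      then show ?thesis using mfps_power_nth_eq_0[of "- u" a N] assms by (simp add: u_def)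
    next
      case False
      then have "deg b = 0" unfolding N_def m by simp
      then show ?thesis by (simp only: mfps_nth_euler) simp
    qed
  qed
  then have "mfps_nth (euler u) m = mfps_nth (f * euler L) m" unfolding eq by simp
  also have "mfps_nth (euler u) m = of_nat (deg m) * mfps_nth f m"
    by (cases "m = 0") (simp_all add: mfps_nth_euler u_def)
  also have "mfps_nth (f * euler L) m =
      (\<Sum>(a, b) | a + b = m. mfps_nth f a * (of_nat (deg b) * mfps_nth (mfps_log f) b))"
    unfolding mfps_nth_mult
  proof (rule sum.cong[OF refl], clarify)
    fix a b assume "m = a + b"
    then have "deg b \<le> N" by (simp add: N_def)
    then show "mfps_nth f a * mfps_nth (euler L) b = mfps_nth f a * (of_nat (deg b) * mfps_nth (mfps_log f) b)"
      using mfps_log_nth[OF assms, of b N] by (simp add: mfps_nth_euler L_def u_def)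
  qed
  finally show ?thesis .
qed

lemma mfps_log_nth_0:
  assumes "mfps_nth f 0 = 1"
  shows "mfps_nth (mfps_log f) 0 = 0"
  using mfps_log_nth[OF assms, of 0 0] by simp

text \<open>As \<open>f\<close> has constant term 1, the recursion determines each coefficient of
  \<open>g\<close> from those of smaller degree.\<close>

lemma mfps_log_eqI:
  fixes f g :: "('v, 'a :: field_char_0) mfps"
  assumes "mfps_nth f 0 = 1" "mfps_nth g 0 = 0"
    and rec: "\<And>m. of_nat (deg m) * mfps_nth f m =
      (\<Sum>(a, b) | a + b = m. mfps_nth f a * (of_nat (deg b) * mfps_nth g b))"
  shows "mfps_log f = g"
proof (rule mfps_eqI)
  fix m
  show "mfps_nth (mfps_log f) m = mfps_nth g m"
  proof (induction "deg m" arbitrary: m rule: less_induct)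
    case less
    show ?case
    proof (cases "m = 0")
      case True
      then show ?thesis using assms mfps_log_nth_0 by metis
    next
      case False
      let ?S = "{(a, b). a + b = m} - {(0, m)}"
      have split: "(\<Sum>(a, b) | a + b = m. mfps_nth f a * (of_nat (deg b) * mfps_nth h b)) =
          of_nat (deg m) * mfps_nth h m +
          (\<Sum>(a, b)\<in>?S. mfps_nth f a * (of_nat (deg b) * mfps_nth h b))" for h
        using finite_exponent_splits[of m] assms(1)
        by (subst sum.remove[of _ "(0, m)"]) auto
      have "(\<Sum>(a, b)\<in>?S. mfps_nth f a * (of_nat (deg b) * mfps_nth (mfps_log f) b)) =
          (\<Sum>(a, b)\<in>?S. mfps_nth f a * (of_nat (deg b) * mfps_nth g b))"
      proof (rule sum.cong[OF refl])
        fix p assume p: "p \<in> ?S"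
        obtain a b where ab: "p = (a, b)" by (cases p)
        then have *: "(a, b) \<noteq> (0, a + b)" "m = a + b" using p by auto
        then have "a \<noteq> 0" by auto
        then have "deg a \<noteq> 0" using deg_eq_0_iff by blast
        then have "deg b < deg m" unfolding *(2) by simp
        then show "(case p of (a, b) \<Rightarrow> mfps_nth f a * (of_nat (deg b) * mfps_nth (mfps_log f) b)) =
            (case p of (a, b) \<Rightarrow> mfps_nth f a * (of_nat (deg b) * mfps_nth g b))"
          using less ab by simp
      qed
      then have "of_nat (deg m) * mfps_nth (mfps_log f) m = of_nat (deg m) * mfps_nth g m"
        using mfps_log_recursion[OF assms(1), of m] rec[of m] split[of "mfps_log f"] split[of g] by simp
      moreover have "deg m \<noteq> 0" using False deg_eq_0_iff by blast
      then have "of_nat (deg m) \<noteq> (0 :: 'a)" by (simp only: of_nat_eq_0_iff) simp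
      ultimately show ?thesis by simp
    qed
  qed
qed


section \<open>The plethystic logarithm\<close>

lemma prime_factors_Prod_primes:
  "finite S \<Longrightarrow> \<forall>p\<in>S. prime p \<Longrightarrow> prime_factors (\<Prod>S) = (S :: nat set)"
proof (induction S rule: finite_induct)
  case (insert p S)
  have "p \<noteq> 0" using insert.prems by (metis insertI1 not_prime_0)
  moreover have "\<Prod>S \<noteq> 0" using insert by (metis insertI2 not_prime_0 prod_zero_iff)
  ultimately have "p \<noteq> 0" "\<Prod>S \<noteq> 0" by auto
  then show ?case using insert by (simp add: prime_factors_product prime_prime_factors)
qed simp

text \<open>Squarefree divisors are the products of sets of prime factors, and their signed count
  expands a product of factors \<open>1 - 1\<close>.\<close>

lemma sum_moebius_mu:
  assumes "n > 0"
  shows "(\<Sum>d | d dvd n. moebius_mu d) = (if n = 1 then 1 else 0)"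
proof -
  let ?P = "prime_factors n"
  have fin: "finite {d. d dvd n}" using assms by simp
  have bij: "bij_betw (\<lambda>S. \<Prod>S) (Pow ?P) {d. d dvd n \<and> squarefree d}"
  proof (rule bij_betw_byWitness[where f' = prime_factors])
    show "\<forall>S\<in>Pow ?P. prime_factors (\<Prod>S) = S"
    proof
      fix S assume S: "S \<in> Pow ?P"
      then have "finite S" by (meson PowD finite_set_mset finite_subset)
      then show "prime_factors (\<Prod>S) = S"
        using S by (intro prime_factors_Prod_primes) (auto simp: in_prime_factors_iff)
    qed
    show "\<forall>d\<in>{d. d dvd n \<and> squarefree d}. \<Prod>(prime_factors d) = d"
    proof
      fix d assume "d \<in> {d. d dvd n \<and> squarefree d}"
      then have d: "squarefree d" "d \<noteq> 0" using assms by auto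
      then have "d = (\<Prod>p\<in>prime_factors d. p ^ multiplicity p d)"
        by (simp add: prime_factorization_nat)
      also have "\<dots> = \<Prod>(prime_factors d)"
      proof (rule prod.cong[OF refl])
        fix p assume p: "p \<in> prime_factors d"
        then have "multiplicity p d = 1"
          using d by (metis One_nat_def in_prime_factors_iff squarefree_factorial_semiring'
              squarefree_factorial_semiring)
        then show "p ^ multiplicity p d = p" by simp
      qed
      finally show "\<Prod>(prime_factors d) = d" ..
    qed
    show "(\<lambda>S. \<Prod>S) ` Pow ?P \<subseteq> {d. d dvd n \<and> squarefree d}"
    proof (rule image_subsetI)
      fix S assume "S \<in> Pow ?P"
      then have S: "S \<subseteq> ?P" by simp
      then have fin: "finite S" by (meson finite_set_mset finite_subset)
      have "\<Prod>S dvd \<Prod>?P" using S by (intro prod_dvd_prod_subset) auto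
      also have "\<Prod>?P dvd n"
      proof -
        have "\<Prod>?P dvd (\<Prod>p\<in>?P. p ^ multiplicity p n)"
          by (intro prod_dvd_prod) (auto simp: dvd_power prime_factors_multiplicity)
        also have "\<dots> = n" using assms by (simp add: prime_factorization_nat[symmetric])
        finally show ?thesis .
      qed
      finally have "\<Prod>S dvd n" .
      moreover have "squarefree (\<Prod>S)"
        by (rule squarefree_prod_coprime)
          (use S in \<open>auto simp: in_prime_factors_iff intro: primes_coprime squarefree_prime\<close>)
      ultimately show "\<Prod>S \<in> {d. d dvd n \<and> squarefree d}" by simp
    qed
    show "prime_factors ` {d. d dvd n \<and> squarefree d} \<subseteq> Pow ?P"
      using assms by (auto simp: in_prime_factors_iff intro: dvd_trans)
  qed
  have "(\<Sum>d | d dvd n. moebius_mu d) = (\<Sum>d | d dvd n \<and> squarefree d. moebius_mu d)"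
    using fin by (intro sum.mono_neutral_right) (auto simp: moebius_mu_def)
  also have "\<dots> = (\<Sum>d | d dvd n \<and> squarefree d. (- 1) ^ card (prime_factors d))"
    by (rule sum.cong) (auto simp: moebius_mu_def)
  also have "\<dots> = (\<Sum>S\<in>Pow ?P. (- 1) ^ card (prime_factors (\<Prod>S)))"
    by (rule sum.reindex_bij_betw[OF bij, symmetric])
  also have "\<dots> = (\<Sum>S\<in>Pow ?P. (- 1) ^ card S)"
  proof (rule sum.cong[OF refl])
    fix S assume S: "S \<in> Pow ?P"
    then have "finite S" by (meson PowD finite_set_mset finite_subset)
    then have "prime_factors (\<Prod>S) = S"
      using S by (intro prime_factors_Prod_primes) (auto simp: in_prime_factors_iff)
    then show "(- 1 :: int) ^ card (prime_factors (\<Prod>S)) = (- 1) ^ card S" by simp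
  qed
  also have "\<dots> = (\<Prod>p\<in>?P. 1 - 1)"
    by (subst prod_diff_conv_sum) simp_all
  also have "\<dots> = (if n = 1 then 1 else 0)"
  proof (cases "n = 1")
    case False
    then have "?P \<noteq> {}" using assms by (auto simp: prime_factorization_empty_iff)
    then show ?thesis using False by (simp add: prod_zero_iff card_gt_0_iff)
  qed simp
  finally show ?thesis .
qed

lemma mfps_nth_adams:
  assumes "n > 0"
  shows "mfps_nth (mfps_adams n f) (pscale n h) = ratfun_adams n (mfps_nth f h)"
    and "(\<And>h. g \<noteq> pscale n h) \<Longrightarrow> mfps_nth (mfps_adams n f) g = 0"
proof -
  have nth: "mfps_nth (mfps_adams n f) g =
      (\<Sum>h\<in>{h. (if g = pscale n h then ratfun_adams n (mfps_nth f h) else 0) \<noteq> 0}.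
        if g = pscale n h then ratfun_adams n (mfps_nth f h) else 0)" for g
    by (simp add: mfps_adams_def mfps_suminf_def mfps_nth_monom pscale_def)
  show "mfps_nth (mfps_adams n f) (pscale n h) = ratfun_adams n (mfps_nth f h)"
  proof -
    have "pscale n h = pscale n k \<longleftrightarrow> k = h" for k using pscale_inj[OF assms] by blast
    then have "mfps_nth (mfps_adams n f) (pscale n h) =
        (\<Sum>k\<in>{k. k = h \<and> ratfun_adams n (mfps_nth f k) \<noteq> 0}. ratfun_adams n (mfps_nth f k))"
      unfolding nth by (intro sum.cong) auto
    also have "\<dots> = ratfun_adams n (mfps_nth f h)"
      by (cases "ratfun_adams n (mfps_nth f h) = 0") (auto simp: conj_commute cong: conj_cong)
    finally show ?thesis .
  qed
  show "mfps_nth (mfps_adams n f) g = 0" if "\<And>h. g \<noteq> pscale n h"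
    unfolding nth using that by (intro sum.neutral) auto
qed

lemma mfps_Log_nth:
  assumes "g \<noteq> 0"
  shows "mfps_nth (mfps_Log f) g = (\<Sum>(n, h)\<in>quotients g.
    of_int (moebius_mu n) / of_nat n * ratfun_adams n (mfps_nth (mfps_log f) h))"
proof -
  let ?L = "mfps_log f"
  let ?t = "\<lambda>n. of_int (moebius_mu n) / of_nat n * mfps_nth (mfps_adams n ?L) g"
  let ?s = "\<lambda>p. of_int (moebius_mu (fst p)) / of_nat (fst p) * ratfun_adams (fst p) (mfps_nth ?L (snd p))"
  have inj: "inj_on fst (quotients g)"
    by (rule inj_onI) (auto simp: quotients_def, metis pscale_inj Suc_le_lessD)
  have fin: "finite (fst ` quotients g)" using finite_quotients[OF assms] by simp
  have zero: "?t n = 0" if "n \<ge> 1" "n \<notin> fst ` quotients g" for n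
  proof -
    have "g \<noteq> pscale n h" for h
      using that by (force simp: quotients_def image_iff)
    then show ?thesis using mfps_nth_adams(2)[of n g ?L] that by simp
  qed
  have "mfps_nth (mfps_Log f) g = (\<Sum>n\<in>{n \<in> {1..}. ?t n \<noteq> 0}. ?t n)"
    by (simp add: mfps_Log_def mfps_suminf_def mfps_nth_const_mult)
  also have "\<dots> = (\<Sum>n\<in>fst ` quotients g. ?t n)"
    using zero fin by (intro sum.mono_neutral_left) (auto simp: quotients_def)
  also have "\<dots> = (\<Sum>p\<in>quotients g. ?t (fst p))"
    by (simp add: sum.reindex[OF inj])
  also have "\<dots> = (\<Sum>p\<in>quotients g. ?s p)"
    by (rule sum.cong[OF refl]) (auto simp: quotients_def mfps_nth_adams(1))
  finally show ?thesis by (simp only: case_prod_unfold)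
qed

text \<open>The recursion says \<open>f = Exp w\<close> by means of logarithmic derivatives. It
  gives \<open>log f\<close> as the sum of \<open>1/j\<close> times the \<open>j\<close>-th Adams
  image of \<open>w\<close>, and Moebius inversion recovers \<open>w\<close>.\<close>

lemma mfps_Log_eqI:
  fixes f :: "('v, ratfun) mfps" and w :: "('v \<Rightarrow>\<^sub>0 nat) \<Rightarrow> ratfun"
  assumes f0: "mfps_nth f 0 = 1"
    and rec: "\<And>g. of_nat (deg g) * mfps_nth f g = (\<Sum>(a, b) | a + b = g.
      mfps_nth f a * (\<Sum>(j, h)\<in>quotients b. of_nat (deg h) * ratfun_adams j (w h)))"
    and "g \<noteq> 0"
  shows "mfps_nth (mfps_Log f) g = w g"
proof -
  define L where "L b = (\<Sum>(j, h)\<in>quotients b. 1 / of_nat j * ratfun_adams j (w h))" for b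
  have "mfps_log f = Abs_mfps L"
  proof (rule mfps_log_eqI[OF f0])
    show "mfps_nth (Abs_mfps L) 0 = 0" using infinite_quotients_0[where 'c = 'v] by (simp add: L_def)
    show "of_nat (deg m) * mfps_nth f m =
        (\<Sum>(a, b) | a + b = m. mfps_nth f a * (of_nat (deg b) * mfps_nth (Abs_mfps L) b))" for m
    proof -
      have "of_nat (deg b) * L b = (\<Sum>(j, h)\<in>quotients b. of_nat (deg h) * ratfun_adams j (w h))" for b
        unfolding L_def sum_distrib_left
      proof (rule sum.cong[OF refl], clarify)
        fix j h assume "(j, h) \<in> quotients b"
        then have "deg b = j * deg h" "j \<noteq> 0" by (auto simp: quotients_def)
        then show "of_nat (deg b) * (1 / of_nat j * ratfun_adams j (w h)) =
            of_nat (deg h) * ratfun_adams j (w h)"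
          by (simp only: of_nat_mult) simp
      qed
      then show ?thesis unfolding rec by simp
    qed
  qed
  then have log: "mfps_nth (mfps_log f) h = L h" for h by simp
  let ?Q = "Sigma (quotients g) (\<lambda>p. quotients (snd p))"
  have q_ne: "h \<noteq> 0" if "(n, h) \<in> quotients g" for n h
    using that assms(3) by (auto simp: quotients_def)
  have "mfps_nth (mfps_Log f) g = (\<Sum>p\<in>quotients g. \<Sum>p'\<in>quotients (snd p).
      of_int (moebius_mu (fst p)) / of_nat (fst p * fst p') * ratfun_adams (fst p * fst p') (w (snd p')))"
    unfolding mfps_Log_nth[OF assms(3)] log case_prod_unfold
  proof (rule sum.cong[OF refl])
    fix p assume "p \<in> quotients g"
    then have p: "fst p > 0" by (auto simp: quotients_def)
    have "ratfun_adams (fst p) (1 / of_nat (fst p') * ratfun_adams (fst p') (w (snd p'))) =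
        1 / of_nat (fst p') * ratfun_adams (fst p * fst p') (w (snd p'))"
      if "p' \<in> quotients (snd p)" for p'
      using that p by (simp add: quotients_def case_prod_unfold
          ratfun_adams_divide_of_nat ratfun_adams_adams)
    then show "of_int (moebius_mu (fst p)) / of_nat (fst p) * ratfun_adams (fst p) (L (snd p)) =
       (\<Sum>p'\<in>quotients (snd p). of_int (moebius_mu (fst p)) / of_nat (fst p * fst p') *
         ratfun_adams (fst p * fst p') (w (snd p')))"
      using p by (simp add: L_def case_prod_unfold ratfun_adams_sum sum_distrib_left)
  qed
  also have "\<dots> = (\<Sum>x\<in>?Q. of_int (moebius_mu (fst (fst x))) / of_nat (fst (fst x) * fst (snd x)) *
      ratfun_adams (fst (fst x) * fst (snd x)) (w (snd (snd x))))"
    using finite_quotients[OF assms(3)] finite_quotients[OF q_ne]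
    by (subst sum.Sigma) (auto simp: case_prod_unfold)
  \<comment> \<open>The two Adams operations compose, so terms are grouped by the product of their
    indices; summing the Moebius function over its divisors leaves only index 1.\<close>
  also have "\<dots> = (\<Sum>y\<in>Sigma (quotients g) (\<lambda>p. {d. d dvd fst p}).
      of_int (moebius_mu (snd y)) / of_nat (fst (fst y)) * ratfun_adams (fst (fst y)) (w (snd (fst y))))"
    by (rule sum.reindex_bij_witness[where
        i = "\<lambda>y. ((snd y, pscale (fst (fst y) div snd y) (snd (fst y))), (fst (fst y) div snd y, snd (fst y)))" and
        j = "\<lambda>x. ((fst (fst x) * fst (snd x), snd (snd x)), fst (fst x))"])
      (auto simp: quotients_def pscale_pscale Suc_le_eq dvd_div_eq_0_iff intro: Nat.gr0I)
  also have "\<dots> = (\<Sum>p\<in>quotients g. \<Sum>d | d dvd fst p.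
      of_int (moebius_mu d) / of_nat (fst p) * ratfun_adams (fst p) (w (snd p)))"
    using finite_quotients[OF assms(3)]
    by (subst sum.Sigma) (auto simp: case_prod_unfold quotients_def)
  also have "\<dots> = (\<Sum>p\<in>quotients g. if p = (1, g) then w g else 0)"
  proof (rule sum.cong[OF refl])
    fix p assume p: "p \<in> quotients g"
    then have pos: "fst p > 0" by (auto simp: quotients_def)
    have "(\<Sum>d | d dvd fst p. of_int (moebius_mu d) / of_nat (fst p) * ratfun_adams (fst p) (w (snd p))) =
        of_int (\<Sum>d | d dvd fst p. moebius_mu d) / of_nat (fst p) * ratfun_adams (fst p) (w (snd p))"
      by (simp add: sum_distrib_right sum_divide_distrib)
    also have "\<dots> = (if fst p = 1 then ratfun_adams 1 (w (snd p)) else 0)"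
      unfolding sum_moebius_mu[OF pos] by simp
    also have "ratfun_adams 1 x = x" for x
    proof (subst fls_of_ratfun_inj[symmetric], rule fls_eqI)
      show "fls_of_ratfun (ratfun_adams 1 x) $$ k = fls_of_ratfun x $$ k" for k
        by (simp add: fls_of_ratfun_adams fls_nth_compose_power)
    qed
    also have "(if fst p = 1 then w (snd p) else 0) = (if p = (1, g) then w g else 0)"
      using p pscale_1[of "snd p"] by (auto simp: quotients_def prod_eq_iff)
    finally show "(\<Sum>d | d dvd fst p. of_int (moebius_mu d) / of_nat (fst p) * ratfun_adams (fst p) (w (snd p))) =
        (if p = (1, g) then w g else 0)" .
  qed
  also have "\<dots> = w g"
    using finite_quotients[OF assms(3)] pscale_1[of g] by (simp add: quotients_def)
  finally show ?thesis .
qed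

lemma keys_add_nat: "Poly_Mapping.keys (a + b) = Poly_Mapping.keys a \<union> Poly_Mapping.keys (b :: 'c \<Rightarrow>\<^sub>0 nat)"
  by (auto simp: in_keys_iff lookup_add)

lemma keys_pscale: "n > 0 \<Longrightarrow> Poly_Mapping.keys (pscale n h) = Poly_Mapping.keys h"
  by (auto simp: in_keys_iff)

context colour_form
begin

text \<open>The colour type also contains pairs whose vertex lies outside the quiver; monomials in
  these do not occur in the series of the quiver.\<close>

definition word_series_on :: "'c set \<Rightarrow> ('c \<Rightarrow>\<^sub>0 nat) \<Rightarrow> rat fls" where
  "word_series_on V g = (if Poly_Mapping.keys g \<subseteq> V then word_series g else 0)"

definition lyndon_series_on :: "'c set \<Rightarrow> ('c \<Rightarrow>\<^sub>0 nat) \<Rightarrow> rat fls" where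
  "lyndon_series_on V g = (if Poly_Mapping.keys g \<subseteq> V then lyndon_series g else 0)"

lemma word_series_on_recursion:
  "of_nat (deg g) * word_series_on V g =
   (\<Sum>(e, u) | e + u = g.
     (\<Sum>(j, h)\<in>quotients e. of_nat (deg h) * fls_compose_power (lyndon_series_on V h) j) *
     word_series_on V u)"
proof (cases "Poly_Mapping.keys g \<subseteq> V")
  case True
  have "fls_compose_power (lyndon_series_on V h) j = fls_compose_power (lyndon_series h) j"
    "word_series_on V u = word_series u" if "e + u = g" "(j, h) \<in> quotients e" for e u j h
    using that True keys_pscale[of j h]
    by (auto simp: quotients_def lyndon_series_on_def word_series_on_def keys_add_nat)
  then show ?thesis
    using True word_series_recursion[of g]
    by (auto simp: word_series_on_def[of V g] case_prod_unfold sum_distrib_right intro!: sum.cong)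
next
  case False
  have "(\<Sum>(j, h)\<in>quotients e. of_nat (deg h) * fls_compose_power (lyndon_series_on V h) j) *
     word_series_on V u = 0" if "e + u = g" for e u
  proof (cases "Poly_Mapping.keys u \<subseteq> V")
    case True
    then have e: "\<not> Poly_Mapping.keys e \<subseteq> V" using False that by (auto simp: keys_add_nat)
    have "lyndon_series_on V h = 0" if "(j, h) \<in> quotients e" for j h
      using that e keys_pscale[of j h] by (auto simp: quotients_def lyndon_series_on_def)
    then have "(\<Sum>(j, h)\<in>quotients e. of_nat (deg h) * fls_compose_power (lyndon_series_on V h) j) = 0"
      by (intro sum.neutral) auto
    then show ?thesis by simp
  qed (simp add: word_series_on_def)
  then show ?thesis using False by (simp add: word_series_on_def sum.neutral case_prod_unfold)
qed

theorem Log_positive: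
  fixes f :: "('c, ratfun) mfps"
  assumes f: "\<And>g. fls_of_ratfun (mfps_nth f g) = word_series_on V g"
  shows "\<exists>p :: rat poly. (\<forall>n. coeff p n \<ge> 0) \<and>
    mfps_nth (mfps_const (ratfun_q - 1) * mfps_Log f) g = to_fract p"
proof -
  have "\<exists>x p. (\<forall>n. coeff p n \<ge> (0 :: rat)) \<and> (ratfun_q - 1) * x = to_fract p \<and>
      fls_of_ratfun x = lyndon_series_on V h" for h
  proof (cases "h = 0 \<or> \<not> Poly_Mapping.keys h \<subseteq> V")
    case True
    have "lyndon_words 0 = {}" by (auto simp: lyndon_words_def words_def lyndon_def)
    then have "lyndon_series 0 = 0"
      by (intro fls_eqI) (simp add: lyndon_series_def gen_series_nth tame_def)
    then have "lyndon_series_on V h = 0" using True by (auto simp: lyndon_series_on_def)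
    then show ?thesis by (intro exI[of _ 0]) simp
  next
    case False
    then have on: "lyndon_series_on V h = lyndon_series h" and "h \<noteq> 0" by (auto simp: lyndon_series_on_def)
    obtain p where p: "\<And>n. coeff p n \<ge> 0"
      "\<And>n. ((1 - fls_X) * lyndon_series h) $$ n = (if n \<le> 0 then coeff p (nat (- n)) else 0)"
      using lyndon_series_positive[OF \<open>h \<noteq> 0\<close>] by blast
    have eq: "(1 - fls_X) * lyndon_series h = fls_of_poly p"
      by (rule fls_eqI) (simp only: p(2) fls_of_poly_nth)
    have q: "ratfun_q \<noteq> 0" "ratfun_q \<noteq> 1"
      unfolding ratfun_q_def by (simp_all flip: to_fract_1 add: one_pCons)
    have X: "1 - fls_X \<noteq> (0 :: rat fls)"
    proof
      assume "1 - fls_X = (0 :: rat fls)"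
      then have "(1 - fls_X) $$ 0 = (0 :: rat)" by simp
      then show False by simp
    qed
    \<comment> \<open>Dividing by \<open>1 - q^-1\<close> undoes the differences of counts. As
      \<open>q - 1\<close> is \<open>q\<close> times \<open>1 - q^-1\<close>, multiplying by it
      gives \<open>q\<close> times the polynomial.\<close>
    define x where "x = to_fract p / (1 - inverse ratfun_q)"
    have "(ratfun_q - 1) * x = ratfun_q * to_fract p"
      using q by (simp add: x_def field_simps)
    also have "\<dots> = to_fract ([:0, 1:] * p)" by (simp only: ratfun_q_def to_fract_mult)
    finally have "(ratfun_q - 1) * x = to_fract (pCons 0 p)" by simp
    moreover have "fls_of_ratfun x = fls_of_poly p / (1 - fls_X)"
      by (simp add: x_def fls_of_ratfun_divide fls_of_ratfun_diff fls_of_ratfun_inverse_q fls_of_ratfun_to_fract)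
    then have "fls_of_ratfun x = lyndon_series_on V h"
      using X unfolding on by (simp flip: eq)
    moreover have "coeff (pCons 0 p) n \<ge> 0" for n using p(1) by (cases n) simp_all
    ultimately show ?thesis by blast
  qed
  then obtain w P where w: "\<And>h n. coeff (P h) n \<ge> (0 :: rat)"
    "\<And>h. (ratfun_q - 1) * w h = to_fract (P h)" "\<And>h. fls_of_ratfun (w h) = lyndon_series_on V h"
    by metis
  have f0: "mfps_nth f 0 = 1"
  proof -
    have "multiset_series 0 = word_series 0" by (simp add: multiset_series_def quad_def)
    then have "fls_of_ratfun (mfps_nth f 0) = fls_of_ratfun 1"
      using f[of 0] multiset_series_0 by (simp add: word_series_on_def)
    then show ?thesis by (simp only: fls_of_ratfun_inj)
  qed
  show ?thesis
  proof (cases "g = 0")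
    case True
    have "mfps_nth (mfps_Log f) 0 = 0"
    proof -
      have "mfps_nth (mfps_adams n (mfps_log f)) 0 = 0" if "n > 0" for n
        using mfps_nth_adams(1)[OF that, of "mfps_log f" 0] mfps_log_nth_0[OF f0] that by simp
      then show ?thesis
        by (auto simp: mfps_Log_def mfps_suminf_def mfps_nth_const_mult intro!: sum.neutral)
    qed
    then show ?thesis by (intro exI[of _ 0]) (simp add: mfps_nth_const_mult True)
  next
    case False
    have "mfps_nth (mfps_Log f) g = w g"
    proof (rule mfps_Log_eqI[OF f0 _ False])
      fix g
      have "fls_of_ratfun (\<Sum>(a, b) | a + b = g.
          mfps_nth f a * (\<Sum>(j, h)\<in>quotients b. of_nat (deg h) * ratfun_adams j (w h))) =
        (\<Sum>(a, b) | a + b = g. word_series_on V a *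
          (\<Sum>(j, h)\<in>quotients b. of_nat (deg h) * fls_compose_power (lyndon_series_on V h) j))"
        unfolding case_prod_unfold fls_of_ratfun_sum fls_of_ratfun_mult f fls_of_ratfun_of_nat
        by (intro sum.cong refl arg_cong2[of _ _ _ _ "(*)"])
          (auto simp: quotients_def fls_of_ratfun_adams w(3))
      also have "\<dots> = (\<Sum>(b, a) | b + a = g.
          (\<Sum>(j, h)\<in>quotients b. of_nat (deg h) * fls_compose_power (lyndon_series_on V h) j) *
          word_series_on V a)"
        by (rule sum.reindex_bij_witness[where i = prod.swap and j = prod.swap])
          (auto simp: mult.commute add.commute)
      also have "\<dots> = fls_of_ratfun (of_nat (deg g) * mfps_nth f g)"
        unfolding word_series_on_recursion[symmetric] fls_of_ratfun_mult fls_of_ratfun_of_nat f ..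
      finally show "of_nat (deg g) * mfps_nth f g = (\<Sum>(a, b) | a + b = g.
          mfps_nth f a * (\<Sum>(j, h)\<in>quotients b. of_nat (deg h) * ratfun_adams j (w h)))"
        by (simp only: fls_of_ratfun_inj)
    qed
    then show ?thesis using w(1,2) by (intro exI[of _ "P g"]) (simp add: mfps_nth_const_mult)
  qed
qed

end

section \<open>The generating series of a quiver\<close>

lemma mfps_monom_mult:
  "mfps_monom m c * mfps_monom n d = mfps_monom (m + n) (c * d)"
proof (rule mfps_eqI)
  fix k
  have "mfps_nth (mfps_monom m c * mfps_monom n d) k =
      (\<Sum>p\<in>{(a, b). a + b = k}. if p = (m, n) then c * d else 0)"
    unfolding mfps_nth_mult by (rule sum.cong) (auto simp: mfps_nth_monom split: if_splits)
  then show "mfps_nth (mfps_monom m c * mfps_monom n d) k = mfps_nth (mfps_monom (m + n) (c * d)) k"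
    by (simp add: finite_exponent_splits mfps_nth_monom)
qed

lemma mfps_monom_0_1: "mfps_monom 0 1 = 1"
  by (rule mfps_eqI) (simp add: mfps_nth_monom)

lemma mfps_var_power: "mfps_var v ^ n = mfps_monom (Poly_Mapping.single v n) 1"
  by (induction n) (simp_all add: mfps_monom_0_1 mfps_monom_mult single_add[symmetric])

lemma mfps_monom_prod:
  "(\<Prod>i\<in>A. mfps_monom (m i) (c i)) = mfps_monom (\<Sum>i\<in>A. m i) (\<Prod>i\<in>A. c i)"
  by (induction A rule: infinite_finite_induct) (simp_all add: mfps_monom_0_1 mfps_monom_mult)

lemma fls_of_ratfun_qfact:
  "fls_of_ratfun (qfact (inverse ratfun_q) n) = (\<Prod>j=1..n. 1 - fls_X ^ j)"
  by (simp add: qfact_def fls_of_ratfun_prod fls_of_ratfun_diff fls_of_ratfun_power fls_of_ratfun_inverse_q)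

lemma qfact_0 [simp]: "qfact z 0 = 1"
  by (simp add: qfact_def)

lemma ratfun_q_neq_0: "ratfun_q \<noteq> 0"
  by (simp add: ratfun_q_def)

lemma colours_surj: "\<exists>w. colours w = g"
proof (induction "deg g" arbitrary: g)
  case 0
  then have "g = 0" by (metis deg_eq_0_iff)
  then show ?case by (intro exI[of _ "[]"]) simp
next
  case (Suc n)
  then have "g \<noteq> 0" by auto
  then obtain c where c: "c \<in> Poly_Mapping.keys g" by (metis keys_eq_empty equals0I)
  define h where "h = g - Poly_Mapping.single c 1"
  have g: "g = Poly_Mapping.single c 1 + h"
    using c unfolding h_def
    by (intro poly_mapping_eqI) (auto simp: lookup_add lookup_minus lookup_single when_def in_keys_iff)
  then have "deg g = Suc (deg h)" by simp
  then obtain w where "colours w = h" using Suc by auto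
  then show ?case by (intro exI[of _ "(0, c) # w"]) (simp add: g)
qed

text \<open>Evenness is inherited from \<open>even_quad\<close>, since every vector of
  multiplicities is the colour vector of some word.\<close>

lemma (in colour_form) quad_double: "2 * quad g = lin (\<lambda>i. lin (a i) g) g"
proof -
  obtain w :: "(int \<times> 'c) list" where "colours w = g" using colours_surj by blast
  then show ?thesis using even_quad[of w] unfolding quad_def by auto
qed

locale loop_quiver =
  fixes Q :: "('v::linorder, 'e) pre_digraph"
  assumes fin: "fin_digraph Q"
    and loops: "\<forall>i\<in>verts Q. \<exists>e\<in>arcs Q. tail Q e = i \<and> head Q e = i"
begin

sublocale fin_digraph Q by (rule fin)

definition num_arcs :: "'v \<Rightarrow> 'v \<Rightarrow> nat" where
  "num_arcs i j = card {e \<in> arcs Q. tail Q e = i \<and> head Q e = j}"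

text \<open>The symmetrised bilinear form in the multiplicities of the parts: a part of size \<open>k + 1\<close>
  contributes to the first \<open>k + 1\<close> of the vectors to which the Tits form is applied.\<close>

definition form :: "nat \<times> 'v \<Rightarrow> nat \<times> 'v \<Rightarrow> nat" where
  "form c d = Suc (min (fst c) (fst d)) *
     (num_arcs (snd c) (snd d) + num_arcs (snd d) (snd c) - (if snd c = snd d then 2 else 0))"

definition half_form :: "nat \<times> 'v \<Rightarrow> nat" where
  "half_form c = Suc (fst c) * (num_arcs (snd c) (snd c) - 1)"

sublocale colour_form form half_form
  by standard (auto simp: form_def half_form_def min.commute add.commute algebra_simps diff_mult_distrib2)

lemma num_arcs_loop: "i \<in> verts Q \<Longrightarrow> num_arcs i i \<ge> 1"
proof -
  assume "i \<in> verts Q"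
  then have "{e \<in> arcs Q. tail Q e = i \<and> head Q e = i} \<noteq> {}" using loops by auto
  then show ?thesis unfolding num_arcs_def by (simp add: Suc_le_eq card_gt_0_iff)
qed

text \<open>The loops enter here: they make the truncated subtraction in \<open>form\<close> exact
  for equal vertices. The additive form stays within the natural numbers.\<close>

lemma form_eq:
  assumes "snd c \<in> verts Q"
  shows "form c d + 2 * (Suc (min (fst c) (fst d)) * (if snd c = snd d then 1 else 0)) =
    Suc (min (fst c) (fst d)) * num_arcs (snd c) (snd d) + Suc (min (fst d) (fst c)) * num_arcs (snd d) (snd c)"
proof (cases "snd c = snd d")
  case True
  have "num_arcs (snd c) (snd c) \<ge> 1" using num_arcs_loop[OF assms] .
  then obtain n where "num_arcs (snd c) (snd c) = Suc n" by (metis Suc_le_D One_nat_def)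
  then show ?thesis using True by (simp add: form_def min.commute algebra_simps)
next
  case False
  then show ?thesis by (simp add: form_def min.commute algebra_simps)
qed

section \<open>From monomials back to multipartitions\<close>

text \<open>Undoes the passage to successive differences: a part at \<open>i\<close> is the sum of
  all later multiplicities at \<open>i\<close>, its own included.\<close>

definition part :: "(nat \<times> 'v \<Rightarrow>\<^sub>0 nat) \<Rightarrow> 'v \<Rightarrow> nat \<Rightarrow> nat" where
  "part m i k = lin (\<lambda>c. if snd c = i \<and> k \<le> fst c then 1 else 0) m"

lemma part_Suc: "part m i k = Poly_Mapping.lookup m (k, i) + part m i (Suc k)"
proof -
  have "part m i k = (\<Sum>c\<in>Poly_Mapping.keys m. Poly_Mapping.lookup m c * (if c = (k, i) then 1 else 0)) + part m i (Suc k)"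
    unfolding part_def lin_def sum.distrib[symmetric]
    by (rule sum.cong) (auto simp: prod_eq_iff)
  also have "(\<Sum>c\<in>Poly_Mapping.keys m. Poly_Mapping.lookup m c * (if c = (k, i) then 1 else 0)) = Poly_Mapping.lookup m (k, i)"
    by (auto simp: if_distrib in_keys_iff cong: if_cong)
  finally show ?thesis .
qed

lemma part_eq_0: "\<forall>c\<in>Poly_Mapping.keys m. fst c < k \<Longrightarrow> part m i k = 0"
  unfolding part_def lin_def by (intro sum.neutral) auto

lemma part_in_partitions: "part m i \<in> partitions"
proof -
  have "antimono (part m i)"
    
  proof (intro antimonoI, erule lift_Suc_antimono_le[rotated])
    show "part m i (Suc k) \<le> part m i k" for k using part_Suc[of m i k] by linarith
  qed
  moreover define K where "K = Suc (Max (insert 0 (fst ` Poly_Mapping.keys m)))"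
  have K: "part m i k = 0" if "k \<ge> K" for k
  proof (rule part_eq_0, rule ballI)
    fix c assume "c \<in> Poly_Mapping.keys m"
    then have "fst c \<le> Max (insert 0 (fst ` Poly_Mapping.keys m))" by (intro Max_ge) auto
    then show "fst c < k" using that by (simp add: K_def)
  qed
  then have "{k. part m i k \<noteq> 0} \<subseteq> {..<K}"
    unfolding subset_iff mem_Collect_eq lessThan_iff by (meson not_le)
  then have "finite {k. part m i k \<noteq> 0}" using finite_subset by blast
  ultimately show ?thesis by (simp add: partitions_def)
qed

text \<open>The sums over vertices and over arrows are expanded in the multiplicities. Two colours
  \<open>c\<close> and \<open>d\<close> meet at the indices \<open>k\<close> up to the smaller of
  their first components, which gives the factor \<open>Suc (min (fst c) (fst d))\<close> of
  \<open>form\<close>.\<close>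

lemma sum_tits_form:
  assumes verts: "snd ` Poly_Mapping.keys m \<subseteq> verts Q" and K: "\<forall>c\<in>Poly_Mapping.keys m. fst c < K"
  shows "- (\<Sum>k<K. tits_form Q (\<lambda>i. int (part m i k))) = int (quad m)"
proof -
  let ?M = "Poly_Mapping.lookup m" and ?k = "Poly_Mapping.keys m"
  let ?ind = "\<lambda>k i c. if snd c = i \<and> k \<le> fst c then (1 :: nat) else 0"
  let ?s = "\<lambda>c d. Suc (min (fst c) (fst d))"
  have prod: "part m i k * part m j k = (\<Sum>c\<in>?k. \<Sum>d\<in>?k. ?M c * ?M d * (?ind k i c * ?ind k j d))" for i j k
    unfolding part_def lin_def sum_product by (intro sum.cong refl) (simp only: mult_ac)
  have count: "(\<Sum>k<K. if k \<le> fst c \<and> k \<le> fst d then 1 else 0) = ?s c d" if "c \<in> ?k" for c d :: "nat \<times> 'v"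
  proof -
    have "{k \<in> {..<K}. k \<le> fst c \<and> k \<le> fst d} = {..min (fst c) (fst d)}" using K that by auto
    moreover have "(\<Sum>k<K. if k \<le> fst c \<and> k \<le> fst d then 1 else 0) = card {k \<in> {..<K}. k \<le> fst c \<and> k \<le> fst d}"
      by (simp add: sum.If_cases Int_def)
    ultimately show ?thesis by simp
  qed
  have sumE: "(\<Sum>k<K. \<Sum>e\<in>arcs Q. part m (tail Q e) k * part m (head Q e) k) =
      (\<Sum>c\<in>?k. \<Sum>d\<in>?k. ?M c * ?M d * (?s c d * num_arcs (snd c) (snd d)))"
  proof -
    have "(\<Sum>k<K. \<Sum>e\<in>arcs Q. ?ind k (tail Q e) c * ?ind k (head Q e) d) = ?s c d * num_arcs (snd c) (snd d)"
      if "c \<in> ?k" for c d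
    proof -
      have "(\<Sum>k<K. \<Sum>e\<in>arcs Q. ?ind k (tail Q e) c * ?ind k (head Q e) d) =
        (\<Sum>k<K. \<Sum>e\<in>arcs Q. (if k \<le> fst c \<and> k \<le> fst d then 1 else 0) *
          (if tail Q e = snd c \<and> head Q e = snd d then 1 else 0))"
        by (intro sum.cong refl) auto
      also have "\<dots> = ?s c d * (\<Sum>e\<in>arcs Q. if tail Q e = snd c \<and> head Q e = snd d then 1 else 0)"
        unfolding sum_product[symmetric] count[OF that] ..
      also have "(\<Sum>e\<in>arcs Q. if tail Q e = snd c \<and> head Q e = snd d then 1 else 0) = num_arcs (snd c) (snd d)"
        by (simp add: num_arcs_def sum.If_cases Int_def)
      finally show ?thesis .
    qed
    moreover have "(\<Sum>k<K. \<Sum>e\<in>arcs Q. part m (tail Q e) k * part m (head Q e) k) =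
      (\<Sum>c\<in>?k. \<Sum>d\<in>?k. \<Sum>k<K. \<Sum>e\<in>arcs Q. ?M c * ?M d * (?ind k (tail Q e) c * ?ind k (head Q e) d))"
      unfolding prod
      by (simp only: sum.swap[of _ "arcs Q" ?k] sum.swap[of _ "{..<K}" ?k])
    ultimately show ?thesis by (simp only: sum_distrib_left[symmetric]) (simp cong: sum.cong)
  qed
  have sumV: "(\<Sum>k<K. \<Sum>i\<in>verts Q. part m i k * part m i k) =
      (\<Sum>c\<in>?k. \<Sum>d\<in>?k. ?M c * ?M d * (?s c d * (if snd c = snd d then 1 else 0)))"
  proof -
    have "(\<Sum>k<K. \<Sum>i\<in>verts Q. ?ind k i c * ?ind k i d) = ?s c d * (if snd c = snd d then 1 else 0)"
      if "c \<in> ?k" for c d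
    proof -
      have "(\<Sum>k<K. \<Sum>i\<in>verts Q. ?ind k i c * ?ind k i d) =
        (\<Sum>k<K. \<Sum>i\<in>verts Q. (if k \<le> fst c \<and> k \<le> fst d then 1 else 0) *
          (if i = snd c \<and> snd c = snd d then 1 else 0))"
        by (intro sum.cong refl) auto
      also have "\<dots> = ?s c d * (\<Sum>i\<in>verts Q. if i = snd c \<and> snd c = snd d then 1 else 0)"
        unfolding sum_product[symmetric] count[OF that] ..
      also have "(\<Sum>i\<in>verts Q. if i = snd c \<and> snd c = snd d then 1 else 0) = (if snd c = snd d then 1 else 0)"
        using verts that by (auto simp: sum.delta)
      finally show ?thesis .
    qed
    moreover have "(\<Sum>k<K. \<Sum>i\<in>verts Q. part m i k * part m i k) =
      (\<Sum>c\<in>?k. \<Sum>d\<in>?k. \<Sum>k<K. \<Sum>i\<in>verts Q. ?M c * ?M d * (?ind k i c * ?ind k i d))"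
      unfolding prod
      by (simp only: sum.swap[of _ "verts Q" ?k] sum.swap[of _ "{..<K}" ?k])
    ultimately show ?thesis by (simp only: sum_distrib_left[symmetric]) (simp cong: sum.cong)
  qed
  have "lin (\<lambda>i. lin (form i) m) m + 2 * (\<Sum>c\<in>?k. \<Sum>d\<in>?k. ?M c * ?M d * (?s c d * (if snd c = snd d then 1 else 0)))
      = (\<Sum>c\<in>?k. \<Sum>d\<in>?k. ?M c * ?M d * (form c d + 2 * (?s c d * (if snd c = snd d then 1 else 0))))"
    unfolding lin_def sum_distrib_left sum.distrib[symmetric]
    by (intro sum.cong refl) (simp add: algebra_simps)
  also have "\<dots> = (\<Sum>c\<in>?k. \<Sum>d\<in>?k. ?M c * ?M d *
      (?s c d * num_arcs (snd c) (snd d) + ?s d c * num_arcs (snd d) (snd c)))"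
    using verts by (intro sum.cong refl arg_cong2[of _ _ _ _ "(*)"] form_eq) auto
  also have "\<dots> = (\<Sum>c\<in>?k. \<Sum>d\<in>?k. ?M c * ?M d * (?s c d * num_arcs (snd c) (snd d))) +
      (\<Sum>c\<in>?k. \<Sum>d\<in>?k. ?M d * ?M c * (?s d c * num_arcs (snd d) (snd c)))"
    unfolding sum.distrib[symmetric] by (intro sum.cong refl) (simp only: distrib_left mult_ac)
  also have "(\<Sum>c\<in>?k. \<Sum>d\<in>?k. ?M d * ?M c * (?s d c * num_arcs (snd d) (snd c))) =
      (\<Sum>c\<in>?k. \<Sum>d\<in>?k. ?M c * ?M d * (?s c d * num_arcs (snd c) (snd d)))"
    by (rule sum.swap)
  finally have "quad m + (\<Sum>k<K. \<Sum>i\<in>verts Q. part m i k * part m i k) =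
      (\<Sum>k<K. \<Sum>e\<in>arcs Q. part m (tail Q e) k * part m (head Q e) k)"
    unfolding sumE sumV quad_double[symmetric] by linarith
  then have "int (quad m) + int (\<Sum>k<K. \<Sum>i\<in>verts Q. part m i k * part m i k) =
      int (\<Sum>k<K. \<Sum>e\<in>arcs Q. part m (tail Q e) k * part m (head Q e) k)"
    by (simp only: of_nat_add[symmetric])
  then show ?thesis
    by (simp add: tits_form_def euler_ringel_form_def sum_subtractf)
qed

definition part_factor :: "('v \<Rightarrow> nat \<Rightarrow> nat) \<Rightarrow> nat \<Rightarrow> ratfun" where
  "part_factor lam k = ratfun_q powi (- tits_form Q (\<lambda>i. int (lam i k))) /
     qfact_vec Q (inverse ratfun_q) (\<lambda>i. lam i k - lam i (Suc k))"

definition part_monom :: "('v \<Rightarrow> nat \<Rightarrow> nat) \<Rightarrow> nat \<Rightarrow> nat \<times> 'v \<Rightarrow>\<^sub>0 nat" where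
  "part_monom lam k = (\<Sum>i\<in>verts Q. Poly_Mapping.single (k, i) (lam i k - lam i (Suc k)))"

lemma multipartition_bound:
  assumes "lam \<in> multipartitions Q"
  obtains K where "\<And>i k. i \<in> verts Q \<Longrightarrow> k \<ge> K \<Longrightarrow> lam i k = 0"
proof -
  have "finite (\<Union>i\<in>verts Q. {k. lam i k \<noteq> 0})"
    using assms by (auto simp: multipartitions_def partitions_def PiE_iff)
  then obtain K where "(\<Union>i\<in>verts Q. {k. lam i k \<noteq> 0}) \<subseteq> {..<K}"
    using finite_nat_bounded by blast
  then show thesis by (intro that[of K]) force
qed

lemma quiver_term:
  assumes K: "\<And>i k. i \<in> verts Q \<Longrightarrow> k \<ge> K \<Longrightarrow> lam i k = 0"
  shows "(\<Prod>k. mfps_const (part_factor lam k) *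
      (\<Prod>i\<in>verts Q. mfps_var (k, i) ^ (lam i k - lam i (Suc k)))) =
    mfps_monom (\<Sum>k<K. part_monom lam k) (\<Prod>k<K. part_factor lam k)"
proof -
  let ?G = "\<lambda>k. mfps_const (part_factor lam k) *
      (\<Prod>i\<in>verts Q. mfps_var (k, i) ^ (lam i k - lam i (Suc k)))"
  have G: "?G k = mfps_monom (part_monom lam k) (part_factor lam k)" for k
    unfolding mfps_var_power mfps_monom_prod by (simp add: mfps_monom_mult part_monom_def)
  have "?G k = 1" if "k \<ge> K" for k
  proof -
    have z: "lam i k = 0" "lam i (Suc k) = 0" if "i \<in> verts Q" for i
      using K that \<open>k \<ge> K\<close> by auto
    have "part_monom lam k = 0" unfolding part_monom_def by (intro sum.neutral) (simp add: z)
    moreover have "tits_form Q (\<lambda>i. int (lam i k)) = 0"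
      unfolding tits_form_def euler_ringel_form_def by (simp add: z)
    moreover have "qfact_vec Q (inverse ratfun_q) (\<lambda>i. lam i k - lam i (Suc k)) = 1"
      unfolding qfact_vec_def by (intro prod.neutral) (simp add: z)
    ultimately show ?thesis unfolding G by (simp add: part_factor_def mfps_monom_0_1)
  qed
  then have "{k. ?G k \<noteq> 1} \<subseteq> {..<K}" by (auto simp: not_le[symmetric])
  then have "(\<Prod>k. ?G k) = (\<Prod>k<K. ?G k)" by (intro Prod_any.expand_superset) auto
  then show ?thesis unfolding G mfps_monom_prod .
qed

lemma lookup_part_monoms:
  assumes K: "\<And>i k. i \<in> verts Q \<Longrightarrow> k \<ge> K \<Longrightarrow> lam i k = 0"
  shows "Poly_Mapping.lookup (\<Sum>k<K. part_monom lam k) (k, i) =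
    (if i \<in> verts Q then lam i k - lam i (Suc k) else 0)"
proof -
  have "Poly_Mapping.lookup (\<Sum>k'<K. part_monom lam k') (k, i) =
      (\<Sum>k'<K. \<Sum>j\<in>verts Q. if k' = k \<and> j = i then lam i k - lam i (Suc k) else 0)"
    unfolding part_monom_def lookup_sum
    by (intro sum.cong refl) (auto simp: lookup_single when_def)
  also have "\<dots> = (\<Sum>k'<K. if k' = k then (if i \<in> verts Q then lam i k - lam i (Suc k) else 0) else 0)"
    by (intro sum.cong refl) auto
  also have "\<dots> = (if i \<in> verts Q then lam i k - lam i (Suc k) else 0)"
    using K[of i k] by (auto simp: not_less)
  finally show ?thesis .
qed

text \<open>A partition is determined by its successive differences, so each monomial comes from at
  most one multipartition, and the coefficient is a single term of the sum.\<close>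

lemma quiver_series_nth:
  "mfps_nth (quiver_series Q) m =
    (if snd ` Poly_Mapping.keys m \<subseteq> verts Q
     then ratfun_q powi int (quad m) /
       (\<Prod>c\<in>Poly_Mapping.keys m. qfact (inverse ratfun_q) (Poly_Mapping.lookup m c))
     else 0)"
proof -
  let ?G = "\<lambda>lam. \<Prod>k. mfps_const (part_factor lam k) *
      (\<Prod>i\<in>verts Q. mfps_var (k, i) ^ (lam i k - lam i (Suc k)))"
  let ?P = "{lam \<in> multipartitions Q. mfps_nth (?G lam) m \<noteq> 0}"
  define lam0 where "lam0 = restrict (part m) (verts Q)"
  have series: "mfps_nth (quiver_series Q) m = (\<Sum>lam\<in>?P. mfps_nth (?G lam) m)"
    by (simp add: quiver_series_def mfps_suminf_def part_factor_def)
  have unique: "snd ` Poly_Mapping.keys m \<subseteq> verts Q \<and> lam = lam0" if lam: "lam \<in> ?P"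
    for lam :: "'v \<Rightarrow> nat \<Rightarrow> nat"
  proof -
    obtain K where K: "\<And>i k. i \<in> verts Q \<Longrightarrow> k \<ge> K \<Longrightarrow> lam i k = 0"
      using lam multipartition_bound[of lam] by blast
    have m: "m = (\<Sum>k<K. part_monom lam k)"
      using lam quiver_term[of K lam, OF K] by (auto simp: mfps_nth_monom split: if_splits)
    have look: "Poly_Mapping.lookup m (k, i) = (if i \<in> verts Q then lam i k - lam i (Suc k) else 0)" for k i
      unfolding m by (rule lookup_part_monoms[OF K])
    have keys: "snd ` Poly_Mapping.keys m \<subseteq> verts Q"
      using look by (auto simp: in_keys_iff split: if_splits)
    have "lam i k = part m i k" if i: "i \<in> verts Q" for i k
    proof -
      have anti: "lam i (Suc k) \<le> lam i k" for k
        using lam i by (auto simp: multipartitions_def partitions_def PiE_iff antimono_def)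
      have "fst c < K" if "c \<in> Poly_Mapping.keys m" for c
      proof (rule ccontr)
        assume "\<not> fst c < K"
        then show False using that look[of "fst c" "snd c"] K[of "snd c" "fst c"]
          by (auto simp: in_keys_iff split: if_splits)
      qed
      then have zero: "part m i k = 0" if "k \<ge> K" for k
        using that by (intro part_eq_0) force
      \<comment> \<open>Downward induction from \<open>K\<close>, from which index on both sides
        vanish.\<close>
      have "lam i (K - j) = part m i (K - j)" for j
      proof (induction j)
        case (Suc j)
        show ?case
        proof (cases "j < K")
          case True
          then have "Suc (K - Suc j) = K - j" by simp
          then show ?thesis
            using Suc anti[of "K - Suc j"] part_Suc[of m i "K - Suc j"] look[of "K - Suc j" i] i by simp
        qed (use Suc in simp)
      qed (use K[OF i] zero in simp)
      then have "lam i k = part m i k" if "k \<le> K" for k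
        using that by (metis diff_diff_cancel)
      then show ?thesis using K[OF i] zero by (cases "k \<le> K") auto
    qed
    moreover have "lam i = undefined" if "i \<notin> verts Q" for i :: 'v
      using lam that by (auto simp: multipartitions_def PiE_iff extensional_def)
    ultimately have "lam = lam0" by (auto simp: lam0_def fun_eq_iff restrict_def)
    then show ?thesis using keys by blast
  qed
  show ?thesis
  proof (cases "snd ` Poly_Mapping.keys m \<subseteq> verts Q")
    case False
    then have "?P = {}" using unique by blast
    then show ?thesis using False series by simp
  next
    case True
    define K where "K = Suc (Max (insert 0 (fst ` Poly_Mapping.keys m)))"
    have K: "\<forall>c\<in>Poly_Mapping.keys m. fst c < K"
    proof
      fix c assume "c \<in> Poly_Mapping.keys m"
      then have "fst c \<le> Max (insert 0 (fst ` Poly_Mapping.keys m))" by (intro Max_ge) auto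
      then show "fst c < K" by (simp add: K_def)
    qed
    have lam0_mem: "lam0 \<in> multipartitions Q"
      using part_in_partitions by (auto simp: lam0_def multipartitions_def)
    have lam0_0: "lam0 i k = 0" if "i \<in> verts Q" "k \<ge> K" for i k
      using that K by (auto simp: lam0_def intro!: part_eq_0)
    have m: "(\<Sum>k<K. part_monom lam0 k) = m"
    proof (rule poly_mapping_eqI)
      fix c :: "nat \<times> 'v"
      obtain k i where c: "c = (k, i)" by (cases c)
      have "Poly_Mapping.lookup m (k, i) = 0" if "i \<notin> verts Q"
        using True that by (force simp: in_keys_iff)
      moreover have look: "Poly_Mapping.lookup (\<Sum>k<K. part_monom lam0 k) (k, i) =
          (if i \<in> verts Q then lam0 i k - lam0 i (Suc k) else 0)"
        by (rule lookup_part_monoms[OF lam0_0])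
      ultimately show "Poly_Mapping.lookup (\<Sum>k<K. part_monom lam0 k) c = Poly_Mapping.lookup m c"
        unfolding c look using part_Suc[of m i k] by (simp add: lam0_def)
    qed
    have nth: "mfps_nth (?G lam0) m = (\<Prod>k<K. part_factor lam0 k)"
      using quiver_term[of K lam0, OF lam0_0] by (simp add: m mfps_nth_monom)
    have "mfps_nth (quiver_series Q) m = (\<Sum>lam\<in>{lam0}. mfps_nth (?G lam) m)"
      unfolding series
    proof (rule sum.mono_neutral_left)
      show "?P \<subseteq> {lam0}" using unique by blast
      show "\<forall>lam\<in>{lam0} - ?P. mfps_nth (?G lam) m = 0" using lam0_mem by blast
    qed simp
    also have "\<dots> = (\<Prod>k<K. part_factor lam0 k)" using nth by simp
    also have "\<dots> = (\<Prod>k<K. ratfun_q powi (- tits_form Q (\<lambda>i. int (part m i k)))) /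
        (\<Prod>k<K. \<Prod>i\<in>verts Q. qfact (inverse ratfun_q) (Poly_Mapping.lookup m (k, i)))"
    proof -
      have "tits_form Q (\<lambda>i. int (lam0 i k)) = tits_form Q (\<lambda>i. int (part m i k))" for k
        unfolding tits_form_def euler_ringel_form_def by (simp add: lam0_def)
      moreover have "qfact_vec Q z (\<lambda>i. lam0 i k - lam0 i (Suc k)) =
          (\<Prod>i\<in>verts Q. qfact z (Poly_Mapping.lookup m (k, i)))" for k and z :: ratfun
        unfolding qfact_vec_def using part_Suc[of m _ k] by (intro prod.cong refl) (simp add: lam0_def)
      ultimately show ?thesis by (simp add: part_factor_def prod_dividef)
    qed
    also have "(\<Prod>k<K. ratfun_q powi (- tits_form Q (\<lambda>i. int (part m i k)))) =
        ratfun_q powi (\<Sum>k<K. - tits_form Q (\<lambda>i. int (part m i k)))"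
      by (induction K) (simp_all add: power_int_add[symmetric] ratfun_q_neq_0)
    also have "(\<Sum>k<K. - tits_form Q (\<lambda>i. int (part m i k))) = int (quad m)"
      using sum_tits_form[OF True K] by (simp add: sum_negf)
    also have "(\<Prod>k<K. \<Prod>i\<in>verts Q. qfact (inverse ratfun_q) (Poly_Mapping.lookup m (k, i))) =
        (\<Prod>c\<in>Poly_Mapping.keys m. qfact (inverse ratfun_q) (Poly_Mapping.lookup m c))"
    proof -
      have "(\<Prod>k<K. \<Prod>i\<in>verts Q. qfact (inverse ratfun_q) (Poly_Mapping.lookup m (k, i))) =
          (\<Prod>c\<in>{..<K} \<times> verts Q. qfact (inverse ratfun_q) (Poly_Mapping.lookup m c))"
        by (simp add: prod.cartesian_product case_prod_unfold)
      also have "\<dots> = (\<Prod>c\<in>Poly_Mapping.keys m. qfact (inverse ratfun_q) (Poly_Mapping.lookup m c))"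
        using True K by (intro prod.mono_neutral_right) (auto simp: in_keys_iff image_subset_iff)
      finally show ?thesis .
    qed
    finally show ?thesis using True by simp
  qed
qed

lemma fls_of_quiver_series:
  "fls_of_ratfun (mfps_nth (quiver_series Q) m) = word_series_on (UNIV \<times> verts Q) m"
proof (cases "snd ` Poly_Mapping.keys m \<subseteq> verts Q")
  case True
  then have V: "Poly_Mapping.keys m \<subseteq> UNIV \<times> verts Q" by force
  define d where "d = (\<Prod>c\<in>Poly_Mapping.keys m. \<Prod>j=1..Poly_Mapping.lookup m c. (1 :: rat fls) - fls_X ^ j)"
  have d: "multiset_series m * d = 1" unfolding d_def by (rule multiset_series_qfact)
  then have "d \<noteq> 0" by auto
  then have ms: "multiset_series m = 1 / d" using d by (simp add: eq_divide_eq)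
  have "word_series m = fls_shift (int (quad m)) (multiset_series m)"
    by (simp add: multiset_series_def)
  also have "\<dots> = fls_X_inv ^ quad m * multiset_series m"
    by (simp add: fls_X_inv_power_conv_shift_1 fls_shifted_times_simps)
  finally have "word_series m = fls_X_inv ^ quad m / d" unfolding ms by simp
  moreover have "fls_of_ratfun (mfps_nth (quiver_series Q) m) = fls_X_inv ^ quad m / d"
    using True by (simp add: d_def quiver_series_nth fls_of_ratfun_divide fls_of_ratfun_power
        fls_of_ratfun_q fls_of_ratfun_prod fls_of_ratfun_qfact)
  ultimately show ?thesis using V by (simp add: word_series_on_def)
next
  case False
  then have V: "\<not> Poly_Mapping.keys m \<subseteq> UNIV \<times> verts Q" by force
  then show ?thesis using False by (simp add: quiver_series_nth word_series_on_def)
qed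

end

theorem theorem5p1:
  fixes Q :: "(nat, 'e) pre_digraph" and r :: nat
  assumes "fin_digraph Q"
    and "verts Q = {1..r}"
    and "\<forall>i \<in> verts Q. \<exists>a \<in> arcs Q. tail Q a = i \<and> head Q a = i"
  shows "\<forall>m. \<exists>p :: rat poly. (\<forall>n. coeff p n \<ge> 0) \<and>
           mfps_nth (mfps_const (ratfun_q - 1) * mfps_Log (quiver_series Q)) m = to_fract p"
proof -
  interpret loop_quiver Q by (rule loop_quiver.intro) (use assms in simp_all)
  show ?thesis using Log_positive[OF fls_of_quiver_series] by blast
qed

end
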